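(* Suppose the Markov chain $\Xi$ on $\mathbb X\subseteq\mathbb R$ satisfies $(\mathrm T^{\mathrm{out}}_{\alpha,\beta,c})$ and $(\mathrm D'_{\gamma,b})$, and let $q>0$, with $\tau_a:=\min\{n\ge0:|\xi_n|\le a\}$. Then for all $a$ sufficiently large and all $x$ with $|x|>a$: (i) if $\gamma>\alpha-1$, then $\mathbb E_x[\tau_a^q]<\infty$ for $q<1/\alpha$ and $=\infty$ for $q>1/\alpha$; (ii) if $\gamma=\alpha-1$ and $b<c\pi|\csc(\pi\alpha)|$, then $\mathbb E_x[\tau_a^q]<\infty$ for $q<\nu^\star/\alpha$ and $=\infty$ for $q>\nu^\star/\alpha$, where $\nu^\star\in(0,\alpha)$ is the unique solution of $\frac bc=(\nu^\star-1)\frac{\Gamma(1-\alpha)\Gamma(\alpha-\nu^\star)}{\Gamma(2-\nu^\star)}$; (iii) if $\gamma<\alpha-1$ and $b<0$, then $\mathbb E_x[\tau_a^q]<\infty$ for $q<\frac{\alpha}{\gamma+1}$ and $=\infty$ for $q\ge\frac{\alpha}{\gamma+1}$.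
   Context: $\Xi=(\xi_n)_{n\ge0}$ is a time-homogeneous Markov chain on an infinite, unbounded, measurable $\mathbb X\subseteq\mathbb R$. $\mathbb P_x,\mathbb E_x$ refer to the chain started at $x$; $\theta:=\xi_1-\xi_0$; $y_+:=y\mathbf 1\{y\ge0\}$, $y_-:=-y\mathbf 1\{y<0\}$; $\mu(x):=\mathbb E_x[\theta]$. $\Gamma$ is the gamma function. $(\mathrm T^{\mathrm{out}}_{\alpha,\beta,c})$: there exist $\alpha\in(1,2)$, $\beta>\alpha$, $c>0$, $x_0\in\mathbb R_+$ with $\lim_{y\to\infty}\sup_{x\ge x_0}|y^\alpha\mathbb P_x[\theta_+>y]-c|=\lim_{y\to\infty}\sup_{x\le -x_0}|y^\alpha\mathbb P_x[\theta_->y]-c|=0$, $\sup_{x\ge x_0}\mathbb E_x[\theta_-^\beta]<\infty$, and $\sup_{x\le-x_0}\mathbb E_x[\theta_+^\beta]<\infty$. $(\mathrm D'_{\gamma,b})$: there exist $\gamma\ge0$, $b\in\mathbb R$ with $\lim_{x\to+\infty}x^\gamma\mu(x)=\lim_{x\to-\infty}(-|x|^\gamma\mu(x))=b$. *)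

theory Defs
  imports "HOL-Probability.Probability"
begin

definition ppart :: "real \<Rightarrow> real" where
  "ppart y = (if y \<ge> 0 then y else 0)"
definition npart :: "real \<Rightarrow> real" where
  "npart y = (if y < 0 then - y else 0)"

text \<open>The chain is described by its one-step transition kernel K: the law of
  xi_{n+1} given xi_n = x is K x. So P_x[theta in S] = K x {z. z - x in S}.\<close>

definition is_kernel_on :: "real set \<Rightarrow> (real \<Rightarrow> real measure) \<Rightarrow> bool" where
  "is_kernel_on X K \<longleftrightarrow> K \<in> borel \<rightarrow>\<^sub>M prob_algebra borel \<and> (\<forall>x\<in>X. emeasure (K x) X = 1)"

definition markov_chain_from ::
  "'w measure \<Rightarrow> (nat \<Rightarrow> 'w \<Rightarrow> real) \<Rightarrow> (real \<Rightarrow> real measure) \<Rightarrow> real \<Rightarrow> bool" where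
  "markov_chain_from M \<xi> K x \<longleftrightarrow>
     prob_space M \<and> (\<forall>n. \<xi> n \<in> borel_measurable M) \<and> (AE \<omega> in M. \<xi> 0 \<omega> = x) \<and>
     (\<forall>n (A :: nat \<Rightarrow> real set) B. (\<forall>i\<le>n. A i \<in> sets borel) \<longrightarrow> B \<in> sets borel \<longrightarrow>
        measure M {\<omega>\<in>space M. (\<forall>i\<le>n. \<xi> i \<omega> \<in> A i) \<and> \<xi> (Suc n) \<omega> \<in> B} =
        (\<integral>\<omega>. indicator {\<omega>\<in>space M. \<forall>i\<le>n. \<xi> i \<omega> \<in> A i} \<omega> * measure (K (\<xi> n \<omega>)) B \<partial>M))"

definition hit_time :: "real \<Rightarrow> (nat \<Rightarrow> 'w \<Rightarrow> real) \<Rightarrow> 'w \<Rightarrow> enat" where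
  "hit_time a \<xi> \<omega> = (if \<exists>n. \<bar>\<xi> n \<omega>\<bar> \<le> a then enat (LEAST n. \<bar>\<xi> n \<omega>\<bar> \<le> a) else \<infinity>)"

definition hit_moment :: "'w measure \<Rightarrow> (nat \<Rightarrow> 'w \<Rightarrow> real) \<Rightarrow> real \<Rightarrow> real \<Rightarrow> ennreal" where
  "hit_moment M \<xi> a q = (\<integral>\<^sup>+\<omega>. (case hit_time a \<xi> \<omega> of enat n \<Rightarrow> ennreal (real n powr q) | \<infinity> \<Rightarrow> \<infinity>) \<partial>M)"

definition drift :: "(real \<Rightarrow> real measure) \<Rightarrow> real \<Rightarrow> real" where
  "drift K x = (\<integral>z. z - x \<partial>K x)"

text \<open>Condition (T^out_{alpha,beta,c}); the uniform limits of the suprema are written out.\<close>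
definition T_out :: "real set \<Rightarrow> (real \<Rightarrow> real measure) \<Rightarrow> real \<Rightarrow> real \<Rightarrow> real \<Rightarrow> bool" where
  "T_out X K \<alpha> \<beta> c \<longleftrightarrow> 1 < \<alpha> \<and> \<alpha> < 2 \<and> \<beta> > \<alpha> \<and> c > 0 \<and>
    (\<exists>x0\<ge>0.
      (\<forall>\<epsilon>>0. \<exists>Y. \<forall>y\<ge>Y. \<forall>x\<in>X. x \<ge> x0 \<longrightarrow>
          \<bar>y powr \<alpha> * measure (K x) {z. ppart (z - x) > y} - c\<bar> \<le> \<epsilon>) \<and>
      (\<forall>\<epsilon>>0. \<exists>Y. \<forall>y\<ge>Y. \<forall>x\<in>X. x \<le> - x0 \<longrightarrow>
          \<bar>y powr \<alpha> * measure (K x) {z. npart (z - x) > y} - c\<bar> \<le> \<epsilon>) \<and>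
      (SUP x\<in>{x\<in>X. x \<ge> x0}. \<integral>\<^sup>+z. ennreal (npart (z - x) powr \<beta>) \<partial>K x) < \<top> \<and>
      (SUP x\<in>{x\<in>X. x \<le> - x0}. \<integral>\<^sup>+z. ennreal (ppart (z - x) powr \<beta>) \<partial>K x) < \<top>)"

definition D' :: "real set \<Rightarrow> (real \<Rightarrow> real measure) \<Rightarrow> real \<Rightarrow> real \<Rightarrow> bool" where
  "D' X K \<gamma> b \<longleftrightarrow> \<gamma> \<ge> 0 \<and>
    ((\<lambda>x. x powr \<gamma> * drift K x) \<longlongrightarrow> b) (inf at_top (principal X)) \<and>
    ((\<lambda>x. - (\<bar>x\<bar> powr \<gamma> * drift K x)) \<longlongrightarrow> b) (inf at_bot (principal X))"

end

theory Submission
  imports Defs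
begin

text \<open>
  All estimates are made for the survival probabilities \<open>P\<^sub>x(\<tau>\<^sub>a > n)\<close>, which satisfy a recursion
  in the transition kernel; upper and lower bounds of the form \<open>n\<^bsup>-p\<^esup>\<close> follow by exhibiting super- and
  subsolutions of that recursion, by induction on \<open>n\<close>, without any stopping theorem. The solutions are
  built from \<open>\<bar>x\<bar>\<^sup>\<nu>\<close>. With \<open>\<nu> < \<alpha>\<close> and \<open>\<gamma> = \<alpha> - 1\<close>, the expected increment of \<open>\<bar>x\<bar>\<^sup>\<nu>\<close> is
  \<open>\<nu> (b + c J) \<bar>x\<bar>\<^bsup>\<nu>-\<alpha>\<^esup>\<close> to leading order, where \<open>J\<close> is the integral of
  \<open>((1 + v)\<^bsup>\<nu>-1\<^esup> - 1) v\<^bsup>-\<alpha>\<^esup>\<close> over the half-line; \<open>\<nu>\<^sup>\<star>\<close> is the exponent at which this changes sign.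
  For \<open>\<gamma> < \<alpha> - 1\<close> the drift dominates and the infinite moments come from a single outward jump.
  The case \<open>\<gamma> > \<alpha> - 1\<close> is the critical case with \<open>b = 0\<close>, hence \<open>\<nu>\<^sup>\<star> = 1\<close>.
\<close>

section \<open>Integrals of stable type\<close>

text \<open>Only the tails of the outward jumps are known, so every expectation over a jump is
  rewritten, by Fubini, as an integral against tail probabilities. The linear part of the power is
  split off first: it belongs to the drift assumption, and what remains is integrable against
  \<open>v powr (- \<alpha>)\<close> at 0 because \<alpha> < 2 and at infinity because \<nu> <
  \<alpha> and 1 < \<alpha>. Inward jumps have a moment of order \<beta> > \<alpha> and enter at the
  smaller order |x|^(-\<beta>). The obstacle to lower bounds is that a subsolution must stay below 1
  while |x|^\<nu> is unbounded, and truncation destroys its drift at high levels. There a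
  persistence estimate takes over: started far above h, the chain stays above h for h^s steps with
  probability at least 1/2, where s = \<gamma> + 1 is the exponent of the time scale. Persistence
  comes from a decreasing power of |x|, whose expectation grows by a factor of at most 1 + C h^(-s)
  per step. Taking h = n^(1/s) turns an exponent \<nu> in space into \<nu>/s in time.\<close>

lemma nn_integral_layer_cake:
  fixes \<psi> :: "real \<Rightarrow> ennreal"
  assumes [measurable]: "\<psi> \<in> borel_measurable borel"
    and N: "sigma_finite_measure N" "sets N = sets borel"
  shows "(\<integral>\<^sup>+t. (\<integral>\<^sup>+v. \<psi> v * indicator {0<..<t} v \<partial>lborel) \<partial>N) =
    (\<integral>\<^sup>+v. \<psi> v * indicator {0<..} v * emeasure N {v<..} \<partial>lborel)"
proof -
  interpret N: sigma_finite_measure N by fact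
  interpret pair_sigma_finite N lborel
    by (rule pair_sigma_finite.intro) (auto intro: N lborel.sigma_finite_measure_axioms)
  have [measurable_cong]: "sets N = sets borel" by fact
  have sp: "space N = UNIV" using N(2) sets_eq_imp_space_eq[of N borel] by simp
  have [measurable]: "(\<lambda>(t,v). \<psi> v * indicator {0<..<t} v) \<in> borel_measurable (N \<Otimes>\<^sub>M lborel)"
  proof -
    have "(\<lambda>(t,v). \<psi> v * indicator {0<..<t} v) = (\<lambda>(t,v). if 0 < v \<and> v < t then \<psi> v else 0)"
      by (auto simp: indicator_def)
    also have "\<dots> \<in> borel_measurable (N \<Otimes>\<^sub>M lborel)" by measurable
    finally show ?thesis .
  qed
  \<comment> \<open>The region is 0 < v < t, so integrating over t first collects the mass of
    \<open>N\<close> beyond v. Sigma-finiteness is the right generality: \<open>N\<close> will be a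
    jump law, but also the infinite measure with density \<open>t powr (- \<alpha>)\<close>.\<close>
  have "(\<integral>\<^sup>+t. (\<integral>\<^sup>+v. \<psi> v * indicator {0<..<t} v \<partial>lborel) \<partial>N) =
        (\<integral>\<^sup>+v. (\<integral>\<^sup>+t. \<psi> v * indicator {0<..<t} v \<partial>N) \<partial>lborel)"
    using Fubini'[of "\<lambda>t v. \<psi> v * indicator {0<..<t} v"] by simp
  also have "\<dots> = (\<integral>\<^sup>+v. \<psi> v * indicator {0<..} v * emeasure N {v<..} \<partial>lborel)"
  proof (rule nn_integral_cong)
    fix v :: real
    have "(\<integral>\<^sup>+t. \<psi> v * indicator {0<..<t} v \<partial>N) = (\<integral>\<^sup>+t. \<psi> v * indicator {0<..} v * indicator {v<..} t \<partial>N)"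
      by (rule nn_integral_cong) (auto simp: indicator_def)
    also have "\<dots> = \<psi> v * indicator {0<..} v * emeasure N {v<..}"
      by (subst nn_integral_cmult) (auto simp: N(2))
    finally show "(\<integral>\<^sup>+t. \<psi> v * indicator {0<..<t} v \<partial>N) = \<psi> v * indicator {0<..} v * emeasure N {v<..}" .
  qed
  finally show ?thesis .
qed

section \<open>Gamma, Beta and power integrals\<close>

lemma Gamma_nn_integral_scaled:
  fixes s l :: real
  assumes "s > 0" "l > 0"
  shows "(\<integral>\<^sup>+t. ennreal (t powr (s - 1) * exp (- (l * t)) * indicator {0<..} t) \<partial>lborel) =
         ennreal (Gamma s * l powr (- s))"
proof -
  have "ennreal (Gamma s) = (\<integral>\<^sup>+t. ennreal (indicator {0..} t * t powr (s - 1) / exp t) \<partial>lborel)"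
    by (rule Gamma_conv_nn_integral_real) fact
  also have "\<dots> = ennreal \<bar>l\<bar> * (\<integral>\<^sup>+t. ennreal (indicator {0..} (0 + l * t) * (0 + l * t) powr (s - 1) / exp (0 + l * t)) \<partial>lborel)"
    using assms by (intro nn_integral_real_affine) auto
  also have "\<dots> = ennreal l * (\<integral>\<^sup>+t. ennreal (l powr (s - 1)) * ennreal (t powr (s - 1) * exp (- (l * t)) * indicator {0<..} t) \<partial>lborel)"
    using assms by (intro arg_cong2[of _ _ _ _ "(*)"] nn_integral_cong)
      (auto simp: indicator_def ennreal_mult[symmetric] powr_mult exp_minus field_simps zero_le_mult_iff mult_less_0_iff)
  also have "\<dots> = ennreal (l powr s) * (\<integral>\<^sup>+t. ennreal (t powr (s - 1) * exp (- (l * t)) * indicator {0<..} t) \<partial>lborel)"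
    using assms by (subst nn_integral_cmult)
      (auto simp: mult.assoc[symmetric] ennreal_mult[symmetric] powr_diff)
  finally have *: "ennreal (Gamma s) = ennreal (l powr s) * (\<integral>\<^sup>+t. ennreal (t powr (s - 1) * exp (- (l * t)) * indicator {0<..} t) \<partial>lborel)" .
  have "ennreal (Gamma s * l powr (- s)) = ennreal (l powr (-s)) * ennreal (Gamma s)"
    using assms by (simp add: ennreal_mult[symmetric] mult.commute less_imp_le)
  also have "\<dots> = (\<integral>\<^sup>+t. ennreal (t powr (s - 1) * exp (- (l * t)) * indicator {0<..} t) \<partial>lborel)"
    unfolding * using assms by (simp add: mult.assoc[symmetric] ennreal_mult[symmetric] powr_minus)
  finally show ?thesis by simp
qed

text \<open>Writing \<open>(1 + v)\<^sup>-\<^sup>(\<^sup>p\<^sup>+\<^sup>q\<^sup>)\<close> as a Gamma integral reduces the claim to two Gamma integrals.\<close>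

lemma nn_integral_Beta_half_line:
  fixes p q :: real
  assumes "p > 0" "q > 0"
  shows "(\<integral>\<^sup>+v. ennreal (v powr (p - 1) * (1 + v) powr (- (p + q)) * indicator {0<..} v) \<partial>lborel) =
         ennreal (Gamma p * Gamma q / Gamma (p + q))"
proof -
  have "(\<integral>\<^sup>+v. ennreal (v powr (p - 1) * (Gamma (p + q) * (1 + v) powr (- (p + q))) * indicator {0<..} v) \<partial>lborel)
    = (\<integral>\<^sup>+v. (\<integral>\<^sup>+t. ennreal (v powr (p - 1) * indicator {0<..} v) * ennreal (t powr (p + q - 1) * exp (- ((1 + v) * t)) * indicator {0<..} t) \<partial>lborel) \<partial>lborel)"
  proof (rule nn_integral_cong)
    fix v :: real
    show "ennreal (v powr (p - 1) * (Gamma (p + q) * (1 + v) powr (- (p + q))) * indicator {0<..} v) =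
      (\<integral>\<^sup>+t. ennreal (v powr (p - 1) * indicator {0<..} v) * ennreal (t powr (p + q - 1) * exp (- ((1 + v) * t)) * indicator {0<..} t) \<partial>lborel)"
    proof (cases "v > 0")
      case True
      then have "Gamma (p + q) > 0" using assms by (intro Gamma_real_pos) auto
      then show ?thesis using True assms
        by (subst nn_integral_cmult, simp, subst Gamma_nn_integral_scaled)
          (auto simp: ennreal_mult[symmetric])
    qed auto
  qed
  also have "\<dots> = (\<integral>\<^sup>+t. (\<integral>\<^sup>+v. ennreal (v powr (p - 1) * indicator {0<..} v) * ennreal (t powr (p + q - 1) * exp (- ((1 + v) * t)) * indicator {0<..} t) \<partial>lborel) \<partial>lborel)"
    by (rule lborel_pair.Fubini') measurable
  also have "\<dots> = (\<integral>\<^sup>+t. ennreal (Gamma p) * ennreal (t powr (q - 1) * exp (- (1 * t)) * indicator {0<..} t) \<partial>lborel)"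
  proof (rule nn_integral_cong)
    fix t :: real
    show "(\<integral>\<^sup>+v. ennreal (v powr (p - 1) * indicator {0<..} v) * ennreal (t powr (p + q - 1) * exp (- ((1 + v) * t)) * indicator {0<..} t) \<partial>lborel)
      = ennreal (Gamma p) * ennreal (t powr (q - 1) * exp (- (1 * t)) * indicator {0<..} t)"
    proof (cases "t > 0")
      case True
      have G: "Gamma p > 0" using assms by auto
      have "(\<integral>\<^sup>+v. ennreal (v powr (p - 1) * indicator {0<..} v) * ennreal (t powr (p + q - 1) * exp (- ((1 + v) * t)) * indicator {0<..} t) \<partial>lborel)
        = (\<integral>\<^sup>+v. ennreal (t powr (p + q - 1) * exp (- t)) * ennreal (v powr (p - 1) * exp (- (t * v)) * indicator {0<..} v) \<partial>lborel)"
        using True by (intro nn_integral_cong) (auto simp: ennreal_mult[symmetric] ring_distribs exp_add[symmetric] exp_diff exp_minus field_simps)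
      also have "\<dots> = ennreal (t powr (p + q - 1) * exp (- t)) * ennreal (Gamma p * t powr (- p))"
        using True assms by (subst nn_integral_cmult, simp, subst Gamma_nn_integral_scaled) auto
      also have "\<dots> = ennreal (Gamma p) * ennreal (t powr (q - 1) * exp (- (1 * t)) * indicator {0<..} t)"
      proof -
        have "t powr (p + q - 1) = t powr p * t powr (q - 1)"
          by (simp add: powr_add[symmetric] algebra_simps)
        moreover have "t powr (- p) = 1 / t powr p" by (simp add: powr_minus_divide)
        ultimately show ?thesis using True G by (simp add: ennreal_mult[symmetric])
      qed
      finally show ?thesis .
    qed auto
  qed
  also have "\<dots> = ennreal (Gamma p * Gamma q)"
    using assms by (subst nn_integral_cmult, simp, subst Gamma_nn_integral_scaled)
      (auto simp: ennreal_mult less_imp_le)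
  finally have *: "(\<integral>\<^sup>+v. ennreal (v powr (p - 1) * (Gamma (p + q) * (1 + v) powr (- (p + q))) * indicator {0<..} v) \<partial>lborel) = ennreal (Gamma p * Gamma q)" .
  have G: "Gamma (p + q) > 0" using assms by (intro Gamma_real_pos) auto
  have "(\<integral>\<^sup>+v. ennreal (v powr (p - 1) * (1 + v) powr (- (p + q)) * indicator {0<..} v) \<partial>lborel)
    = (\<integral>\<^sup>+v. ennreal (1 / Gamma (p + q)) * ennreal (v powr (p - 1) * (Gamma (p + q) * (1 + v) powr (- (p + q))) * indicator {0<..} v) \<partial>lborel)"
    using G by (intro nn_integral_cong) (auto simp: ennreal_mult[symmetric] indicator_def)
  also have "\<dots> = ennreal (1 / Gamma (p + q)) * ennreal (Gamma p * Gamma q)"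
    by (subst nn_integral_cmult) (simp_all only: *, measurable)
  also have "\<dots> = ennreal (Gamma p * Gamma q / Gamma (p + q))"
    using G assms by (subst ennreal_mult[symmetric]) (auto simp: less_imp_le)
  finally show ?thesis .
qed

lemma nn_integral_powr_tail:
  fixes v :: real
  assumes "v > 0" "a > 1"
  shows "(\<integral>\<^sup>+t. ennreal (t powr (- a) * indicator {v<..} t) \<partial>lborel) = ennreal (v powr (1 - a) / (a - 1))"
proof -
  have "(\<integral>\<^sup>+t. ennreal (t powr (- a) * indicator {v<..} t) \<partial>lborel) = (\<integral>\<^sup>+t. ennreal (t powr (- a)) * indicator {v..} t \<partial>lborel)"
    using AE_lborel_singleton[of v]
    by (intro nn_integral_cong_AE) (auto elim!: eventually_mono simp: indicator_def)
  also have "\<dots> = ennreal (0 - v powr (1 - a) / (1 - a))"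
  proof (rule nn_integral_FTC_atLeast)
    show "((\<lambda>t. t powr (1 - a) / (1 - a)) \<longlongrightarrow> 0) at_top"
    proof -
      have "((\<lambda>t::real. t powr (1 - a)) \<longlongrightarrow> 0) at_top"
        using assms by (intro tendsto_neg_powr filterlim_ident) auto
      then show ?thesis using tendsto_divide[OF _ tendsto_const[of "1 - a"], of "\<lambda>t. t powr (1 - a)" 0 at_top] assms by auto
    qed
    show "((\<lambda>t. t powr (1 - a) / (1 - a)) has_real_derivative x powr - a) (at x)" if "v \<le> x" for x
    proof -
      have "((\<lambda>t. t powr (1 - a) / (1 - a)) has_real_derivative (1 - a) * x powr (1 - a - 1) / (1 - a)) (at x)"
        using that assms by (intro DERIV_cdivide has_real_derivative_powr) auto
      then show ?thesis using assms by simp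
    qed
  qed auto
  also have "0 - v powr (1 - a) / (1 - a) = v powr (1 - a) / (a - 1)"
    using assms by (simp add: field_simps)
  finally show ?thesis .
qed

text \<open>Dividing by \<nu> - 1 keeps the value nonnegative for either sign of \<nu> - 1, as
  nonnegative integration demands; at \<nu> = 1 the antiderivative would be a logarithm.\<close>

lemma nn_integral_incr_powr:
  fixes t \<nu> :: real
  assumes "t > 0" "\<nu> \<noteq> 1"
  shows "(\<integral>\<^sup>+v. ennreal ((1 + v) powr (\<nu> - 2)) * indicator {0<..<t} v \<partial>lborel) =
    ennreal (((1 + t) powr (\<nu> - 1) - 1) / (\<nu> - 1))"
proof -
  have "(\<integral>\<^sup>+v. ennreal ((1 + v) powr (\<nu> - 2)) * indicator {0<..<t} v \<partial>lborel) =
     (\<integral>\<^sup>+v. ennreal ((1 + v) powr (\<nu> - 2)) * indicator {0..t} v \<partial>lborel)"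
    using AE_lborel_singleton[of 0] AE_lborel_singleton[of t]
    by (intro nn_integral_cong_AE) (auto elim!: eventually_elim2 simp: indicator_def)
  also have "\<dots> = ennreal ((1 + t) powr (\<nu> - 1) / (\<nu> - 1) - (1 + 0) powr (\<nu> - 1) / (\<nu> - 1))"
  proof (intro nn_integral_FTC_Icc)
    fix x assume x: "x \<in> {0..t}"
    have "((\<lambda>v. (1 + v) powr (\<nu> - 1) / (\<nu> - 1)) has_real_derivative (\<nu> - 1) * (1 + x) powr (\<nu> - 1 - 1) * 1 / (\<nu> - 1)) (at x)"
      using x by (intro DERIV_cdivide DERIV_fun_powr) (auto intro!: derivative_eq_intros)
    then show "((\<lambda>v. (1 + v) powr (\<nu> - 1) / (\<nu> - 1)) has_real_derivative (1 + x) powr (\<nu> - 2)) (at x)"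
      using assms by simp
  qed (use assms in auto)
  finally show ?thesis by (simp add: diff_divide_distrib)
qed

section \<open>The stable coefficient as an integral\<close>

lemma Gamma_two_minus:
  fixes \<alpha> :: real
  assumes "1 < \<alpha>" "\<alpha> < 2"
  shows "Gamma (2 - \<alpha>) = (1 - \<alpha>) * Gamma (1 - \<alpha>)"
proof -
  have "1 - \<alpha> \<notin> \<int>\<^sub>\<le>\<^sub>0"
  proof
    assume "1 - \<alpha> \<in> \<int>\<^sub>\<le>\<^sub>0"
    then obtain n where "1 - \<alpha> = real_of_int n" by (auto elim: nonpos_Ints_cases)
    with assms have "real_of_int (- 1) < real_of_int n" "real_of_int n < real_of_int 0" by auto
    then show False unfolding of_int_less_iff by auto
  qed
  then show ?thesis using Gamma_plus1[of "1 - \<alpha>"] by simp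
qed

text \<open>Minus the integral J of the overview, in closed form. The bracketing is that of the
  equation for \<open>\<nu>\<^sup>\<star>\<close> in the theorem, so that the equation folds to
  \<open>b / c = stable_coeff \<alpha> \<nu>\<close>.\<close>

definition stable_coeff :: "real \<Rightarrow> real \<Rightarrow> real" where
  "stable_coeff \<alpha> \<nu> = (\<nu> - 1) * (Gamma (1 - \<alpha>) * Gamma (\<alpha> - \<nu>) / Gamma (2 - \<nu>))"

text \<open>After division by \<nu> - 1 the integrand is nonnegative and the layer-cake formula
  applies to the measure with density \<open>t powr (- \<alpha>)\<close>; its tails are powers,
  which leaves a Beta integral. Negative \<nu> are covered because persistence uses \<nu> =
  -(\<beta> - \<alpha>).\<close>

lemma has_bochner_integral_stable:
  fixes \<alpha> \<nu> :: real
  assumes "1 < \<alpha>" "\<alpha> < 2" "\<nu> < \<alpha>"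
  shows "has_bochner_integral lborel
    (\<lambda>v. ((1 + v) powr (\<nu> - 1) - 1) * v powr (- \<alpha>) * indicator {0<..} v) (- stable_coeff \<alpha> \<nu>)"
proof (cases "\<nu> = 1")
  case True
  then have "(\<lambda>v. ((1 + v) powr (\<nu> - 1) - 1) * v powr (- \<alpha>) * indicator {0<..} v) = (\<lambda>_. 0)"
    by (auto simp: fun_eq_iff indicator_def)
  then show ?thesis using True by (simp add: stable_coeff_def has_bochner_integral_iff)
next
  case False
  define N where "N = density lborel (\<lambda>t::real. ennreal (t powr (- \<alpha>) * indicator {0<..} t))"
  have sN: "sigma_finite_measure N"
    unfolding N_def by (subst sigma_finite_measure.sigma_finite_iff_density_finite[OF lborel.sigma_finite_measure_axioms]) auto
  have N: "sets N = sets borel" unfolding N_def by simp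
  have Ntail: "emeasure N {v<..} = ennreal (v powr (1 - \<alpha>) / (\<alpha> - 1))" if "v > 0" for v
  proof -
    have "emeasure N {v<..} = (\<integral>\<^sup>+t. ennreal (t powr (- \<alpha>) * indicator {v<..} t) \<partial>lborel)"
      unfolding N_def using that by (subst emeasure_density) (auto intro!: nn_integral_cong simp: indicator_def)
    then show ?thesis using that assms by (simp add: nn_integral_powr_tail)
  qed
  have nonneg: "((1 + t) powr (\<nu> - 1) - 1) / (\<nu> - 1) \<ge> 0" if "t > 0" for t
  proof (cases "\<nu> > 1")
    case True then show ?thesis using that by (simp add: ge_one_powr_ge_zero)
  next
    case False
    then have "(1 + t) powr (\<nu> - 1) \<le> 1 powr (\<nu> - 1)" using that by (intro powr_mono2') auto
    then show ?thesis using False by (simp add: divide_nonpos_nonpos)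
  qed
  \<comment> \<open>The factor 1 - \<alpha> from the recurrence of Gamma cancels the \<alpha> - 1 of
    the tail and leaves the minus sign.\<close>
  have val: "Gamma (2 - \<alpha>) * Gamma (\<alpha> - \<nu>) / Gamma (2 - \<nu>) / (\<alpha> - 1) = - stable_coeff \<alpha> \<nu> / (\<nu> - 1)"
  proof -
    have "Gamma (2 - \<alpha>) / (\<alpha> - 1) = - Gamma (1 - \<alpha>)" using assms Gamma_two_minus[OF assms(1,2)] by (simp add: divide_eq_eq algebra_simps)
    moreover have "Gamma (2 - \<alpha>) * Gamma (\<alpha> - \<nu>) / Gamma (2 - \<nu>) / (\<alpha> - 1) =
        Gamma (2 - \<alpha>) / (\<alpha> - 1) * (Gamma (\<alpha> - \<nu>) / Gamma (2 - \<nu>))" by simp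
    ultimately show ?thesis using False by (simp add: stable_coeff_def)
  qed
  have pos: "- stable_coeff \<alpha> \<nu> / (\<nu> - 1) \<ge> 0"
    unfolding val[symmetric] using assms by (intro divide_nonneg_nonneg mult_nonneg_nonneg) (auto intro!: less_imp_le Gamma_real_pos)
  have "(\<integral>\<^sup>+t. ennreal (((1 + t) powr (\<nu> - 1) - 1) / (\<nu> - 1) * t powr (- \<alpha>) * indicator {0<..} t) \<partial>lborel)
    = (\<integral>\<^sup>+t. ennreal (t powr (- \<alpha>) * indicator {0<..} t) * (\<integral>\<^sup>+v. ennreal ((1 + v) powr (\<nu> - 2)) * indicator {0<..<t} v \<partial>lborel) \<partial>lborel)"
  proof (rule nn_integral_cong)
    fix t :: real
    show "ennreal (((1 + t) powr (\<nu> - 1) - 1) / (\<nu> - 1) * t powr (- \<alpha>) * indicator {0<..} t) =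
     ennreal (t powr (- \<alpha>) * indicator {0<..} t) * (\<integral>\<^sup>+v. ennreal ((1 + v) powr (\<nu> - 2)) * indicator {0<..<t} v \<partial>lborel)"
    proof (cases "t > 0")
      case True
      then show ?thesis using nonneg[OF True] False
        by (subst nn_integral_incr_powr) (simp_all add: ennreal_mult[symmetric] mult.commute)
    qed auto
  qed
  also have "\<dots> = (\<integral>\<^sup>+t. (\<integral>\<^sup>+v. ennreal ((1 + v) powr (\<nu> - 2)) * indicator {0<..<t} v \<partial>lborel) \<partial>N)"
  proof -
    have "(\<lambda>t. \<integral>\<^sup>+v. ennreal ((1 + v) powr (\<nu> - 2)) * indicator {0<..<t} v \<partial>lborel) =
      (\<lambda>t. if t > 0 then ennreal (((1 + t) powr (\<nu> - 1) - 1) / (\<nu> - 1)) else 0)"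
      using False by (auto simp: nn_integral_incr_powr)
    also have "\<dots> \<in> borel_measurable lborel" by measurable
    finally show ?thesis unfolding N_def by (subst nn_integral_density) auto
  qed
  also have "\<dots> = (\<integral>\<^sup>+v. ennreal ((1 + v) powr (\<nu> - 2)) * indicator {0<..} v * emeasure N {v<..} \<partial>lborel)"
    using sN N by (intro nn_integral_layer_cake) auto
  \<comment> \<open>The tail supplies \<open>v powr (1 - \<alpha>)\<close>, hence the Beta
    parameters 2 - \<alpha> and \<alpha> - \<nu>, with sum 2 - \<nu>.\<close>
  also have "\<dots> = (\<integral>\<^sup>+v. ennreal (1 / (\<alpha> - 1)) * ennreal (v powr ((2 - \<alpha>) - 1) * (1 + v) powr (- ((2 - \<alpha>) + (\<alpha> - \<nu>))) * indicator {0<..} v) \<partial>lborel)"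
    using assms by (intro nn_integral_cong)
      (auto simp: indicator_def Ntail ennreal_mult[symmetric] field_simps)
  also have "\<dots> = ennreal (- stable_coeff \<alpha> \<nu> / (\<nu> - 1))"
  proof -
    have *: "0 < 2 - \<alpha>" "0 < \<alpha> - \<nu>" using assms by auto
    show ?thesis
      unfolding val[symmetric]
      using assms Gamma_real_pos[of "2-\<nu>"] Gamma_real_pos[of "2-\<alpha>"] Gamma_real_pos[of "\<alpha>-\<nu>"]
      apply (subst nn_integral_cmult)
       apply measurable
      apply (subst nn_integral_Beta_half_line[OF *])
      apply (subst ennreal_mult[symmetric])
      apply (auto simp: field_simps)
      done
  qed
  finally have "has_bochner_integral lborel (\<lambda>t. ((1 + t) powr (\<nu> - 1) - 1) / (\<nu> - 1) * t powr (- \<alpha>) * indicator {0<..} t)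
     (- stable_coeff \<alpha> \<nu> / (\<nu> - 1))"
  proof (intro has_bochner_integral_nn_integral)
    show "AE t in lborel. 0 \<le> ((1 + t) powr (\<nu> - 1) - 1) / (\<nu> - 1) * t powr (- \<alpha>) * indicator {0<..} t"
    proof (rule AE_I2)
      fix t :: real
      show "0 \<le> ((1 + t) powr (\<nu> - 1) - 1) / (\<nu> - 1) * t powr (- \<alpha>) * indicator {0<..} t"
        using mult_nonneg_nonneg[OF nonneg powr_ge_zero] by (cases "t > 0") auto
    qed
  qed (use pos in auto)
  then have "has_bochner_integral lborel (\<lambda>t. (\<nu> - 1) * (((1 + t) powr (\<nu> - 1) - 1) / (\<nu> - 1) * t powr (- \<alpha>) * indicator {0<..} t))
     ((\<nu> - 1) * (- stable_coeff \<alpha> \<nu> / (\<nu> - 1)))"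
    by (intro has_bochner_integral_mult_right) auto
  then show ?thesis using False by (simp add: mult.assoc)
qed

section \<open>Monotonicity, boundary values and root of the stable coefficient\<close>

lemma stable_coeff_strict_antimono:
  assumes "1 < \<alpha>" "\<alpha> < 2" "\<mu> < \<nu>" "\<nu> < \<alpha>"
  shows "stable_coeff \<alpha> \<nu> < stable_coeff \<alpha> \<mu>"
proof -
  let ?f = "\<lambda>\<nu> v. ((1 + v) powr (\<nu> - 1) - 1) * v powr (- \<alpha>) * indicator {0<..} v"
  have m: "has_bochner_integral lborel (?f \<mu>) (- stable_coeff \<alpha> \<mu>)"
    and n: "has_bochner_integral lborel (?f \<nu>) (- stable_coeff \<alpha> \<nu>)"
    using assms by (auto intro!: has_bochner_integral_stable)
  have lt: "?f \<mu> v < ?f \<nu> v" if "v > 0" for v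
    using that assms by (auto intro!: powr_less_mono)
  have le: "?f \<mu> v \<le> ?f \<nu> v" for v
    using lt[of v] by (cases "v > 0") auto
  \<comment> \<open>The integrands increase strictly with the exponent at each v > 0. Equal
    integrals would make them agree almost everywhere, which the interval (0, 1), of positive
    measure, refutes.\<close>
  have "integral\<^sup>L lborel (\<lambda>v. ?f \<nu> v - ?f \<mu> v) \<noteq> 0"
  proof
    assume "integral\<^sup>L lborel (\<lambda>v. ?f \<nu> v - ?f \<mu> v) = 0"
    then have "AE v in lborel. ?f \<nu> v - ?f \<mu> v = 0"
      using m n le by (subst (asm) integral_nonneg_eq_0_iff_AE) (auto simp: has_bochner_integral_iff)
    then have "AE v in lborel. v \<notin> {0<..<1::real}"
    proof eventually_elim
      case (elim v)
      then have "?f \<mu> v = ?f \<nu> v" by linarith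
      then show ?case using lt[of v] by (metis greaterThanLessThan_iff less_irrefl)
    qed
    then have "emeasure lborel {v \<in> space lborel. v \<in> {0<..<1::real}} = 0"
      by (rule emeasure_eq_0_AE)
    moreover have "{v \<in> space lborel. v \<in> {0<..<1::real}} = {0<..<1}" by auto
    ultimately have "emeasure lborel {0<..<1::real} = 0" by (simp only:)
    then show False by simp
  qed
  moreover have "integral\<^sup>L lborel (?f \<mu>) \<le> integral\<^sup>L lborel (?f \<nu>)"
    using m n le by (intro integral_mono) (auto simp: has_bochner_integral_iff)
  ultimately show ?thesis using m n by (simp add: has_bochner_integral_iff)
qed

text \<open>This is the reflection formula, with the sign settled by sin(\<pi> \<alpha>) < 0. It
  identifies the threshold on b in case (ii) as b/c < \<open>stable_coeff \<alpha> 0\<close>, the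
  condition for a root to the right of 0.\<close>

lemma stable_coeff_0:
  assumes "1 < \<alpha>" "\<alpha> < 2"
  shows "stable_coeff \<alpha> 0 = pi * \<bar>1 / sin (pi * \<alpha>)\<bar>"
proof -
  have "complex_of_real (Gamma \<alpha> * Gamma (1 - \<alpha>)) = complex_of_real (pi / sin (pi * \<alpha>))"
    using Gamma_reflection_complex[of "complex_of_real \<alpha>"]
    by (simp add: Gamma_complex_of_real[symmetric] sin_of_real[symmetric])
  then have G: "Gamma \<alpha> * Gamma (1 - \<alpha>) = pi / sin (pi * \<alpha>)"
    by (simp only: of_real_eq_iff)
  have "sin (pi * \<alpha>) < 0"
  proof -
    have "sin (pi * \<alpha> - pi) > 0"
      using assms by (intro sin_gt_zero) (auto simp: algebra_simps)
    then show ?thesis by (simp add: sin_diff)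
  qed
  then show ?thesis using G by (simp add: stable_coeff_def Gamma_numeral[of "Num.Bit0 Num.One", simplified] mult.commute abs_if)
qed

lemma Gamma_one_minus_neg:
  assumes "1 < \<alpha>" "\<alpha> < (2::real)"
  shows "Gamma (1 - \<alpha>) < 0"
proof -
  have "(1 - \<alpha>) * Gamma (1 - \<alpha>) > 0" unfolding Gamma_two_minus[OF assms, symmetric] using assms by auto
  then show ?thesis using assms by (simp add: zero_less_mult_iff)
qed

lemma continuous_on_stable_coeff:
  assumes "1 < \<alpha>" "\<alpha> < 2"
  shows "continuous_on {..<\<alpha>} (stable_coeff \<alpha>)"
proof -
  have pos: "continuous_on {0<..} (Gamma :: real \<Rightarrow> real)"
    by (intro continuous_on_Gamma) (auto dest: nonpos_Ints_nonpos)
  have "Gamma (2 - \<nu>) > 0" if "\<nu> < \<alpha>" for \<nu>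
    using that assms by (intro Gamma_real_pos) auto
  then have nz: "Gamma (2 - \<nu>) \<noteq> 0" if "\<nu> < \<alpha>" for \<nu>
    using that by force
  show ?thesis
    unfolding stable_coeff_def using assms nz
    by (intro continuous_intros continuous_on_compose2[OF pos]) auto
qed

text \<open>Only Gamma(\<alpha> - \<nu>) is singular at \<nu> = \<alpha>. The recurrence extracts
  its simple pole as \<open>inverse (\<alpha> - \<nu>)\<close>, and the other factor
  \<open>?g\<close> has a negative limit since Gamma(1 - \<alpha>) < 0.\<close>

lemma filterlim_stable_coeff:
  assumes "1 < \<alpha>" "\<alpha> < 2"
  shows "filterlim (stable_coeff \<alpha>) at_bot (at_left \<alpha>)"
proof -
  let ?g = "\<lambda>\<nu>. (\<nu> - 1) * Gamma (1 - \<alpha>) * Gamma (\<alpha> - \<nu> + 1) / Gamma (2 - \<nu>)"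
  have G: "Gamma (2 - \<alpha>) > 0" using assms by auto
  have 1: "u \<notin> \<int>\<^sub>\<le>\<^sub>0" if "u > 0" for u :: real
    using that nonpos_Ints_nonpos[of u] by auto
  have "(?g \<longlongrightarrow> (\<alpha> - 1) * Gamma (1 - \<alpha>) * Gamma (\<alpha> - \<alpha> + 1) / Gamma (2 - \<alpha>)) (at_left \<alpha>)"
    using assms less_imp_neq[OF G] by (intro tendsto_intros 1) auto
  then have g: "(?g \<longlongrightarrow> (\<alpha> - 1) * Gamma (1 - \<alpha>) / Gamma (2 - \<alpha>)) (at_left \<alpha>)" by simp
  have neg: "(\<alpha> - 1) * Gamma (1 - \<alpha>) / Gamma (2 - \<alpha>) < 0"
    using G assms Gamma_one_minus_neg[OF assms] by (simp add: divide_neg_pos mult_pos_neg)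
  have "filterlim (\<lambda>\<nu>. inverse (\<alpha> - \<nu>)) at_top (at_left \<alpha>)"
  proof (rule filterlim_compose[OF filterlim_inverse_at_top_right])
    show "filterlim (\<lambda>\<nu>. \<alpha> - \<nu>) (at_right 0) (at_left \<alpha>)"
      unfolding filterlim_at
      by (auto intro!: tendsto_eq_intros exI[of _ "\<alpha> - 1"] simp: eventually_at_left_field)
  qed
  then have "filterlim (\<lambda>\<nu>. ?g \<nu> * inverse (\<alpha> - \<nu>)) at_bot (at_left \<alpha>)"
    by (intro filterlim_tendsto_neg_mult_at_bot[OF g neg])
  moreover have "eventually (\<lambda>\<nu>. ?g \<nu> * inverse (\<alpha> - \<nu>) = stable_coeff \<alpha> \<nu>) (at_left \<alpha>)"
  proof -
    have "eventually (\<lambda>\<nu>. \<nu> < \<alpha>) (at_left \<alpha>)" by (auto simp: eventually_at_left_field intro: exI[of _ "\<alpha> - 1"])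
    then show ?thesis
    proof eventually_elim
      case (elim \<nu>)
      then have "Gamma (\<alpha> - \<nu> + 1) = (\<alpha> - \<nu>) * Gamma (\<alpha> - \<nu>)" by (intro Gamma_plus1 1) auto
      then show ?case using elim by (simp add: stable_coeff_def)
    qed
  qed
  ultimately show ?thesis by (rule filterlim_cong[THEN iffD1, OF refl refl, rotated])
qed

text \<open>The coefficient is continuous and strictly decreasing, from its value at 0 down to minus
  infinity at \<alpha>.\<close>

lemma stable_coeff_root:
  assumes "1 < \<alpha>" "\<alpha> < 2" "w < pi * \<bar>1 / sin (pi * \<alpha>)\<bar>"
  shows "\<exists>!\<nu>. 0 < \<nu> \<and> \<nu> < \<alpha> \<and> w = stable_coeff \<alpha> \<nu>"
proof -
  have "eventually (\<lambda>\<nu>. stable_coeff \<alpha> \<nu> \<le> w) (at_left \<alpha>)"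
    using filterlim_stable_coeff[OF assms(1,2)] by (simp add: filterlim_at_bot)
  moreover have "eventually (\<lambda>\<nu>. 0 < \<nu> \<and> \<nu> < \<alpha>) (at_left \<alpha>)"
    using assms by (auto simp: eventually_at_left_field intro: exI[of _ "0"])
  ultimately have "eventually (\<lambda>\<nu>. stable_coeff \<alpha> \<nu> \<le> w \<and> 0 < \<nu> \<and> \<nu> < \<alpha>) (at_left \<alpha>)"
    by (rule eventually_conj)
  then obtain \<mu> where \<mu>: "stable_coeff \<alpha> \<mu> \<le> w" "0 < \<mu>" "\<mu> < \<alpha>"
    using eventually_happens[of _ "at_left \<alpha>"] by auto
  have sub: "{0..\<mu>} \<subseteq> {..<\<alpha>}" using \<mu> by auto
  have "\<exists>\<nu>\<ge>0. \<nu> \<le> \<mu> \<and> stable_coeff \<alpha> \<nu> = w"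
    using \<mu> assms continuous_on_subset[OF continuous_on_stable_coeff sub]
    by (intro IVT2') (auto simp: stable_coeff_0)
  then obtain \<nu> where \<nu>: "\<nu> \<ge> 0" "\<nu> \<le> \<mu>" "stable_coeff \<alpha> \<nu> = w" by auto
  show ?thesis
  proof (rule ex1I[of _ \<nu>])
    show "0 < \<nu> \<and> \<nu> < \<alpha> \<and> w = stable_coeff \<alpha> \<nu>"
      using \<nu> \<mu> assms stable_coeff_0[of \<alpha>] by (cases "\<nu> = 0") auto
    show "\<nu>' = \<nu>" if "0 < \<nu>' \<and> \<nu>' < \<alpha> \<and> w = stable_coeff \<alpha> \<nu>'" for \<nu>'
      using that \<nu> \<mu> stable_coeff_strict_antimono[of \<alpha> \<nu> \<nu>'] stable_coeff_strict_antimono[of \<alpha> \<nu>' \<nu>] assms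
      by (cases \<nu> \<nu>' rule: linorder_cases) auto
  qed
qed

section \<open>Layer-cake asymptotics for heavy-tailed increments\<close>

text \<open>Dominated convergence with majorant |w|. It serves both ends of the half-line: intervals
  shrinking to 0 and tails receding to infinity.\<close>

lemma integral_vanishing_sets:
  fixes w :: "real \<Rightarrow> real"
  assumes w: "integrable lborel w" and A: "\<And>n. A n \<in> sets borel"
    and ev: "\<And>v. eventually (\<lambda>n. v \<notin> A n) sequentially" and "\<eta> > 0"
  shows "\<exists>n::nat. (\<integral>v. \<bar>w v\<bar> * indicator (A n) v \<partial>lborel) < \<eta>"
proof -
  note A [measurable]
  have [measurable]: "w \<in> borel_measurable borel" using w by auto
  have "(\<lambda>n. \<integral>v. \<bar>w v\<bar> * indicator (A n) v \<partial>lborel) \<longlonglongrightarrow> (\<integral>v. 0 \<partial>(lborel :: real measure))"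
  proof (rule integral_dominated_convergence[where w="\<lambda>v. \<bar>w v\<bar>"])
    show "AE v in lborel. (\<lambda>n. \<bar>w v\<bar> * indicator (A n) v) \<longlonglongrightarrow> 0"
    proof (intro AE_I2 tendsto_eventually)
      fix v
      show "eventually (\<lambda>n. \<bar>w v\<bar> * indicator (A n) v = 0) sequentially"
        using ev[of v] by eventually_elim simp
    qed
  qed (use w in \<open>auto simp: indicator_def\<close>)
  then have "eventually (\<lambda>n. (\<integral>v. \<bar>w v\<bar> * indicator (A n) v \<partial>lborel) < \<eta>) sequentially"
    by (rule order_tendstoD(2)) (use \<open>\<eta> > 0\<close> in simp)
  then show ?thesis by (auto simp: eventually_sequentially)
qed

lemma integral_near_0_small:
  fixes w :: "real \<Rightarrow> real"
  assumes w: "integrable lborel w" and "\<eta> > 0"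
  shows "\<exists>\<delta>>0. (\<integral>v. \<bar>w v\<bar> * indicator {0<..<\<delta>} v \<partial>lborel) < \<eta>"
proof -
  have "eventually (\<lambda>n. v \<notin> {0<..<inverse (real (Suc n))}) sequentially" for v :: real
  proof (cases "v > 0")
    case True
    have "eventually (\<lambda>n. inverse (real (Suc n)) < v) sequentially"
      using LIMSEQ_inverse_real_of_nat True by (rule order_tendstoD)
    then show ?thesis by eventually_elim auto
  qed auto
  from integral_vanishing_sets[OF w _ this \<open>\<eta> > 0\<close>] obtain n
    where "(\<integral>v. \<bar>w v\<bar> * indicator {0<..<inverse (real (Suc n))} v \<partial>lborel) < \<eta>" by auto
  then show ?thesis by (intro exI[of _ "inverse (real (Suc n))"]) auto
qed

lemma integral_tail_small:
  fixes w :: "real \<Rightarrow> real"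
  assumes w: "integrable lborel w" and "\<eta> > 0"
  shows "\<exists>T0. \<forall>T\<ge>T0. (\<integral>v. \<bar>w v\<bar> * indicator {T<..} v \<partial>lborel) < \<eta>"
proof -
  have "eventually (\<lambda>n. v \<notin> {real n<..}) sequentially" for v :: real
    using filterlim_real_sequentially by (auto simp: filterlim_at_top not_less)
  from integral_vanishing_sets[OF w _ this \<open>\<eta> > 0\<close>] obtain n
    where n: "(\<integral>v. \<bar>w v\<bar> * indicator {real n<..} v \<partial>lborel) < \<eta>" by auto
  show ?thesis
  proof (intro exI[of _ "real n"] allI impI)
    fix T assume "real n \<le> T"
    then have "(\<integral>v. \<bar>w v\<bar> * indicator {T<..} v \<partial>lborel) \<le> (\<integral>v. \<bar>w v\<bar> * indicator {real n<..} v \<partial>lborel)"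
      using w by (intro integral_mono integrable_real_mult_indicator) (auto simp: indicator_def)
    then show "(\<integral>v. \<bar>w v\<bar> * indicator {T<..} v \<partial>lborel) < \<eta>" using n by simp
  qed
qed

section \<open>Expectations of jumps through their tail probabilities\<close>

lemma layer_cake_bochner:
  fixes \<psi> F :: "real \<Rightarrow> real"
  assumes [measurable]: "\<psi> \<in> borel_measurable borel" "F \<in> borel_measurable borel" "Y \<in> borel_measurable N"
    and N: "prob_space N"
    and pos: "\<And>v. v > 0 \<Longrightarrow> \<psi> v \<ge> 0" "\<And>u. u > 0 \<Longrightarrow> F u \<ge> 0"
    and F: "\<And>u. u > 0 \<Longrightarrow> (\<integral>\<^sup>+v. ennreal (\<psi> v) * indicator {0<..<u} v \<partial>lborel) = ennreal (F u)"
    and int: "integrable lborel (\<lambda>v. \<psi> v * indicator {0<..} v * measure N {\<omega>\<in>space N. v < Y \<omega>})"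
  shows "has_bochner_integral N (\<lambda>\<omega>. F (Y \<omega>) * indicator {0<..} (Y \<omega>))
    (\<integral>v. \<psi> v * indicator {0<..} v * measure N {\<omega>\<in>space N. v < Y \<omega>} \<partial>lborel)"
proof -
  interpret prob_space N by fact
  define D where "D = distr N borel Y"
  interpret D: prob_space D unfolding D_def by (rule prob_space_distr) simp
  have D: "sets D = sets borel" "sigma_finite_measure D" unfolding D_def
    by (simp_all add: D.sigma_finite_measure_axioms[unfolded D_def])
  have Dm: "emeasure D {v<..} = ennreal (measure N {\<omega>\<in>space N. v < Y \<omega>})" for v
    unfolding D_def by (subst emeasure_distr) (auto simp: emeasure_eq_measure vimage_def Int_def conj_commute)
  have nn: "0 \<le> \<psi> v * indicator {0<..} v * measure N {\<omega>\<in>space N. v < Y \<omega>}" for v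
    using pos(1)[of v] by (cases "v > 0") auto
  have "(\<integral>\<^sup>+\<omega>. ennreal (F (Y \<omega>) * indicator {0<..} (Y \<omega>)) \<partial>N) = (\<integral>\<^sup>+t. ennreal (F t * indicator {0<..} t) \<partial>D)"
    unfolding D_def by (subst nn_integral_distr) auto
  also have "\<dots> = (\<integral>\<^sup>+t. (\<integral>\<^sup>+v. ennreal (\<psi> v) * indicator {0<..<t} v \<partial>lborel) \<partial>D)"
  proof (intro nn_integral_cong)
    fix t
    show "ennreal (F t * indicator {0<..} t) = (\<integral>\<^sup>+v. ennreal (\<psi> v) * indicator {0<..<t} v \<partial>lborel)"
      using F[of t] by (cases "t > 0") auto
  qed
  also have "\<dots> = (\<integral>\<^sup>+v. ennreal (\<psi> v) * indicator {0<..} v * emeasure D {v<..} \<partial>lborel)"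
    using D by (intro nn_integral_layer_cake) auto
  also have "\<dots> = (\<integral>\<^sup>+v. ennreal (\<psi> v * indicator {0<..} v * measure N {\<omega>\<in>space N. v < Y \<omega>}) \<partial>lborel)"
    using pos by (intro nn_integral_cong) (auto simp: Dm ennreal_mult indicator_def)
  also have "\<dots> = ennreal (\<integral>v. \<psi> v * indicator {0<..} v * measure N {\<omega>\<in>space N. v < Y \<omega>} \<partial>lborel)"
    using int nn by (intro nn_integral_eq_integral) auto
  finally show ?thesis
  proof (intro has_bochner_integral_nn_integral)
    show "AE x in N. 0 \<le> F (Y x) * indicator {0<..} (Y x)"
    proof (rule AE_I2)
      fix x show "0 \<le> F (Y x) * indicator {0<..} (Y x)"
        using pos(2)[of "Y x"] by (cases "Y x > 0") auto
    qed
  qed (use nn in \<open>auto intro!: integral_nonneg_AE\<close>)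
qed

text \<open>A whole set of laws is carried along so that every threshold found here is uniform in
  the starting point of the chain. Jumps are counted positive away from the origin:
  \<open>tail\<close> concerns outward jumps, \<open>neg\<close> inward ones. The cap \<beta> \<le>
  2 lets a quadratic Taylor remainder be paid for by the moment of order \<beta>.\<close>

locale heavy_tails =
  fixes \<N> :: "real measure set" and \<alpha> \<beta> c B :: real
  assumes alpha: "1 < \<alpha>" "\<alpha> < 2" and beta: "\<alpha> < \<beta>" "\<beta> \<le> 2" and c: "c > 0" and B: "B \<ge> 0"
    and prob: "\<And>N. N \<in> \<N> \<Longrightarrow> prob_space N"
    and sets_N: "\<And>N. N \<in> \<N> \<Longrightarrow> sets N = sets borel"
    and tail: "\<And>\<epsilon>. \<epsilon> > 0 \<Longrightarrow> \<exists>Y. \<forall>y\<ge>Y. \<forall>N\<in>\<N>. \<bar>y powr \<alpha> * measure N {y<..} - c\<bar> \<le> \<epsilon>"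
    and neg: "\<And>N. N \<in> \<N> \<Longrightarrow> (\<integral>\<^sup>+t. ennreal (npart t powr \<beta>) \<partial>N) \<le> ennreal B"
begin

lemma space_N: "N \<in> \<N> \<Longrightarrow> space N = UNIV"
  using sets_eq_imp_space_eq[OF sets_N] by simp

lemma measurable_N: "N \<in> \<N> \<Longrightarrow> f \<in> borel_measurable borel \<Longrightarrow> f \<in> borel_measurable N"
  using measurable_cong_sets[OF sets_N refl] by blast

text \<open>The limit in \<open>tail\<close> is silent about moderate y, where instead a probability
  is at most 1 and \<open>y powr \<alpha>\<close> is bounded. A bound at all y > 0 is what dominates
  the layer-cake integrand near 0.\<close>

lemma tail_bound: "\<exists>C>0. \<forall>N\<in>\<N>. \<forall>y>0. measure N {y<..} \<le> C * y powr (- \<alpha>)"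
proof -
  obtain Y where Y: "\<And>y N. y \<ge> Y \<Longrightarrow> N \<in> \<N> \<Longrightarrow> \<bar>y powr \<alpha> * measure N {y<..} - c\<bar> \<le> c"
    using tail[OF c] by blast
  define C where "C = 2 * c + max Y 1 powr \<alpha>"
  have "measure N {y<..} \<le> C * y powr (- \<alpha>)" if "N \<in> \<N>" "y > 0" for N y
  proof -
    interpret prob_space N by (rule prob) fact
    have "y powr \<alpha> * measure N {y<..} \<le> C"
    proof (cases "y \<ge> Y")
      case True
      with Y[OF _ that(1), of y] show ?thesis unfolding C_def by (smt (verit) powr_ge_zero)
    next
      case False
      have "y powr \<alpha> * measure N {y<..} \<le> y powr \<alpha> * 1" by (intro mult_left_mono) auto
      also have "\<dots> \<le> max Y 1 powr \<alpha>" using False that alpha by (simp, intro powr_mono2) auto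
      finally show ?thesis using c by (simp add: C_def)
    qed
    then show ?thesis using that by (simp add: powr_minus field_simps)
  qed
  moreover have "C > 0" using c by (simp add: C_def add_pos_nonneg)
  ultimately show ?thesis by auto
qed

lemma measurable_tail:
  assumes "r > 0" and N: "N \<in> \<N>"
  shows "(\<lambda>v. measure N {r * v<..}) \<in> borel_measurable borel"
proof -
  interpret prob_space N by (rule prob) fact
  have "mono (\<lambda>v. - measure N {r * v<..})"
  proof (rule monoI)
    fix x y :: real assume "x \<le> y"
    then have "r * x \<le> r * y" using \<open>r > 0\<close> by simp
    then have "{r * y<..} \<subseteq> {r * x<..}" by auto
    then have "measure N {r * y<..} \<le> measure N {r * x<..}"
      by (rule finite_measure_mono) (simp add: sets_N[OF N])
    then show "- measure N {r * x<..} \<le> - measure N {r * y<..}" by simp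
  qed
  then have "(\<lambda>v. - measure N {r * v<..}) \<in> borel_measurable borel" by (rule borel_measurable_mono)
  from borel_measurable_uminus[OF this] show ?thesis by (simp only: minus_minus)
qed

text \<open>In units of r the tail is at most C r^(-\<alpha>) v^(-\<alpha>). One integrability
  condition, free of the law and of the scale, therefore serves all of them.\<close>

lemma layer:
  fixes \<psi> F :: "real \<Rightarrow> real"
  assumes [measurable]: "\<psi> \<in> borel_measurable borel" "F \<in> borel_measurable borel"
    and N: "N \<in> \<N>" and r: "r > 0"
    and pos: "\<And>v. v > 0 \<Longrightarrow> \<psi> v \<ge> 0" "\<And>u. u > 0 \<Longrightarrow> F u \<ge> 0"
    and F: "\<And>u. u > 0 \<Longrightarrow> (\<integral>\<^sup>+v. ennreal (\<psi> v) * indicator {0<..<u} v \<partial>lborel) = ennreal (F u)"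
    and int: "integrable lborel (\<lambda>v. \<psi> v * v powr (- \<alpha>) * indicator {0<..} v)"
  shows "integrable lborel (\<lambda>v. \<psi> v * indicator {0<..} v * measure N {r * v<..})"
    and "has_bochner_integral N (\<lambda>t. F (t / r) * indicator {0<..} t)
     (\<integral>v. \<psi> v * indicator {0<..} v * measure N {r * v<..} \<partial>lborel)"
proof -
  obtain C where C: "C > 0" "\<And>y. y > 0 \<Longrightarrow> measure N {y<..} \<le> C * y powr (- \<alpha>)"
    using tail_bound N by blast
  have [measurable]: "(\<lambda>v. measure N {r * v<..}) \<in> borel_measurable borel" by (rule measurable_tail[OF r N])
  show *: "integrable lborel (\<lambda>v. \<psi> v * indicator {0<..} v * measure N {r * v<..})"
  proof (rule Bochner_Integration.integrable_bound[OF integrable_mult_right[OF int, of "C * r powr (- \<alpha>)"]])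
    show "AE v in lborel. norm (\<psi> v * indicator {0<..} v * measure N {r * v<..}) \<le> norm (C * r powr - \<alpha> * (\<psi> v * v powr - \<alpha> * indicator {0<..} v))"
    proof (rule AE_I2)
      fix v :: real
      show "norm (\<psi> v * indicator {0<..} v * measure N {r * v<..}) \<le> norm (C * r powr - \<alpha> * (\<psi> v * v powr - \<alpha> * indicator {0<..} v))"
      proof (cases "v > 0")
        case True
        then have "\<psi> v * measure N {r * v<..} \<le> \<psi> v * (C * (r * v) powr (- \<alpha>))"
          using r pos by (intro mult_left_mono C) auto
        then show ?thesis using True r pos(1)[of v] C by (simp add: abs_mult powr_mult mult_ac)
      qed auto
    qed
  qed simp
  have eq: "{\<omega> \<in> space N. v < \<omega> / r} = {r * v<..}" for v
    using r space_N[OF N] by (auto simp: field_simps)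
  have ieq: "indicator {0<..} (t / r) = (indicator {0<..} t :: real)" for t
    using r by (auto simp: indicator_def zero_less_divide_iff)
  have mN: "(\<lambda>\<omega>. \<omega> / r) \<in> borel_measurable N" by (rule measurable_N[OF N]) simp
  show "has_bochner_integral N (\<lambda>t. F (t / r) * indicator {0<..} t)
     (\<integral>v. \<psi> v * indicator {0<..} v * measure N {r * v<..} \<partial>lborel)"
    using layer_cake_bochner[OF assms(1,2) mN prob[OF N] pos F] * unfolding eq ieq by simp
qed

end

section \<open>Outward jumps: the power without its linear part\<close>

lemma compensated_powr_sign:
  fixes \<nu> :: real
  defines "\<sigma> \<equiv> (if 0 < \<nu> \<and> \<nu> < 1 then - 1 else 1 :: real)"
  assumes "v \<ge> 0"
  shows "\<sigma> * (\<nu> * ((1 + v) powr (\<nu> - 1) - 1)) \<ge> 0"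
proof -
  consider "\<nu> \<le> 0" | "0 < \<nu>" "\<nu> < 1" | "\<nu> \<ge> 1" by linarith
  then show ?thesis
  proof cases
    case 3
    then have "(1 + v) powr (\<nu> - 1) \<ge> 1" using assms by (simp add: ge_one_powr_ge_zero)
    then show ?thesis using 3 by (simp add: \<sigma>_def)
  next
    case 2
    have "(1 + v) powr (\<nu> - 1) \<le> 1 powr (\<nu> - 1)" using 2 assms by (intro powr_mono2') auto
    then show ?thesis using 2 by (simp add: \<sigma>_def mult_nonneg_nonpos)
  next
    case 1
    have "(1 + v) powr (\<nu> - 1) \<le> 1 powr (\<nu> - 1)" using 1 assms by (intro powr_mono2') auto
    then show ?thesis using 1 by (simp add: \<sigma>_def mult_nonpos_nonpos)
  qed
qed

lemma compensated_powr_deriv: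
  fixes \<nu> v :: real
  assumes "v > - 1"
  shows "((\<lambda>u. (1 + u) powr \<nu> - 1 - \<nu> * u) has_real_derivative \<nu> * ((1 + v) powr (\<nu> - 1) - 1)) (at v)"
proof -
  have "((\<lambda>u. (1 + u) powr \<nu>) has_real_derivative \<nu> * (1 + v) powr (\<nu> - 1) * 1) (at v)"
    using assms by (auto intro!: derivative_eq_intros)
  then have "((\<lambda>u. (1 + u) powr \<nu> - 1 - \<nu> * u) has_real_derivative \<nu> * (1 + v) powr (\<nu> - 1) * 1 - 0 - \<nu> * 1) (at v)"
    by (intro DERIV_diff DERIV_const DERIV_cmult DERIV_ident)
  then show ?thesis by (simp add: algebra_simps)
qed

lemma compensated_powr_nn_integral:
  fixes \<nu> u :: real
  defines "\<sigma> \<equiv> (if 0 < \<nu> \<and> \<nu> < 1 then - 1 else 1 :: real)"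
  assumes "u > 0"
  shows "(\<integral>\<^sup>+v. ennreal (\<sigma> * (\<nu> * ((1 + v) powr (\<nu> - 1) - 1))) * indicator {0<..<u} v \<partial>lborel)
      = ennreal (\<sigma> * ((1 + u) powr \<nu> - 1 - \<nu> * u))" (is ?A)
    and "\<sigma> * ((1 + u) powr \<nu> - 1 - \<nu> * u) \<ge> 0" (is ?B)
proof -
  have d: "((\<lambda>u. \<sigma> * ((1 + u) powr \<nu> - 1 - \<nu> * u)) has_real_derivative \<sigma> * (\<nu> * ((1 + v) powr (\<nu> - 1) - 1))) (at v)"
    if "v \<ge> 0" for v
    using that by (intro DERIV_cmult compensated_powr_deriv) auto
  have s: "\<sigma> * (\<nu> * ((1 + v) powr (\<nu> - 1) - 1)) \<ge> 0" if "v \<ge> 0" for v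
    using compensated_powr_sign[OF that, of \<nu>] by (simp add: \<sigma>_def)
  have "(\<integral>\<^sup>+v. ennreal (\<sigma> * (\<nu> * ((1 + v) powr (\<nu> - 1) - 1))) * indicator {0<..<u} v \<partial>lborel)
     = (\<integral>\<^sup>+v. ennreal (\<sigma> * (\<nu> * ((1 + v) powr (\<nu> - 1) - 1))) * indicator {0..u} v \<partial>lborel)"
    using AE_lborel_singleton[of 0] AE_lborel_singleton[of u]
    by (intro nn_integral_cong_AE) (auto elim!: eventually_elim2 simp: indicator_def)
  also have "\<dots> = ennreal (\<sigma> * ((1 + u) powr \<nu> - 1 - \<nu> * u) - \<sigma> * ((1 + 0) powr \<nu> - 1 - \<nu> * 0))"
    using assms d s by (intro nn_integral_FTC_Icc) auto
  finally show ?A by simp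
  have "\<sigma> * ((1 + 0) powr \<nu> - 1 - \<nu> * 0) \<le> \<sigma> * ((1 + u) powr \<nu> - 1 - \<nu> * u)"
  proof (rule DERIV_nonneg_imp_nondecreasing[where f="\<lambda>u. \<sigma> * ((1 + u) powr \<nu> - 1 - \<nu> * u)"])
    show "0 \<le> u" using assms by simp
    show "\<exists>y. ((\<lambda>u. \<sigma> * ((1 + u) powr \<nu> - 1 - \<nu> * u)) has_real_derivative y) (at x) \<and> 0 \<le> y"
      if "0 \<le> x" for x using d[OF that] s[OF that] by blast
  qed
  then show ?B by simp
qed

lemma integrable_compensated_stable:
  fixes \<alpha> \<nu> :: real
  assumes "1 < \<alpha>" "\<alpha> < 2" "\<nu> < \<alpha>"
  shows "integrable lborel (\<lambda>v. \<nu> * ((1 + v) powr (\<nu> - 1) - 1) * v powr (- \<alpha>) * indicator {0<..} v)"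
proof -
  have "integrable lborel (\<lambda>v. \<nu> * (((1 + v) powr (\<nu> - 1) - 1) * v powr (- \<alpha>) * indicator {0<..} v))"
    using has_bochner_integral_stable[OF assms] by (intro integrable_mult_right) (simp add: has_bochner_integral_iff)
  then show ?thesis by (simp add: mult.assoc)
qed

context heavy_tails
begin

abbreviation compensated :: "real \<Rightarrow> real \<Rightarrow> real \<Rightarrow> real" where
  "compensated \<nu> r t \<equiv> ((1 + t / r) powr \<nu> - 1 - \<nu> * (t / r)) * indicator {0<..} t"

lemma compensated_layer:
  fixes \<nu> :: real
  assumes "\<nu> < \<alpha>" and N: "N \<in> \<N>" and r: "r > 0"
  shows "integrable lborel (\<lambda>v. \<nu> * ((1 + v) powr (\<nu> - 1) - 1) * indicator {0<..} v * measure N {r * v<..})"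
    and "has_bochner_integral N (compensated \<nu> r)
     (\<integral>v. \<nu> * ((1 + v) powr (\<nu> - 1) - 1) * indicator {0<..} v * measure N {r * v<..} \<partial>lborel)"
proof -
  \<comment> \<open>For 0 < \<nu> < 1 the power is concave and the compensated power is negative.
    The sign \<sigma> makes it nonnegative for the layer-cake formula, and multiplying by \<sigma>
    once more removes it.\<close>
  define \<sigma> where "\<sigma> = (if 0 < \<nu> \<and> \<nu> < 1 then - 1 else 1 :: real)"
  have \<sigma>: "\<sigma> * (\<sigma> * x) = x" for x by (simp add: \<sigma>_def)
  have "integrable lborel (\<lambda>v. \<sigma> * (\<nu> * ((1 + v) powr (\<nu> - 1) - 1) * v powr (- \<alpha>) * indicator {0<..} v))"
    using alpha assms by (intro integrable_mult_right integrable_compensated_stable)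
  then have int: "integrable lborel (\<lambda>v. \<sigma> * (\<nu> * ((1 + v) powr (\<nu> - 1) - 1)) * v powr (- \<alpha>) * indicator {0<..} v)"
    by (simp add: mult.assoc)
  note L = layer[where \<psi>="\<lambda>v. \<sigma> * (\<nu> * ((1 + v) powr (\<nu> - 1) - 1))" and F="\<lambda>u. \<sigma> * ((1 + u) powr \<nu> - 1 - \<nu> * u)", OF _ _ N r _ _ _ int]
  have "integrable lborel (\<lambda>v. \<sigma> * (\<sigma> * (\<nu> * ((1 + v) powr (\<nu> - 1) - 1)) * indicator {0<..} v * measure N {r * v<..}))"
    using compensated_powr_sign[of _ \<nu>] compensated_powr_nn_integral[of _ \<nu>]
    by (intro integrable_mult_right L(1)) (auto simp: \<sigma>_def)
  then show "integrable lborel (\<lambda>v. \<nu> * ((1 + v) powr (\<nu> - 1) - 1) * indicator {0<..} v * measure N {r * v<..})"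
    by (simp only: mult.assoc \<sigma>)
  have "has_bochner_integral N (\<lambda>t. \<sigma> * (\<sigma> * ((1 + t / r) powr \<nu> - 1 - \<nu> * (t / r)) * indicator {0<..} t))
     (\<sigma> * (\<integral>v. \<sigma> * (\<nu> * ((1 + v) powr (\<nu> - 1) - 1)) * indicator {0<..} v * measure N {r * v<..} \<partial>lborel))"
    using compensated_powr_sign[of _ \<nu>] compensated_powr_nn_integral[of _ \<nu>]
    by (intro has_bochner_integral_mult_right L(2)) (auto simp: \<sigma>_def)
  then show "has_bochner_integral N (compensated \<nu> r)
     (\<integral>v. \<nu> * ((1 + v) powr (\<nu> - 1) - 1) * indicator {0<..} v * measure N {r * v<..} \<partial>lborel)"
    by (simp only: mult.assoc \<sigma> integral_mult_right_zero)
qed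

text \<open>The tail at r v, multiplied by r^\<alpha>, tends to c v^(-\<alpha>). For v \<ge>
  \<delta> this is uniform over the laws as soon as r \<ge> Y/\<delta>, since then r v \<ge> Y;
  below \<delta> the global tail bound and the integrability of \<open>w\<close> make the
  contribution small.\<close>

lemma compensated_asymp:
  fixes \<nu> :: real
  assumes "\<nu> < \<alpha>" and "\<epsilon> > 0"
  shows "\<exists>R>0. \<forall>r\<ge>R. \<forall>N\<in>\<N>.
     \<bar>r powr \<alpha> * (\<integral>t. compensated \<nu> r t \<partial>N) + c * \<nu> * stable_coeff \<alpha> \<nu>\<bar> \<le> \<epsilon>"
proof -
  define d where "d v = \<nu> * ((1 + v) powr (\<nu> - 1) - 1)" for v
  define w where "w v = d v * v powr (- \<alpha>) * indicator {0<..} v" for v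
  have w: "integrable lborel w" 
    unfolding w_def d_def using alpha assms by (intro integrable_compensated_stable)
  have wi: "(\<integral>v. w v \<partial>lborel) = - \<nu> * stable_coeff \<alpha> \<nu>"
  proof -
    have "(\<integral>v. w v \<partial>lborel) = (\<integral>v. \<nu> * (((1 + v) powr (\<nu> - 1) - 1) * v powr (- \<alpha>) * indicator {0<..} v) \<partial>lborel)"
      by (simp add: w_def d_def mult.assoc)
    also have "\<dots> = \<nu> * (- stable_coeff \<alpha> \<nu>)"
      using has_bochner_integral_stable[OF alpha assms(1)] by (simp only: integral_mult_right_zero has_bochner_integral_iff)
    finally show ?thesis by simp
  qed
  define k where "k = (\<integral>v. \<bar>w v\<bar> \<partial>lborel)"
  have k: "k \<ge> 0" unfolding k_def by simp
  obtain C where C: "C > 0" "\<And>y N. N \<in> \<N> \<Longrightarrow> y > 0 \<Longrightarrow> measure N {y<..} \<le> C * y powr (- \<alpha>)"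
    using tail_bound by blast
  define \<epsilon>' where "\<epsilon>' = \<epsilon> / (2 * (k + 1))"
  have \<epsilon>': "\<epsilon>' > 0" "\<epsilon>' * k \<le> \<epsilon> / 2" using k assms by (auto simp: \<epsilon>'_def field_simps)
  obtain Y0 where Y0: "\<And>y N. y \<ge> Y0 \<Longrightarrow> N \<in> \<N> \<Longrightarrow> \<bar>y powr \<alpha> * measure N {y<..} - c\<bar> \<le> \<epsilon>'"
    using tail[OF \<epsilon>'(1)] by blast
  define Y where "Y = max Y0 1"
  \<comment> \<open>Below \<delta> the error of the rescaled tail is only known to be at most C + c,
    so the integral of |w| there has to be small by this factor.\<close>
  have "\<epsilon> / (2 * (C + c)) > 0" using C c assms by simp
  from integral_near_0_small[OF w this] obtain \<delta> where \<delta>: "\<delta> > 0"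
    "(\<integral>v. \<bar>w v\<bar> * indicator {0<..<\<delta>} v \<partial>lborel) < \<epsilon> / (2 * (C + c))" by blast
  have \<delta>2: "(C + c) * (\<integral>v. \<bar>w v\<bar> * indicator {0<..<\<delta>} v \<partial>lborel) \<le> \<epsilon> / 2"
    using \<delta>(2) C c by (simp add: field_simps)
  have wi2: "integrable lborel (\<lambda>v. \<bar>w v\<bar> * indicator {0<..<\<delta>} v)"
    using w by (intro integrable_real_mult_indicator) auto
  have main: "\<bar>r powr \<alpha> * (\<integral>t. compensated \<nu> r t \<partial>N) + c * \<nu> * stable_coeff \<alpha> \<nu>\<bar> \<le> \<epsilon>"
    if r: "r \<ge> Y / \<delta>" and N: "N \<in> \<N>" for r N
  proof -
    have "Y / \<delta> > 0" using \<delta> by (auto simp: Y_def)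
    then have r0: "r > 0" using r by linarith
    interpret prob_space N by (rule prob) fact
    let ?m = "\<lambda>v. d v * indicator {0<..} v * measure N {r * v<..}"
    have mi: "integrable lborel ?m"
      unfolding d_def by (rule compensated_layer(1)[OF assms(1) N r0])
    have "(\<integral>t. compensated \<nu> r t \<partial>N) = (\<integral>v. ?m v \<partial>lborel)"
      using compensated_layer(2)[OF assms(1) N r0] unfolding d_def has_bochner_integral_iff by blast
    then have "\<bar>r powr \<alpha> * (\<integral>t. compensated \<nu> r t \<partial>N) + c * \<nu> * stable_coeff \<alpha> \<nu>\<bar>
      = \<bar>r powr \<alpha> * (\<integral>v. ?m v \<partial>lborel) - c * (\<integral>v. w v \<partial>lborel)\<bar>" unfolding wi by simp
    also have "\<dots> = \<bar>\<integral>v. r powr \<alpha> * ?m v - c * w v \<partial>lborel\<bar>"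
      using mi w by (subst Bochner_Integration.integral_diff) (auto simp only: integrable_mult_right integral_mult_right_zero)
    also have "\<dots> \<le> (\<integral>v. \<epsilon>' * \<bar>w v\<bar> + (C + c) * (\<bar>w v\<bar> * indicator {0<..<\<delta>} v) \<partial>lborel)"
    proof (rule integral_abs_bound[THEN order_trans], rule integral_mono)
      show "integrable lborel (\<lambda>v. \<bar>r powr \<alpha> * ?m v - c * w v\<bar>)"
        by (intro integrable_abs Bochner_Integration.integrable_diff integrable_mult_right mi w)
      show "integrable lborel (\<lambda>v. \<epsilon>' * \<bar>w v\<bar> + (C + c) * (\<bar>w v\<bar> * indicator {0<..<\<delta>} v))"
        by (intro Bochner_Integration.integrable_add integrable_mult_right integrable_abs w wi2)
      fix v :: real
      show "\<bar>r powr \<alpha> * ?m v - c * w v\<bar> \<le> \<epsilon>' * \<bar>w v\<bar> + (C + c) * (\<bar>w v\<bar> * indicator {0<..<\<delta>} v)"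
      proof (cases "v > 0")
        case True
        have rv: "(r * v) powr \<alpha> = r powr \<alpha> * v powr \<alpha>" using True r0 by (simp add: powr_mult)
        have v1: "v powr \<alpha> * v powr (- \<alpha>) = 1" using True by (simp add: powr_minus)
        \<comment> \<open>The error of the rescaled tail at r v; the two integrands differ by
          exactly w v times this.\<close>
        define q where "q = (r * v) powr \<alpha> * measure N {r * v<..} - c"
        have eq: "r powr \<alpha> * ?m v - c * w v = w v * q"
        proof -
          have "w v * q = d v * r powr \<alpha> * measure N {r * v<..} * (v powr \<alpha> * v powr (- \<alpha>)) - c * w v"
            using True unfolding q_def rv w_def by (simp add: algebra_simps)
          then show ?thesis using True unfolding v1 by simp
        qed
        have "\<bar>q\<bar> \<le> \<epsilon>' + (C + c) * indicator {0<..<\<delta>} v"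
        proof (cases "v < \<delta>")
          case False
          then have "r * v \<ge> Y / \<delta> * \<delta>" using r r0 \<delta> by (intro mult_mono) auto
          then have "r * v \<ge> Y0" using \<delta> by (auto simp: Y_def)
          then show ?thesis using Y0[OF _ N] False by (simp add: q_def)
        next
          case lt: True
          have p: "r * v > 0" using True r0 by simp
          have "(r * v) powr \<alpha> * measure N {r * v<..} \<le> (r * v) powr \<alpha> * (C * (r * v) powr (- \<alpha>))"
            using C(2)[OF N p] by (intro mult_left_mono) auto
          also have "\<dots> = C" using p less_imp_neq[OF p] by (simp add: powr_minus)
          finally have "(r * v) powr \<alpha> * measure N {r * v<..} \<le> C" .
          moreover have "(r * v) powr \<alpha> * measure N {r * v<..} \<ge> 0" by simp
          ultimately have "\<bar>q\<bar> \<le> C + c" using c C(1) unfolding q_def by linarith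
          then show ?thesis using \<epsilon>' lt True by simp
        qed
        then have "\<bar>w v\<bar> * \<bar>q\<bar> \<le> \<bar>w v\<bar> * (\<epsilon>' + (C + c) * indicator {0<..<\<delta>} v)"
          by (intro mult_left_mono) auto
        then show ?thesis unfolding eq abs_mult by (simp add: algebra_simps)
      next
        case False
        then show ?thesis using \<epsilon>' by (simp add: w_def)
      qed
    qed
    also have "\<dots> = \<epsilon>' * k + (C + c) * (\<integral>v. \<bar>w v\<bar> * indicator {0<..<\<delta>} v \<partial>lborel)"
      unfolding k_def using w wi2 by (subst Bochner_Integration.integral_add) auto
    also have "\<dots> \<le> \<epsilon>" using \<epsilon>' \<delta>2 by linarith
    finally show ?thesis .
  qed
  show ?thesis
    using main \<delta>(1) by (intro exI[of _ "Y / \<delta>"]) (auto simp: Y_def)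
qed

end

section \<open>Truncation of powers, and inward jumps\<close>

lemma integrable_powr_tail:
  fixes \<alpha> a :: real
  assumes "1 < \<alpha>" "a > 0"
  shows "integrable lborel (\<lambda>v. v powr (- \<alpha>) * indicator {a<..} v)"
proof (rule integrableI_nn_integral_finite)
  show "(\<integral>\<^sup>+ v. ennreal (v powr (- \<alpha>) * indicator {a<..} v) \<partial>lborel) = ennreal (a powr (1 - \<alpha>) / (\<alpha> - 1))"
    using assms by (intro nn_integral_powr_tail)
qed auto

lemma integrable_powr_stable_tail:
  fixes \<alpha> \<nu> :: real
  assumes "1 < \<alpha>" "\<alpha> < 2" "\<nu> < \<alpha>"
  shows "integrable lborel (\<lambda>v. \<nu> * (1 + v) powr (\<nu> - 1) * v powr (- \<alpha>) * indicator {1<..} v)"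
proof -
  let ?w = "\<lambda>v. \<nu> * ((1 + v) powr (\<nu> - 1) - 1) * v powr (- \<alpha>) * indicator {0<..} v"
  have "integrable lborel (\<lambda>v. ?w v * indicator {1<..} v + \<nu> * (v powr (- \<alpha>) * indicator {1<..} v))"
    using assms by (intro Bochner_Integration.integrable_add integrable_mult_right integrable_powr_tail
      integrable_real_mult_indicator integrable_compensated_stable) auto
  moreover have "?w v * indicator {1<..} v + \<nu> * (v powr (- \<alpha>) * indicator {1<..} v) =
      \<nu> * (1 + v) powr (\<nu> - 1) * v powr (- \<alpha>) * indicator {1<..} v" for v
    by (auto simp: indicator_def algebra_simps)
  ultimately show ?thesis by (simp only:)
qed

text \<open>The excess over \<open>T powr \<nu>\<close> only accumulates where 1 + v > T. In this
  form the truncation loss is again a layer-cake integral.\<close>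

lemma truncated_powr_nn_integral:
  fixes \<nu> u T :: real
  assumes "0 < \<nu>" "T \<ge> 1" "u > 0"
  shows "(\<integral>\<^sup>+v. ennreal (\<nu> * (1 + v) powr (\<nu> - 1) * indicator {T - 1<..} v) * indicator {0<..<u} v \<partial>lborel)
      = ennreal (max 0 ((1 + u) powr \<nu> - T powr \<nu>))"
proof (cases "u \<le> T - 1")
  case True
  then have "(1 + u) powr \<nu> \<le> T powr \<nu>" using assms by (intro powr_mono2) auto
  moreover have "(\<integral>\<^sup>+v. ennreal (\<nu> * (1 + v) powr (\<nu> - 1) * indicator {T - 1<..} v) * indicator {0<..<u} v \<partial>lborel)
    = (\<integral>\<^sup>+v. 0 \<partial>(lborel :: real measure))"
    using True by (intro nn_integral_cong) (auto simp: indicator_def)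
  ultimately show ?thesis by simp
next
  case False
  have "(\<integral>\<^sup>+v. ennreal (\<nu> * (1 + v) powr (\<nu> - 1) * indicator {T - 1<..} v) * indicator {0<..<u} v \<partial>lborel)
    = (\<integral>\<^sup>+v. ennreal (\<nu> * (1 + v) powr (\<nu> - 1)) * indicator {T - 1..u} v \<partial>lborel)"
    using AE_lborel_singleton[of "T - 1"] AE_lborel_singleton[of u] assms
    by (intro nn_integral_cong_AE) (auto elim!: eventually_elim2 simp: indicator_def)
  also have "\<dots> = ennreal ((1 + u) powr \<nu> - (1 + (T - 1)) powr \<nu>)"
  proof (intro nn_integral_FTC_Icc)
    fix x assume "x \<in> {T - 1..u}"
    then show "((\<lambda>v. (1 + v) powr \<nu>) has_real_derivative \<nu> * (1 + x) powr (\<nu> - 1)) (at x)"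
      using assms by (auto intro!: derivative_eq_intros)
  qed (use assms False in auto)
  finally show ?thesis
    using assms False by (simp add: max_def powr_mono2)
qed

text \<open>Two mean value steps. The constant \<open>M\<close> bounds (1 + v)^(\<nu> - 2) on
  [-1/2, 0], where the maximum sits at an end that depends on the sign of \<nu> - 2.\<close>

lemma compensated_powr_near_0:
  fixes \<nu> :: real
  shows "\<exists>K\<ge>0. \<forall>u. - (1/2) \<le> u \<longrightarrow> u \<le> 0 \<longrightarrow> \<bar>(1 + u) powr \<nu> - 1 - \<nu> * u\<bar> \<le> K * u\<^sup>2"
proof -
  define M where "M = max 1 ((1/2) powr (\<nu> - 2))"
  have M: "(1 + v) powr (\<nu> - 2) \<le> M" if "- (1/2) \<le> v" "v \<le> 0" for v
  proof (cases "\<nu> \<ge> 2")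
    case True
    then have "(1 + v) powr (\<nu> - 2) \<le> 1 powr (\<nu> - 2)" using that by (intro powr_mono2) auto
    then show ?thesis by (simp add: M_def)
  next
    case False
    then have "(1 + v) powr (\<nu> - 2) \<le> (1/2) powr (\<nu> - 2)" using that by (intro powr_mono2') auto
    then show ?thesis by (simp add: M_def)
  qed
  have 1: "\<bar>(1 + v) powr (\<nu> - 1) - 1\<bar> \<le> \<bar>\<nu> - 1\<bar> * M * \<bar>v\<bar>" if v: "- (1/2) \<le> v" "v < 0" for v
  proof -
    have "\<exists>z>v. z < 0 \<and> (1 + 0) powr (\<nu> - 1) - (1 + v) powr (\<nu> - 1) = (0 - v) * ((\<nu> - 1) * (1 + z) powr (\<nu> - 2))"
    proof (rule MVT2)
      fix x assume "v \<le> x" "x \<le> 0"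
      then show "((\<lambda>v. (1 + v) powr (\<nu> - 1)) has_real_derivative (\<nu> - 1) * (1 + x) powr (\<nu> - 2)) (at x)"
        using v by (auto intro!: derivative_eq_intros)
    qed fact
    then obtain z where z: "v < z" "z < 0" "1 - (1 + v) powr (\<nu> - 1) = (0 - v) * ((\<nu> - 1) * (1 + z) powr (\<nu> - 2))" by auto
    have "\<bar>(1 + v) powr (\<nu> - 1) - 1\<bar> = \<bar>1 - (1 + v) powr (\<nu> - 1)\<bar>" by simp
    also have "\<dots> = \<bar>v\<bar> * \<bar>\<nu> - 1\<bar> * (1 + z) powr (\<nu> - 2)" unfolding z(3) by (simp add: abs_mult)
    also have "\<dots> \<le> \<bar>v\<bar> * \<bar>\<nu> - 1\<bar> * M" using v z by (intro mult_left_mono M mult_nonneg_nonneg abs_ge_zero) auto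
    finally show ?thesis by (simp add: mult_ac)
  qed
  have 2: "\<bar>(1 + u) powr \<nu> - 1 - \<nu> * u\<bar> \<le> \<bar>\<nu>\<bar> * (\<bar>\<nu> - 1\<bar> * M) * u\<^sup>2" if u: "- (1/2) \<le> u" "u \<le> 0" for u
  proof (cases "u < 0")
    case True
    let ?f = "\<lambda>u. (1 + u) powr \<nu> - 1 - \<nu> * u"
    have "\<exists>z>u. z < 0 \<and> ?f 0 - ?f u = (0 - u) * (\<nu> * ((1 + z) powr (\<nu> - 1) - 1))"
    proof (rule MVT2)
      fix x assume "u \<le> x" "x \<le> 0"
      then show "(?f has_real_derivative \<nu> * ((1 + x) powr (\<nu> - 1) - 1)) (at x)"
        using u by (intro compensated_powr_deriv) auto
    qed fact
    then obtain z where z: "u < z" "z < 0" "?f 0 - ?f u = (0 - u) * (\<nu> * ((1 + z) powr (\<nu> - 1) - 1))" by auto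
    have "\<bar>?f u\<bar> = \<bar>?f 0 - ?f u\<bar>" by simp
    also have "\<dots> = \<bar>u\<bar> * (\<bar>\<nu>\<bar> * \<bar>(1 + z) powr (\<nu> - 1) - 1\<bar>)" unfolding z(3) by (simp add: abs_mult)
    also have "\<dots> \<le> \<bar>u\<bar> * (\<bar>\<nu>\<bar> * (\<bar>\<nu> - 1\<bar> * M * \<bar>u\<bar>))"
    proof (intro mult_left_mono)
      have "\<bar>(1 + z) powr (\<nu> - 1) - 1\<bar> \<le> \<bar>\<nu> - 1\<bar> * M * \<bar>z\<bar>" using z u by (intro 1) auto
      also have "\<dots> \<le> \<bar>\<nu> - 1\<bar> * M * \<bar>u\<bar>" using z by (intro mult_left_mono) (auto simp: M_def)
      finally show "\<bar>(1 + z) powr (\<nu> - 1) - 1\<bar> \<le> \<bar>\<nu> - 1\<bar> * M * \<bar>u\<bar>" .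
    qed auto
    also have "\<dots> = \<bar>\<nu>\<bar> * (\<bar>\<nu> - 1\<bar> * M) * u\<^sup>2" by (simp add: power2_eq_square algebra_simps abs_mult_self_eq)
    finally show ?thesis .
  qed (use u in simp)
  show ?thesis
    by (rule exI[of _ "\<bar>\<nu>\<bar> * (\<bar>\<nu> - 1\<bar> * M)"]) (use 2 in \<open>auto simp: M_def\<close>)
qed

lemma square_le_powr:
  fixes u \<beta> :: real
  assumes "- 1 \<le> u" "u < 0" "\<beta> \<le> 2"
  shows "u\<^sup>2 \<le> (- u) powr \<beta>"
proof -
  have "u\<^sup>2 = (- u) powr 2" using assms by (simp add: powr_numeral)
  also have "\<dots> \<le> (- u) powr \<beta>" using assms by (intro powr_mono') auto
  finally show ?thesis .
qed

text \<open>Small inward jumps leave a second-order remainder, and u^2 \<le> (-u)^\<beta> as \<beta>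
  \<le> 2. For u < -1/2 each of the three terms is by itself of order (-u)^\<beta>. The absolute
  value accounts for jumps across the origin.\<close>

lemma compensated_powr_neg:
  fixes \<nu> \<beta> :: real
  assumes "0 < \<nu>" "\<nu> \<le> \<beta>" "1 \<le> \<beta>" "\<beta> \<le> 2"
  shows "\<exists>K\<ge>0. \<forall>u<0. \<bar>\<bar>1 + u\<bar> powr \<nu> - 1 - \<nu> * u\<bar> \<le> K * (- u) powr \<beta>"
proof -
  obtain K where K: "K \<ge> 0" "\<And>u. - (1/2) \<le> u \<Longrightarrow> u \<le> 0 \<Longrightarrow> \<bar>(1 + u) powr \<nu> - 1 - \<nu> * u\<bar> \<le> K * u\<^sup>2"
    using compensated_powr_near_0[of \<nu>] by blast
  define K' where "K' = K + (2 + (1 + \<nu>)) * 2 powr \<beta>"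
  have "\<bar>\<bar>1 + u\<bar> powr \<nu> - 1 - \<nu> * u\<bar> \<le> K' * (- u) powr \<beta>" if u: "u < 0" for u
  proof (cases "u \<ge> - (1/2)")
    case True
    have "\<bar>\<bar>1 + u\<bar> powr \<nu> - 1 - \<nu> * u\<bar> \<le> K * u\<^sup>2" using K(2)[OF True] True u by simp
    also have "\<dots> \<le> K * (- u) powr \<beta>" using True u assms K by (intro mult_left_mono square_le_powr) auto
    also have "\<dots> \<le> K' * (- u) powr \<beta>" using assms by (intro mult_right_mono) (auto simp: K'_def)
    finally show ?thesis .
  next
    case False
    \<comment> \<open>Doubling gives s \<ge> 1, so that all smaller powers of s are at most
      s^\<beta>; the price is the factor 2^\<beta> in \<open>K'\<close>.\<close>
    define s where "s = - 2 * u"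
    have s: "s \<ge> 1" using False by (simp add: s_def)
    have s1: "1 \<le> s powr \<beta>" using s assms by (simp add: ge_one_powr_ge_zero)
    have s2: "s \<le> s powr \<beta>" using s assms powr_mono[of 1 \<beta> s] by simp
    have s3: "s powr \<nu> \<le> s powr \<beta>" using s assms by (intro powr_mono) auto
    have "\<bar>1 + u\<bar> powr \<nu> \<le> s powr \<nu>" using False s assms by (intro powr_mono2) (auto simp: s_def)
    moreover have "\<nu> * (- u) \<le> \<nu> * s powr \<beta>" using s2 u assms by (intro mult_left_mono) (auto simp: s_def)
    ultimately have "\<bar>\<bar>1 + u\<bar> powr \<nu> - 1 - \<nu> * u\<bar> \<le> (2 + (1 + \<nu>)) * s powr \<beta>"
      using s1 s3 powr_ge_zero[of "\<bar>1 + u\<bar>" \<nu>] mult_nonneg_nonneg[of \<nu> "- u"] assms u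
        mult_nonneg_nonneg[of \<nu> "s powr \<beta>"]
      unfolding abs_le_iff ring_distribs by (intro conjI; linarith)
    also have "s powr \<beta> = 2 powr \<beta> * (- u) powr \<beta>" using u by (simp add: s_def powr_mult[symmetric])
    also have "(2 + (1 + \<nu>)) * (2 powr \<beta> * (- u) powr \<beta>) \<le> K' * (- u) powr \<beta>"
      using K by (simp add: K'_def algebra_simps)
    finally show ?thesis .
  qed
  moreover have "K' \<ge> 0" using K assms by (simp add: K'_def)
  ultimately show ?thesis by auto
qed

lemma npart_divide: "r > 0 \<Longrightarrow> npart (t / r) = npart t / r"
  by (simp add: npart_def divide_less_0_iff)

lemma npart_nonneg [simp]: "npart t \<ge> 0"
  by (simp add: npart_def)

lemma measurable_npart [measurable]: "npart \<in> borel_measurable borel"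
  unfolding npart_def by measurable

lemma eventually_powr_small:
  fixes K s \<epsilon> :: real
  assumes "s > 0" "\<epsilon> > 0" "K \<ge> 0"
  shows "\<exists>R>0. \<forall>r\<ge>R. K * r powr (- s) \<le> \<epsilon>"
proof -
  have "((\<lambda>r. K * r powr (- s)) \<longlongrightarrow> K * 0) at_top"
    using assms by (intro tendsto_intros tendsto_neg_powr filterlim_ident) auto
  then have "eventually (\<lambda>r. K * r powr (- s) < \<epsilon>) at_top"
    using assms by (intro order_tendstoD(2)[where y="K * 0"]) auto
  then obtain R where "\<forall>r\<ge>R. K * r powr (- s) < \<epsilon>" by (auto simp: eventually_at_top_linorder)
  then show ?thesis by (intro exI[of _ "max R 1"]) (auto intro: less_imp_le)
qed

context heavy_tails
begin

abbreviation overshoot :: "real \<Rightarrow> real \<Rightarrow> real \<Rightarrow> real \<Rightarrow> real" where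
  "overshoot \<nu> T r t \<equiv> max 0 ((1 + t / r) powr \<nu> - T powr \<nu>) * indicator {0<..} t"

text \<open>By scaling, inward jumps cost r^(-\<beta>), which is negligible against the leading
  order r^(-\<alpha>).\<close>

lemma npart_moment:
  assumes N: "N \<in> \<N>" and r: "r > 0"
  shows "integrable N (\<lambda>t. npart (t / r) powr \<beta>)"
    and "(\<integral>t. npart (t / r) powr \<beta> \<partial>N) \<le> B * r powr (- \<beta>)"
proof -
  have m: "(\<lambda>t. npart t powr \<beta>) \<in> borel_measurable N" by (rule measurable_N[OF N]) measurable
  have eq: "npart (t / r) powr \<beta> = r powr (- \<beta>) * npart t powr \<beta>" for t
    using r by (simp add: npart_divide powr_divide powr_minus_divide)
  have "(\<integral>\<^sup>+t. ennreal (npart t powr \<beta>) \<partial>N) < \<infinity>"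
    using le_less_trans[OF neg[OF N] ennreal_less_top] by simp
  then have i: "integrable N (\<lambda>t. npart t powr \<beta>)"
    using m by (intro integrableI_bounded) auto
  then show "integrable N (\<lambda>t. npart (t / r) powr \<beta>)" unfolding eq by simp
  have "ennreal (\<integral>t. npart t powr \<beta> \<partial>N) \<le> ennreal B"
    using neg[OF N] i by (subst nn_integral_eq_integral[symmetric]) auto
  then have "(\<integral>t. npart t powr \<beta> \<partial>N) \<le> B" using B by simp
  then show "(\<integral>t. npart (t / r) powr \<beta> \<partial>N) \<le> B * r powr (- \<beta>)"
    unfolding eq using r by simp
qed

text \<open>The loss is at most C r^(-\<alpha>) times the integral of one fixed integrable function
  beyond T - 1. The tail bound behind this holds at every scale, so a single choice of T serves all
  r > 0.\<close>

lemma trunc_loss: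
  fixes \<nu> \<eta> :: real
  assumes \<nu>: "0 < \<nu>" "\<nu> < \<alpha>" and \<eta>: "\<eta> > 0"
  shows "\<exists>T0\<ge>2. \<forall>T\<ge>T0. \<forall>r>0. \<forall>N\<in>\<N>.
    integrable N (overshoot \<nu> T r) \<and>
    (\<integral>t. overshoot \<nu> T r t \<partial>N) \<le> \<eta> * r powr (- \<alpha>)"
proof -
  define w where "w v = \<nu> * (1 + v) powr (\<nu> - 1) * v powr (- \<alpha>) * indicator {1<..} v" for v
  have w: "integrable lborel w" unfolding w_def using alpha \<nu> by (intro integrable_powr_stable_tail)
  have w0: "w v \<ge> 0" for v using \<nu> by (simp add: w_def)
  obtain C where C: "C > 0" "\<And>y N. N \<in> \<N> \<Longrightarrow> y > 0 \<Longrightarrow> measure N {y<..} \<le> C * y powr (- \<alpha>)"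
    using tail_bound by blast
  from integral_tail_small[OF w, of "\<eta> / C"] C \<eta> obtain S where S: "\<And>T. T \<ge> S \<Longrightarrow> (\<integral>v. \<bar>w v\<bar> * indicator {T<..} v \<partial>lborel) < \<eta> / C"
    by auto
  have main: "integrable N (overshoot \<nu> T r) \<and>
    (\<integral>t. overshoot \<nu> T r t \<partial>N) \<le> \<eta> * r powr (- \<alpha>)"
    if T: "T \<ge> max 2 (S + 1)" and r: "r > 0" and N: "N \<in> \<N>" for T r N
  proof -
    define \<psi> where "\<psi> v = \<nu> * (1 + v) powr (\<nu> - 1) * indicator {T - 1<..} v" for v
    define F where "F u = max 0 ((1 + u) powr \<nu> - T powr \<nu>)" for u
    have [measurable]: "\<psi> \<in> borel_measurable borel" "F \<in> borel_measurable borel"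
      unfolding \<psi>_def F_def by measurable
    have eq: "\<psi> v * v powr (- \<alpha>) * indicator {0<..} v = w v * indicator {T - 1<..} v" for v
      using T by (auto simp: \<psi>_def w_def indicator_def)
    have int: "integrable lborel (\<lambda>v. \<psi> v * v powr (- \<alpha>) * indicator {0<..} v)"
      unfolding eq using w by (intro integrable_real_mult_indicator) auto
    have int': "integrable lborel (\<lambda>v. w v * indicator {T - 1<..} v)"
      using w by (intro integrable_real_mult_indicator) auto
    have p: "\<And>v. v > 0 \<Longrightarrow> \<psi> v \<ge> 0" "\<And>u. u > 0 \<Longrightarrow> F u \<ge> 0"
      using \<nu> by (auto simp: \<psi>_def F_def)
    have nn: "\<And>u. u > 0 \<Longrightarrow> (\<integral>\<^sup>+v. ennreal (\<psi> v) * indicator {0<..<u} v \<partial>lborel) = ennreal (F u)"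
      unfolding \<psi>_def F_def using T \<nu> by (intro truncated_powr_nn_integral) auto
    note L = layer[OF \<open>\<psi> \<in> _\<close> \<open>F \<in> _\<close> N r p nn int]
    have "(\<integral>v. \<psi> v * indicator {0<..} v * measure N {r * v<..} \<partial>lborel) \<le> (\<integral>v. (C * r powr (- \<alpha>)) * (w v * indicator {T - 1<..} v) \<partial>lborel)"
    proof (rule integral_mono)
      fix v :: real
      show "\<psi> v * indicator {0<..} v * measure N {r * v<..} \<le> (C * r powr (- \<alpha>)) * (w v * indicator {T - 1<..} v)"
      proof (cases "v > 0")
        case True
        then have "\<psi> v * measure N {r * v<..} \<le> \<psi> v * (C * (r * v) powr (- \<alpha>))"
          using r C(2)[OF N, of "r * v"] p(1) by (intro mult_left_mono) auto
        also have "\<dots> = (C * r powr (- \<alpha>)) * (\<psi> v * v powr (- \<alpha>) * indicator {0<..} v)"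
          using True r by (simp add: powr_mult)
        finally show ?thesis using True unfolding eq by simp
      qed (use w0 C in simp)
    qed (use L(1) int' in auto)
    also have "\<dots> = C * r powr (- \<alpha>) * (\<integral>v. \<bar>w v\<bar> * indicator {T - 1<..} v \<partial>lborel)" using w0 by simp
    also have "\<dots> \<le> C * r powr (- \<alpha>) * (\<eta> / C)" using S[of "T - 1"] T C r by (intro mult_left_mono) auto
    also have "\<dots> = \<eta> * r powr (- \<alpha>)" using C by simp
    finally show ?thesis using L(2) by (simp add: has_bochner_integral_iff F_def)
  qed
  show ?thesis by (rule exI[of _ "max 2 (S + 1)"]) (use main in auto)
qed

lemma integrable_scaled_powr:
  assumes \<nu>: "0 < \<nu>" "\<nu> < \<alpha>" and N: "N \<in> \<N>" and r: "r > 0"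
  shows "integrable N (\<lambda>t. \<bar>1 + t / r\<bar> powr \<nu>)"
proof -
  interpret prob_space N by (rule prob) fact
  obtain T where T1: "T \<ge> 2" "\<forall>T'\<ge>T. \<forall>r>0. \<forall>N\<in>\<N>.
    integrable N (overshoot \<nu> T' r) \<and>
    (\<integral>t. overshoot \<nu> T' r t \<partial>N) \<le> 1 * r powr (- \<alpha>)"
    using trunc_loss[OF \<nu> zero_less_one] by blast
  have T: "T \<ge> 2" "integrable N (overshoot \<nu> T r)"
    by (rule T1(1), rule conjunct1[OF T1(2)[rule_format, OF order_refl r N]])
  have "integrable N (\<lambda>t. T powr \<nu> + 1 + overshoot \<nu> T r t + npart (t / r) powr \<beta>)"
    using T npart_moment(1)[OF N r] by auto
  then show ?thesis
  proof (rule Bochner_Integration.integrable_bound)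
    show "(\<lambda>t. \<bar>1 + t / r\<bar> powr \<nu>) \<in> borel_measurable N" by (rule measurable_N[OF N]) measurable
    show "AE t in N. norm (\<bar>1 + t / r\<bar> powr \<nu>) \<le> norm (T powr \<nu> + 1 + overshoot \<nu> T r t + npart (t / r) powr \<beta>)"
    proof (rule AE_I2)
      fix t :: real
      define u where "u = t / r"
      have it: "indicator {0<..} t = (indicator {0<..} u :: real)"
        using r by (simp add: u_def indicator_def zero_less_divide_iff)
      \<comment> \<open>The overshoot covers outward jumps beyond T, and the inward moment is called
        upon only for u < -1, a jump across the origin.\<close>
      have "\<bar>1 + u\<bar> powr \<nu> \<le> T powr \<nu> + 1 + max 0 ((1 + u) powr \<nu> - T powr \<nu>) * indicator {0<..} u + npart u powr \<beta>"
      proof -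
        consider "u > 0" | "- 1 \<le> u" "u \<le> 0" | "u < - 1" by linarith
        then show ?thesis
        proof cases
          case 1
          then show ?thesis by (simp, smt (verit) powr_ge_zero)
        next
          case 2
          then have "\<bar>1 + u\<bar> powr \<nu> \<le> 1" using \<nu> by (intro powr_le1) auto
          then show ?thesis using 2 by (simp, smt (verit) powr_ge_zero)
        next
          case 3
          then have "\<bar>1 + u\<bar> powr \<nu> \<le> (- u) powr \<nu>" using \<nu> by (intro powr_mono2) auto
          also have "\<dots> \<le> (- u) powr \<beta>" using \<nu> beta 3 by (intro powr_mono) auto
          finally show ?thesis using 3 by (simp add: npart_def, smt (verit) powr_ge_zero)
        qed
      qed
      then show "norm (\<bar>1 + t / r\<bar> powr \<nu>) \<le> norm (T powr \<nu> + 1 + overshoot \<nu> T r t + npart (t / r) powr \<beta>)"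
        unfolding it u_def[symmetric] by simp
    qed
  qed
qed

lemma integrable_id:
  assumes N: "N \<in> \<N>"
  shows "integrable N (\<lambda>t. t)"
proof -
  interpret prob_space N by (rule prob) fact
  \<comment> \<open>The exponent 1 is admissible because \<alpha> > 1, and |t| \<le> |1 + t| +
    1.\<close>
  have "integrable N (\<lambda>t. \<bar>1 + t / 1\<bar> powr 1 + 1)"
    by (intro Bochner_Integration.integrable_add integrable_const integrable_scaled_powr N alpha) auto
  then show ?thesis
  proof (rule Bochner_Integration.integrable_bound)
    show "(\<lambda>t. t) \<in> borel_measurable N" by (rule measurable_N[OF N]) simp
  qed auto
qed

text \<open>The linear Taylor term is removed for jumps of both signs, so that the exact mean
  appears. Of the rest, outward jumps produce the stable coefficient and inward ones at most K B
  r^(-\<beta>).\<close>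

lemma powr_asymp:
  fixes \<nu> :: real
  assumes \<nu>: "0 < \<nu>" "\<nu> < \<alpha>" and "\<epsilon> > 0"
  shows "\<exists>R>0. \<forall>r\<ge>R. \<forall>N\<in>\<N>.
     \<bar>(\<integral>t. \<bar>1 + t / r\<bar> powr \<nu> \<partial>N) - 1 - \<nu> / r * (\<integral>t. t \<partial>N) + c * \<nu> * stable_coeff \<alpha> \<nu> * r powr (- \<alpha>)\<bar> \<le> \<epsilon> * r powr (- \<alpha>)"
proof -
  have "\<epsilon> / 2 > 0" using assms by simp
  from compensated_asymp[OF \<nu>(2) this] obtain R1 where R1: "R1 > 0" "\<And>r N. r \<ge> R1 \<Longrightarrow> N \<in> \<N> \<Longrightarrow>
    \<bar>r powr \<alpha> * (\<integral>t. compensated \<nu> r t \<partial>N) + c * \<nu> * stable_coeff \<alpha> \<nu>\<bar> \<le> \<epsilon> / 2"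
    by blast
  obtain K where K: "K \<ge> 0" "\<And>u. u < 0 \<Longrightarrow> \<bar>\<bar>1 + u\<bar> powr \<nu> - 1 - \<nu> * u\<bar> \<le> K * (- u) powr \<beta>"
    using compensated_powr_neg[of \<nu> \<beta>] \<nu> alpha beta by auto
  obtain R2 where R2: "R2 > 0" "\<And>r. r \<ge> R2 \<Longrightarrow> K * B * r powr (- (\<beta> - \<alpha>)) \<le> \<epsilon> / 2"
    using eventually_powr_small[of "\<beta> - \<alpha>" "\<epsilon> / 2" "K * B"] K B beta assms by auto
  have "\<bar>(\<integral>t. \<bar>1 + t / r\<bar> powr \<nu> \<partial>N) - 1 - \<nu> / r * (\<integral>t. t \<partial>N) + c * \<nu> * stable_coeff \<alpha> \<nu> * r powr (- \<alpha>)\<bar> \<le> \<epsilon> * r powr (- \<alpha>)"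
    if r: "r \<ge> max R1 R2" and N: "N \<in> \<N>" for r N
  proof -
    interpret prob_space N by (rule prob) fact
    have r0: "r > 0" using r R1 by simp
    let ?p = "compensated \<nu> r"
    let ?n = "\<lambda>t. (\<bar>1 + t / r\<bar> powr \<nu> - 1 - \<nu> / r * t) - ?p t"
    have ip: "integrable N ?p" using compensated_layer(2)[OF \<nu>(2) N r0] by (simp add: has_bochner_integral_iff)
    have i1: "integrable N (\<lambda>t. \<bar>1 + t / r\<bar> powr \<nu> - 1 - \<nu> / r * t)"
      by (intro Bochner_Integration.integrable_diff integrable_mult_right integrable_const integrable_id integrable_scaled_powr \<nu> N r0)
    have e1: "(\<integral>t. \<bar>1 + t / r\<bar> powr \<nu> - 1 - \<nu> / r * t \<partial>N) = (\<integral>t. \<bar>1 + t / r\<bar> powr \<nu> \<partial>N) - 1 - \<nu> / r * (\<integral>t. t \<partial>N)"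
      using integrable_id[OF N] integrable_scaled_powr[OF \<nu> N r0]
      by (simp add: Bochner_Integration.integral_diff prob_space)
    have "\<bar>\<integral>t. ?n t \<partial>N\<bar> \<le> (\<integral>t. K * npart (t / r) powr \<beta> \<partial>N)"
    proof (rule integral_abs_bound[THEN order_trans], rule integral_mono)
      fix t :: real
      consider "t > 0" | "t = 0" | "t < 0" by linarith
      then show "\<bar>?n t\<bar> \<le> K * npart (t / r) powr \<beta>"
      proof cases
        case 1 then show ?thesis using K r0 by simp
      next
        case 2 then show ?thesis using K by simp
      next
        case 3
        then have "t / r < 0" using r0 by (simp add: divide_less_0_iff)
        from K(2)[OF this] show ?thesis using 3 \<open>t / r < 0\<close> by (simp add: npart_def)
      qed
    qed (use ip i1 npart_moment(1)[OF N r0] in auto)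
    also have "\<dots> \<le> K * (B * r powr (- \<beta>))" using K npart_moment(2)[OF N r0] by (simp add: mult_left_mono)
    also have "\<dots> = (K * B * r powr (- (\<beta> - \<alpha>))) * r powr (- \<alpha>)" using r0 by (simp add: powr_add[symmetric])
    also have "\<dots> \<le> \<epsilon> / 2 * r powr (- \<alpha>)" using R2(2)[of r] r by (intro mult_right_mono) auto
    finally have n: "\<bar>\<integral>t. ?n t \<partial>N\<bar> \<le> \<epsilon> / 2 * r powr (- \<alpha>)" .
    have e2: "(\<integral>t. ?n t \<partial>N) = (\<integral>t. \<bar>1 + t / r\<bar> powr \<nu> \<partial>N) - 1 - \<nu> / r * (\<integral>t. t \<partial>N) - (\<integral>t. ?p t \<partial>N)"
      using i1 ip by (simp only: Bochner_Integration.integral_diff e1)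
    have ra: "r powr \<alpha> * r powr (- \<alpha>) = 1" using r0 by (simp add: powr_add[symmetric])
    have e3: "(\<integral>t. ?p t \<partial>N) + c * \<nu> * stable_coeff \<alpha> \<nu> * r powr (- \<alpha>) = (r powr \<alpha> * (\<integral>t. ?p t \<partial>N) + c * \<nu> * stable_coeff \<alpha> \<nu>) * r powr (- \<alpha>)"
      using ra by (simp add: ring_distribs mult_ac)
    have "\<bar>r powr \<alpha> * (\<integral>t. ?p t \<partial>N) + c * \<nu> * stable_coeff \<alpha> \<nu>\<bar> * r powr (- \<alpha>) \<le> \<epsilon> / 2 * r powr (- \<alpha>)"
      by (rule mult_right_mono[OF R1(2)[OF _ N]]) (use r in auto)
    then have "\<bar>(\<integral>t. ?p t \<partial>N) + c * \<nu> * stable_coeff \<alpha> \<nu> * r powr (- \<alpha>)\<bar> \<le> \<epsilon> / 2 * r powr (- \<alpha>)"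
      unfolding e3 by (simp only: abs_mult abs_of_nonneg[OF powr_ge_zero])
    moreover have "\<bar>i - 1 - k + x\<bar> \<le> 2 * E" if "\<bar>p + x\<bar> \<le> E" "\<bar>m\<bar> \<le> E" "m = i - 1 - k - p"
      for i k x E m p :: real
      using that by linarith
    ultimately have "\<bar>(\<integral>t. \<bar>1 + t / r\<bar> powr \<nu> \<partial>N) - 1 - \<nu> / r * (\<integral>t. t \<partial>N) + c * \<nu> * stable_coeff \<alpha> \<nu> * r powr (- \<alpha>)\<bar> \<le> 2 * (\<epsilon> / 2 * r powr (- \<alpha>))"
      using n e2 by blast
    then show ?thesis by simp
  qed
  then show ?thesis using R1 by (intro exI[of _ "max R1 R2"]) auto
qed

text \<open>Truncation acts on two kinds of jumps: outward ones that overshoot T, made harmless by a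
  large T, and inward ones that cross the origin and land beyond T on the other side, made harmless
  by a large r through the moment of order \<beta>.\<close>

lemma truncated_powr_asymp:
  fixes \<nu> :: real
  assumes \<nu>: "0 < \<nu>" "\<nu> < \<alpha>" and "\<epsilon> > 0"
  shows "\<exists>T0\<ge>2. \<exists>R>0. \<forall>T\<ge>T0. \<forall>r\<ge>R. \<forall>N\<in>\<N>.
     (\<integral>t. (min \<bar>1 + t / r\<bar> T) powr \<nu> \<partial>N) \<ge> (\<integral>t. \<bar>1 + t / r\<bar> powr \<nu> \<partial>N) - \<epsilon> * r powr (- \<alpha>)"
proof -
  obtain T0 where T0: "T0 \<ge> 2" "\<And>T r N. T \<ge> T0 \<Longrightarrow> r > 0 \<Longrightarrow> N \<in> \<N> \<Longrightarrow> integrable N (overshoot \<nu> T r) \<and>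
    (\<integral>t. overshoot \<nu> T r t \<partial>N) \<le> \<epsilon> / 2 * r powr (- \<alpha>)"
    using trunc_loss[OF \<nu>, of "\<epsilon> / 2"] assms by auto
  obtain R2 where R2: "R2 > 0" "\<And>r. r \<ge> R2 \<Longrightarrow> B * r powr (- (\<beta> - \<alpha>)) \<le> \<epsilon> / 2"
    using eventually_powr_small[of "\<beta> - \<alpha>" "\<epsilon> / 2" "B"] B beta assms by auto
  have "(\<integral>t. (min \<bar>1 + t / r\<bar> T) powr \<nu> \<partial>N) \<ge> (\<integral>t. \<bar>1 + t / r\<bar> powr \<nu> \<partial>N) - \<epsilon> * r powr (- \<alpha>)"
    if T: "T \<ge> T0" and r: "r \<ge> R2" and N: "N \<in> \<N>" for T r N
  proof -
    interpret prob_space N by (rule prob) fact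
    have r0: "r > 0" using r R2 by simp
    let ?F = "\<lambda>t. overshoot \<nu> T r t"
    let ?n = "\<lambda>t. npart (t / r) powr \<beta>"
    have iF: "integrable N ?F" and F: "(\<integral>t. ?F t \<partial>N) \<le> \<epsilon> / 2 * r powr (- \<alpha>)" using T0(2)[OF T r0 N] by auto
    have iN: "integrable N ?n" by (rule npart_moment(1)[OF N r0])
    have i1: "integrable N (\<lambda>t. \<bar>1 + t / r\<bar> powr \<nu>)" by (rule integrable_scaled_powr[OF \<nu> N r0])
    have i2: "integrable N (\<lambda>t. (min \<bar>1 + t / r\<bar> T) powr \<nu>)"
    proof (rule Bochner_Integration.integrable_bound[OF i1])
      show "(\<lambda>t. (min \<bar>1 + t / r\<bar> T) powr \<nu>) \<in> borel_measurable N" by (rule measurable_N[OF N]) measurable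
      show "AE t in N. norm (min \<bar>1 + t / r\<bar> T powr \<nu>) \<le> norm (\<bar>1 + t / r\<bar> powr \<nu>)"
        using \<nu> T T0(1) by (intro AE_I2) (auto intro!: powr_mono2)
    qed
    have "(\<integral>t. \<bar>1 + t / r\<bar> powr \<nu> \<partial>N) - (\<integral>t. (min \<bar>1 + t / r\<bar> T) powr \<nu> \<partial>N) =
       (\<integral>t. \<bar>1 + t / r\<bar> powr \<nu> - (min \<bar>1 + t / r\<bar> T) powr \<nu> \<partial>N)"
      using i1 i2 by simp
    also have "\<dots> \<le> (\<integral>t. ?F t + ?n t \<partial>N)"
    proof (rule integral_mono)
      fix t :: real
      define u where "u = t / r"
      have it: "indicator {0<..} t = (indicator {0<..} u :: real)"
        using r0 by (simp add: u_def indicator_def zero_less_divide_iff)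
      have "\<bar>1 + u\<bar> powr \<nu> - (min \<bar>1 + u\<bar> T) powr \<nu> \<le> max 0 ((1 + u) powr \<nu> - T powr \<nu>) * indicator {0<..} u + npart u powr \<beta>"
      proof (cases "\<bar>1 + u\<bar> \<le> T")
        case True
        then show ?thesis by (simp add: min_def)
      next
        case False
        show ?thesis
        proof (cases "u > 0")
          case True
          then show ?thesis using False by (simp add: min_def, smt (verit) powr_ge_zero)
        next
          case neg: False
          then have "u < - 1" using False T T0(1) by linarith
          then have "\<bar>1 + u\<bar> powr \<nu> \<le> (- u) powr \<nu>" using \<nu> by (intro powr_mono2) auto
          also have "\<dots> \<le> (- u) powr \<beta>" using \<nu> beta \<open>u < - 1\<close> by (intro powr_mono) auto
          finally show ?thesis using \<open>u < - 1\<close> by (simp add: npart_def, smt (verit) powr_ge_zero)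
        qed
      qed
      then show "\<bar>1 + t / r\<bar> powr \<nu> - (min \<bar>1 + t / r\<bar> T) powr \<nu> \<le> ?F t + ?n t"
        unfolding it u_def[symmetric] by simp
    qed (use i1 i2 iF iN in auto)
    also have "\<dots> \<le> \<epsilon> / 2 * r powr (- \<alpha>) + B * r powr (- \<beta>)"
      using iF iN F npart_moment(2)[OF N r0] by simp
    also have "B * r powr (- \<beta>) = (B * r powr (- (\<beta> - \<alpha>))) * r powr (- \<alpha>)" using r0 by (simp add: powr_add[symmetric])
    also have "\<epsilon> / 2 * r powr (- \<alpha>) + \<dots> \<le> \<epsilon> / 2 * r powr (- \<alpha>) + \<epsilon> / 2 * r powr (- \<alpha>)"
      using R2(2)[OF r] by (intro add_left_mono mult_right_mono) auto
    finally show ?thesis by simp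
  qed
  then show ?thesis using T0 R2 by (intro exI[of _ T0] conjI exI[of _ R2]) auto
qed

text \<open>The flat piece below h keeps the function at most 1. An inward jump of more than r/2 may
  land on it and costs 2^\<beta> B r^(-\<beta>), without the prefactor (r/h)^(-\<rho>). The choice
  \<rho> = \<beta> - \<alpha> repairs this: r^(-\<beta>) = r^(-\<rho>) r^(-\<alpha>), and
  r^(-\<rho>) \<le> (r/h)^(-\<rho>) because h \<ge> 1.\<close>

lemma decreasing_powr_bound:
  defines "\<rho> \<equiv> \<beta> - \<alpha>"
  shows "\<exists>C\<ge>0. \<exists>R\<ge>1. \<forall>h\<ge>R. \<forall>r\<ge>h. \<forall>N\<in>\<N>.
    (\<integral>t. (max 1 (\<bar>r + t\<bar> / h)) powr (- \<rho>) \<partial>N) \<le> (r / h) powr (- \<rho>) * (1 - \<rho> / r * (\<integral>t. t \<partial>N) + C * r powr (- \<alpha>))"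
proof -
  have \<rho>: "\<rho> > 0" "\<rho> < 1" using beta alpha by (auto simp: \<rho>_def)
  define C where "C = 1 + \<bar>c * (- \<rho>) * stable_coeff \<alpha> (- \<rho>)\<bar>"
  have "- \<rho> < \<alpha>" using \<rho> alpha by simp
  from compensated_asymp[OF this zero_less_one] obtain R1 where R1: "\<And>r N. r \<ge> R1 \<Longrightarrow> N \<in> \<N> \<Longrightarrow>
     \<bar>r powr \<alpha> * (\<integral>t. compensated (- \<rho>) r t \<partial>N) + c * (- \<rho>) * stable_coeff \<alpha> (- \<rho>)\<bar> \<le> 1"
    by blast
  have C: "C \<ge> 0" "(\<integral>t. compensated (- \<rho>) r t \<partial>N) \<le> C * r powr (- \<alpha>)" if "r \<ge> max 1 R1" "N \<in> \<N>" for r N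
  proof -
    have "r powr \<alpha> * (\<integral>t. compensated (- \<rho>) r t \<partial>N) \<le> C" using R1[OF _ that(2), of r] that(1) by (simp add: C_def)
    then show "(\<integral>t. compensated (- \<rho>) r t \<partial>N) \<le> C * r powr (- \<alpha>)" using that(1) by (simp add: powr_minus field_simps)
  qed (simp add: C_def)
  obtain K where K: "K \<ge> 0" "\<And>u. - (1/2) \<le> u \<Longrightarrow> u \<le> 0 \<Longrightarrow> \<bar>(1 + u) powr (- \<rho>) - 1 - (- \<rho>) * u\<bar> \<le> K * u\<^sup>2"
    using compensated_powr_near_0[of "- \<rho>"] by blast
  define C' where "C' = C + K * B + 2 powr \<beta> * B"
  have "(\<integral>t. (max 1 (\<bar>r + t\<bar> / h)) powr (- \<rho>) \<partial>N) \<le> (r / h) powr (- \<rho>) * (1 - \<rho> / r * (\<integral>t. t \<partial>N) + C' * r powr (- \<alpha>))"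
    if h1: "h \<ge> max 1 R1" and r: "r \<ge> h" and N: "N \<in> \<N>" for h r N
  proof -
    interpret prob_space N by (rule prob) fact
    have h: "h \<ge> 1" and r0: "r > 0" and rR: "r \<ge> max 1 R1" using r h1 by auto
    define A where "A = (r / h) powr (- \<rho>)"
    have A: "A \<ge> 0" by (simp add: A_def)
    let ?p = "compensated (- \<rho>) r"
    let ?n = "\<lambda>t. npart (t / r) powr \<beta>"
    have ip: "integrable N ?p" using compensated_layer(2)[OF _ N r0, of "- \<rho>"] \<rho> alpha by (simp add: has_bochner_integral_iff)
    have iN: "integrable N ?n" by (rule npart_moment(1)[OF N r0])
    have ig: "integrable N (\<lambda>t. (max 1 (\<bar>r + t\<bar> / h)) powr (- \<rho>))"
    proof (rule integrable_const_bound[where B=1])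
      show "(\<lambda>t. (max 1 (\<bar>r + t\<bar> / h)) powr (- \<rho>)) \<in> borel_measurable N" by (rule measurable_N[OF N]) measurable
      show "AE t in N. norm ((max 1 (\<bar>r + t\<bar> / h)) powr (- \<rho>)) \<le> 1"
      proof (rule AE_I2)
        fix t :: real
        have "(max 1 (\<bar>r + t\<bar> / h)) powr (- \<rho>) \<le> 1 powr (- \<rho>)" using \<rho> by (intro powr_mono2') auto
        then show "norm ((max 1 (\<bar>r + t\<bar> / h)) powr (- \<rho>)) \<le> 1" by simp
      qed
    qed
    have "(\<integral>t. (max 1 (\<bar>r + t\<bar> / h)) powr (- \<rho>) \<partial>N) \<le> (\<integral>t. A * (1 - \<rho> / r * t + ?p t) + (A * K + 2 powr \<beta>) * ?n t \<partial>N)"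
    proof (rule integral_mono)
      fix t :: real
      define u where "u = t / r"
      have it: "indicator {0<..} t = (indicator {0<..} u :: real)"
        using r0 by (simp add: u_def indicator_def zero_less_divide_iff)
      have t: "t = r * u" using r0 by (simp add: u_def)
      have rt: "\<bar>r + t\<bar> / h = r / h * \<bar>1 + u\<bar>"
      proof -
        have "r + t = r * (1 + u)" unfolding t by (simp add: algebra_simps)
        then show ?thesis using r0 by (simp add: abs_mult)
      qed
      have rh: "r / h \<ge> 1" using r h by simp
      have "(max 1 (r / h * \<bar>1 + u\<bar>)) powr (- \<rho>) \<le> A * (1 - \<rho> * u + ((1 + u) powr (- \<rho>) - 1 - (- \<rho>) * u) * indicator {0<..} u) + (A * K + 2 powr \<beta>) * npart u powr \<beta>"
      proof -
        \<comment> \<open>Outward jumps stay above h and give an identity. Small inward jumps obey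
          the Taylor bound once the maximum is dropped, which only increases a negative power. Large
          inward jumps use the trivial bound 1 \<le> (-2u)^\<beta>.\<close>
        consider "u \<ge> 0" | "- (1/2) \<le> u" "u < 0" | "u < - (1/2)" by linarith
        then show ?thesis
        proof cases
          case 1
          have "1 * 1 \<le> r / h * (1 + u)" using rh 1 by (intro mult_mono) auto
          then have "(max 1 (r / h * \<bar>1 + u\<bar>)) powr (- \<rho>) = A * (1 + u) powr (- \<rho>)"
            using 1 r h by (simp add: A_def powr_mult[symmetric] max_def)
          then show ?thesis using 1 A K by (cases "u = 0") (auto simp: npart_def algebra_simps)
        next
          case 2
          have "(max 1 (r / h * \<bar>1 + u\<bar>)) powr (- \<rho>) \<le> (r / h * \<bar>1 + u\<bar>) powr (- \<rho>)"
            using 2 r0 h \<rho> by (intro powr_mono2') auto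
          also have "\<dots> = A * (1 + u) powr (- \<rho>)"
            using 2 r h powr_mult[of "r / h" "1 + u" "- \<rho>"] by (simp add: A_def)
          also have "\<dots> \<le> A * (1 - \<rho> * u + K * (- u) powr \<beta>)"
          proof (intro mult_left_mono A)
            have "K * u\<^sup>2 \<le> K * (- u) powr \<beta>" using 2 beta K by (intro mult_left_mono square_le_powr) auto
            then show "(1 + u) powr (- \<rho>) \<le> 1 - \<rho> * u + K * (- u) powr \<beta>" using K(2)[of u] 2 by (simp add: abs_le_iff)
          qed
          also have "\<dots> \<le> A * (1 - \<rho> * u) + (A * K + 2 powr \<beta>) * (- u) powr \<beta>"
            using 2 by (simp add: algebra_simps)
          finally show ?thesis using 2 by (simp add: npart_def)
        next
          case 3
          have "(max 1 (r / h * \<bar>1 + u\<bar>)) powr (- \<rho>) \<le> 1 powr (- \<rho>)" using \<rho> by (intro powr_mono2') auto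
          also have "\<dots> \<le> (2 * (- u)) powr \<beta>" using 3 beta alpha by (auto intro!: ge_one_powr_ge_zero)
          also have "\<dots> = 2 powr \<beta> * (- u) powr \<beta>" by (rule powr_mult)
          also have "\<dots> \<le> A * (1 - \<rho> * u) + (A * K + 2 powr \<beta>) * (- u) powr \<beta>"
          proof -
            have "0 \<le> A * (1 - \<rho> * u)" using A \<rho> 3 mult_nonneg_nonpos[of \<rho> u] by (intro mult_nonneg_nonneg) auto
            moreover have "0 \<le> A * K * (- u) powr \<beta>" using A K by simp
            ultimately show ?thesis by (simp add: ring_distribs)
          qed
          finally show ?thesis using 3 by (simp add: npart_def)
        qed
      qed
      then show "(max 1 (\<bar>r + t\<bar> / h)) powr (- \<rho>) \<le> A * (1 - \<rho> / r * t + ?p t) + (A * K + 2 powr \<beta>) * ?n t"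
        unfolding rt it u_def[symmetric] using r0 by (simp add: t)
    qed (use ig ip iN integrable_id[OF N] in auto)
    also have "\<dots> = A * (1 - \<rho> / r * (\<integral>t. t \<partial>N) + (\<integral>t. ?p t \<partial>N)) + (A * K + 2 powr \<beta>) * (\<integral>t. ?n t \<partial>N)"
      using ip iN integrable_id[OF N] by (simp add: prob_space)
    also have "\<dots> \<le> A * (1 - \<rho> / r * (\<integral>t. t \<partial>N) + C * r powr (- \<alpha>)) + (A * K + 2 powr \<beta>) * (B * r powr (- \<beta>))"
      using C(2)[OF rR N] A K npart_moment(2)[OF N r0] by (intro add_mono mult_left_mono) auto
    also have "(A * K + 2 powr \<beta>) * (B * r powr (- \<beta>)) \<le> A * (K * B + 2 powr \<beta> * B) * r powr (- \<alpha>)"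
    proof -
      have rb: "r powr (- \<beta>) = r powr (- \<rho>) * r powr (- \<alpha>)" by (simp add: powr_add[symmetric] \<rho>_def)
      have "r powr (- \<rho>) \<le> 1 powr (- \<rho>)" using r h \<rho> by (intro powr_mono2') auto
      then have r1: "r powr (- \<rho>) \<le> 1" by simp
      have r2: "r powr (- \<rho>) \<le> A" unfolding A_def using r0 h \<rho> by (intro powr_mono2') (auto simp: field_simps)
      have "(A * K + 2 powr \<beta>) * (B * r powr (- \<beta>)) = (A * K * B * r powr (- \<rho>) + 2 powr \<beta> * B * r powr (- \<rho>)) * r powr (- \<alpha>)"
        unfolding rb by (simp add: algebra_simps)
      also have "\<dots> \<le> (A * K * B * 1 + 2 powr \<beta> * B * A) * r powr (- \<alpha>)"
        using A K B r1 r2 by (intro mult_right_mono add_mono mult_left_mono) auto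
      finally show ?thesis by (simp add: algebra_simps)
    qed
    finally show ?thesis unfolding A_def C'_def by (simp add: algebra_simps)
  qed
  moreover have "C' \<ge> 0" using K B by (simp add: C'_def C_def)
  ultimately show ?thesis by (intro exI[of _ C'] conjI exI[of _ "max 1 R1"]) auto
qed

end

section \<open>Survival probabilities and moments of the hitting time\<close>

text \<open>The probability that a chain started at x has modulus above a at all times 0, ..., n.
  Being built from the kernel alone, it needs no sample space; \<open>emeasure_survival\<close>
  supplies the link to a given chain.\<close>

primrec survival :: "(real \<Rightarrow> real measure) \<Rightarrow> real \<Rightarrow> nat \<Rightarrow> real \<Rightarrow> real" where
  "survival K a 0 x = indicator {x. a < \<bar>x\<bar>} x"
| "survival K a (Suc n) x = indicator {x. a < \<bar>x\<bar>} x * (\<integral>z. survival K a n z \<partial>K x)"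

text \<open>The index n = 0 is excluded because \<open>0 powr (- p)\<close> is 0 while survival at
  time 0 may be 1.\<close>

definition survival_O :: "(real \<Rightarrow> real measure) \<Rightarrow> real \<Rightarrow> real \<Rightarrow> real \<Rightarrow> bool" where
  "survival_O K a x p \<longleftrightarrow> (\<exists>C\<ge>0. \<forall>n\<ge>1. survival K a n x \<le> C * real n powr (- p))"

definition survival_Omega :: "(real \<Rightarrow> real measure) \<Rightarrow> real \<Rightarrow> real \<Rightarrow> real \<Rightarrow> bool" where
  "survival_Omega K a x p \<longleftrightarrow> (\<exists>C>0. \<exists>n0. \<forall>n\<ge>n0. C * real n powr (- p) \<le> survival K a n x)"

lemma survival_zero: "\<bar>x\<bar> \<le> a \<Longrightarrow> survival K a n x = 0"
  by (cases n) auto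

context
  fixes K :: "real \<Rightarrow> real measure"
  assumes K: "K \<in> borel \<rightarrow>\<^sub>M prob_algebra borel"
begin

lemma prob_space_kernel: "prob_space (K x)" and sets_kernel: "sets (K x) = sets borel"
  using measurable_space[OF K, of x] by (auto simp: space_prob_algebra)

lemma space_kernel: "space (K x) = UNIV"
  using sets_eq_imp_space_eq[OF sets_kernel] by simp

lemma measurable_kernel: "f \<in> borel_measurable borel \<Longrightarrow> f \<in> borel_measurable (K x)"
  using measurable_cong_sets[OF sets_kernel refl] by blast

lemma measurable_survival: "survival K a n \<in> borel_measurable borel"
proof (induction n)
  case 0
  have "survival K a 0 = indicator {x. a < \<bar>x\<bar>}" by (rule ext) simp
  also have "\<dots> \<in> borel_measurable borel" by measurable
  finally show ?case .
next
  case (Suc n)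
  have "(\<lambda>M. \<integral>z. survival K a n z \<partial>M) \<in> subprob_algebra borel \<rightarrow>\<^sub>M borel"
    by (rule integral_measurable_subprob_algebra[OF Suc])
  then have [measurable]: "(\<lambda>x. \<integral>z. survival K a n z \<partial>K x) \<in> borel_measurable borel"
    using measurable_compose[OF measurable_prob_algebraD[OF K]] by blast
  have "survival K a (Suc n) = (\<lambda>x. indicator {x. a < \<bar>x\<bar>} x * (\<integral>z. survival K a n z \<partial>K x))" by (rule ext) simp
  also have "\<dots> \<in> borel_measurable borel" by measurable
  finally show ?case .
qed

lemma survival_bounds: "0 \<le> survival K a n x" "survival K a n x \<le> 1"
proof -
  have "0 \<le> survival K a n x \<and> survival K a n x \<le> 1"
  proof (induction n arbitrary: x)
    case (Suc n)
    interpret prob_space "K x" by (rule prob_space_kernel)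
    have "integrable (K x) (survival K a n)"
      by (rule integrable_const_bound[where B=1]) (use Suc measurable_kernel[OF measurable_survival] in auto)
    then have "(\<integral>z. survival K a n z \<partial>K x) \<le> (\<integral>z. 1 \<partial>K x)"
      by (intro integral_mono) (use Suc in auto)
    moreover have "0 \<le> (\<integral>z. survival K a n z \<partial>K x)" using Suc by (intro integral_nonneg_AE) auto
    ultimately show ?case by (auto simp: indicator_def prob_space)
  qed (auto simp: indicator_def)
  then show "0 \<le> survival K a n x" "survival K a n x \<le> 1" by auto
qed

lemma integrable_survival: "integrable (K x) (survival K a n)"
proof -
  interpret prob_space "K x" by (rule prob_space_kernel)
  show ?thesis
    by (rule integrable_const_bound[where B=1]) (use survival_bounds measurable_kernel[OF measurable_survival] in auto)
qed

lemma survival_Suc_le: "survival K a (Suc n) x \<le> survival K a n x"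
proof (induction n arbitrary: x)
  case 0
  then show ?case using survival_bounds(2)[of a "Suc 0" x] by (auto simp: indicator_def)
next
  case (Suc n)
  have "(\<integral>z. survival K a (Suc n) z \<partial>K x) \<le> (\<integral>z. survival K a n z \<partial>K x)"
    by (intro integral_mono integrable_survival Suc)
  then show ?case by (simp add: mult_left_mono)
qed

lemma survival_level_antimono: "a \<le> h \<Longrightarrow> survival K h n x \<le> survival K a n x"
proof (induction n arbitrary: x)
  case (Suc n)
  have "(\<integral>z. survival K h n z \<partial>K x) \<le> (\<integral>z. survival K a n z \<partial>K x)"
    by (intro integral_mono integrable_survival Suc)
  moreover have "0 \<le> (\<integral>z. survival K h n z \<partial>K x)" using survival_bounds by (intro integral_nonneg_AE) auto
  ultimately show ?case using Suc(2) by (auto simp: indicator_def)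
qed (auto simp: indicator_def)

text \<open>A chain is specified only by its probabilities on product events. Weighting
  \<open>M\<close> by the event of the past gives a measure \<open>D\<close> under which the law of
  the next state is the mixture \<open>D \<bind> (\<lambda>w. K (\<xi> n w))\<close>. This is
  checked on sets, and equality of the two measures then extends it to functions.\<close>

lemma markov_chain_step:
  fixes g :: "real \<Rightarrow> ennreal"
  assumes mc: "markov_chain_from M \<xi> K x" and A: "A \<in> sets borel" and g: "g \<in> borel_measurable borel"
  shows "(\<integral>\<^sup>+w. indicator {w\<in>space M. \<forall>i\<le>n. \<xi> i w \<in> A} w * g (\<xi> (Suc n) w) \<partial>M) =
    (\<integral>\<^sup>+w. indicator {w\<in>space M. \<forall>i\<le>n. \<xi> i w \<in> A} w * (\<integral>\<^sup>+z. g z \<partial>K (\<xi> n w)) \<partial>M)"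
proof -
  have M: "prob_space M" and X[measurable]: "\<And>n. \<xi> n \<in> borel_measurable M"
    using mc by (auto simp: markov_chain_from_def)
  interpret prob_space M by fact
  let ?E = "{w\<in>space M. \<forall>i\<le>n. \<xi> i w \<in> A}"
  note A [measurable]
  have E [measurable]: "?E \<in> sets M" by measurable
  define D where "D = density M (indicator ?E)"
  have D: "sets D = sets M" "space D = space M" by (simp_all add: D_def)
  have XD: "\<xi> i \<in> borel_measurable D" for i using X[of i] by (simp add: D_def)
  have KD: "(\<lambda>w. K (\<xi> n w)) \<in> D \<rightarrow>\<^sub>M subprob_algebra borel"
    using measurable_compose[OF XD measurable_prob_algebraD[OF K]] .
  have "distr D borel (\<xi> (Suc n)) = D \<bind> (\<lambda>w. K (\<xi> n w))"
  proof (rule measure_eqI)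
    show "sets (distr D borel (\<xi> (Suc n))) = sets (D \<bind> (\<lambda>w. K (\<xi> n w)))"
      using not_empty by (subst sets_bind) (auto simp: sets_kernel D)
    fix B assume "B \<in> sets (distr D borel (\<xi> (Suc n)))"
    then have B [measurable]: "B \<in> sets borel" by simp
    have "emeasure (distr D borel (\<xi> (Suc n))) B = emeasure D (\<xi> (Suc n) -` B \<inter> space M)"
      using XD by (simp add: emeasure_distr D)
    also have "\<dots> = (\<integral>\<^sup>+w. indicator ?E w * indicator (\<xi> (Suc n) -` B \<inter> space M) w \<partial>M)"
      unfolding D_def by (rule emeasure_density) (use measurable_sets[OF X B] in auto)
    also have "\<dots> = (\<integral>\<^sup>+w. indicator {w\<in>space M. (\<forall>i\<le>n. \<xi> i w \<in> A) \<and> \<xi> (Suc n) w \<in> B} w \<partial>M)"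
      by (intro nn_integral_cong) (auto simp: indicator_def)
    also have "\<dots> = emeasure M {w\<in>space M. (\<forall>i\<le>n. \<xi> i w \<in> A) \<and> \<xi> (Suc n) w \<in> B}"
      by (intro nn_integral_indicator) measurable
    also have "\<dots> = ennreal (\<integral>w. indicator ?E w * measure (K (\<xi> n w)) B \<partial>M)"
      unfolding emeasure_eq_measure
      using mc[unfolded markov_chain_from_def, THEN conjunct2, THEN conjunct2, THEN conjunct2, rule_format, of n "\<lambda>_. A" B] A B by simp
    also have "\<dots> = (\<integral>\<^sup>+w. ennreal (indicator ?E w * measure (K (\<xi> n w)) B) \<partial>M)"
    proof (rule nn_integral_eq_integral[symmetric])
      have "(\<lambda>w. measure (K (\<xi> n w)) B) \<in> borel_measurable M"
        using measurable_compose[OF X measurable_compose[OF K measurable_measure_prob_algebra[OF B]]] .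
      then show "integrable M (\<lambda>w. indicator ?E w * measure (K (\<xi> n w)) B)"
        using prob_space.prob_le_1[OF prob_space_kernel]
        by (intro integrable_const_bound[where B=1]) (auto simp: indicator_def)
    qed auto
    also have "\<dots> = (\<integral>\<^sup>+w. emeasure (K (\<xi> n w)) B \<partial>D)"
    proof -
      have "(\<lambda>w. emeasure (K (\<xi> n w)) B) \<in> borel_measurable M"
        using measurable_compose[OF X measurable_compose[OF measurable_prob_algebraD[OF K] measurable_emeasure_subprob_algebra[OF B]]] .
      then show ?thesis unfolding D_def
        by (subst nn_integral_density)
          (auto intro!: nn_integral_cong simp: indicator_def finite_measure.emeasure_eq_measure[OF prob_space.finite_measure[OF prob_space_kernel]])
    qed
    also have "\<dots> = emeasure (D \<bind> (\<lambda>w. K (\<xi> n w))) B"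
      using not_empty D(2) by (intro emeasure_bind[OF _ KD B, symmetric]) simp
    finally show "emeasure (distr D borel (\<xi> (Suc n))) B = emeasure (D \<bind> (\<lambda>w. K (\<xi> n w))) B" .
  qed
  then have "(\<integral>\<^sup>+z. g z \<partial>distr D borel (\<xi> (Suc n))) = (\<integral>\<^sup>+w. (\<integral>\<^sup>+z. g z \<partial>K (\<xi> n w)) \<partial>D)"
    by (simp only: nn_integral_bind[OF g KD])
  moreover have "(\<integral>\<^sup>+z. g z \<partial>distr D borel (\<xi> (Suc n))) = (\<integral>\<^sup>+w. g (\<xi> (Suc n) w) \<partial>D)"
    by (rule nn_integral_distr[OF XD]) (use g in simp)
  ultimately have eq: "(\<integral>\<^sup>+w. g (\<xi> (Suc n) w) \<partial>D) = (\<integral>\<^sup>+w. (\<integral>\<^sup>+z. g z \<partial>K (\<xi> n w)) \<partial>D)" by simp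
  have "(\<lambda>w. \<integral>\<^sup>+z. g z \<partial>K (\<xi> n w)) \<in> borel_measurable M"
    using measurable_compose[OF X measurable_compose[OF measurable_prob_algebraD[OF K] nn_integral_measurable_subprob_algebra[OF g]]] .
  moreover have "(\<lambda>w. g (\<xi> (Suc n) w)) \<in> borel_measurable M" using measurable_compose[OF X g] .
  ultimately show ?thesis using eq unfolding D_def by (simp add: nn_integral_density)
qed

lemma emeasure_survival:
  assumes mc: "markov_chain_from M \<xi> K x"
  shows "emeasure M {w\<in>space M. \<forall>i\<le>n. a < \<bar>\<xi> i w\<bar>} = ennreal (survival K a n x)"
proof -
  have M: "prob_space M" and X[measurable]: "\<And>n. \<xi> n \<in> borel_measurable M" and X0: "AE w in M. \<xi> 0 w = x"
    using mc by (auto simp: markov_chain_from_def)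
  interpret prob_space M by fact
  let ?E = "\<lambda>n. {w\<in>space M. \<forall>i\<le>n. a < \<bar>\<xi> i w\<bar>}"
  \<comment> \<open>Conditioning at an arbitrary time m is the strengthening that the induction on k
    needs: each step lowers k and raises m, leaving m + k fixed.\<close>
  have *: "emeasure M (?E (m + k)) = (\<integral>\<^sup>+w. indicator (?E m) w * ennreal (survival K a k (\<xi> m w)) \<partial>M)" for m k
  proof (induction k arbitrary: m)
    case 0
    have "(\<integral>\<^sup>+w. indicator (?E m) w * ennreal (survival K a 0 (\<xi> m w)) \<partial>M) = (\<integral>\<^sup>+w. indicator (?E m) w \<partial>M)"
      by (intro nn_integral_cong) (auto simp: indicator_def)
    then show ?case by simp
  next
    case (Suc k)
    have A: "{x. a < \<bar>x\<bar>} \<in> sets (borel :: real measure)" by measurable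
    have "emeasure M (?E (m + Suc k)) = (\<integral>\<^sup>+w. indicator (?E (Suc m)) w * ennreal (survival K a k (\<xi> (Suc m) w)) \<partial>M)"
      using Suc[of "Suc m"] by simp
    also have "\<dots> = (\<integral>\<^sup>+w. indicator {w\<in>space M. \<forall>i\<le>m. \<xi> i w \<in> {x. a < \<bar>x\<bar>}} w * ennreal (survival K a k (\<xi> (Suc m) w)) \<partial>M)"
    proof (intro nn_integral_cong)
      fix w
      show "indicator (?E (Suc m)) w * ennreal (survival K a k (\<xi> (Suc m) w)) =
         indicator {w\<in>space M. \<forall>i\<le>m. \<xi> i w \<in> {x. a < \<bar>x\<bar>}} w * ennreal (survival K a k (\<xi> (Suc m) w))"
        by (cases "a < \<bar>\<xi> (Suc m) w\<bar>") (auto simp: indicator_def le_Suc_eq survival_zero not_less)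
    qed
    also have "\<dots> = (\<integral>\<^sup>+w. indicator {w\<in>space M. \<forall>i\<le>m. \<xi> i w \<in> {x. a < \<bar>x\<bar>}} w * (\<integral>\<^sup>+z. ennreal (survival K a k z) \<partial>K (\<xi> m w)) \<partial>M)"
      using measurable_survival by (intro markov_chain_step[OF mc A]) auto
    also have "\<dots> = (\<integral>\<^sup>+w. indicator (?E m) w * ennreal (survival K a (Suc k) (\<xi> m w)) \<partial>M)"
    proof (intro nn_integral_cong)
      fix w
      have "(\<integral>\<^sup>+z. ennreal (survival K a k z) \<partial>K (\<xi> m w)) = ennreal (\<integral>z. survival K a k z \<partial>K (\<xi> m w))"
        using survival_bounds by (intro nn_integral_eq_integral integrable_survival) auto
      then show "indicator {w\<in>space M. \<forall>i\<le>m. \<xi> i w \<in> {x. a < \<bar>x\<bar>}} w * (\<integral>\<^sup>+z. ennreal (survival K a k z) \<partial>K (\<xi> m w)) =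
         indicator (?E m) w * ennreal (survival K a (Suc k) (\<xi> m w))"
        by (auto simp: indicator_def)
    qed
    finally show ?case .
  qed
  have "emeasure M (?E n) = (\<integral>\<^sup>+w. indicator (?E 0) w * ennreal (survival K a n (\<xi> 0 w)) \<partial>M)"
    using *[of 0 n] by simp
  also have "\<dots> = (\<integral>\<^sup>+w. ennreal (survival K a n x) \<partial>M)"
  proof (intro nn_integral_cong_AE)
    show "AE w in M. indicator (?E 0) w * ennreal (survival K a n (\<xi> 0 w)) = ennreal (survival K a n x)"
      using X0 AE_space
    proof eventually_elim
      case (elim w)
      then show ?case by (cases "a < \<bar>x\<bar>") (auto simp: indicator_def survival_zero not_less)
    qed
  qed
  finally show ?thesis by (simp add: emeasure_space_1)
qed

end

section \<open>Moments of the hitting time from the decay of survival\<close>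

lemma hit_time_eq_enat:
  assumes "hit_time a \<xi> w = enat n"
  shows "\<bar>\<xi> n w\<bar> \<le> a" "\<And>i. i < n \<Longrightarrow> a < \<bar>\<xi> i w\<bar>"
proof -
  have ex: "\<exists>n. \<bar>\<xi> n w\<bar> \<le> a" and n: "n = (LEAST n. \<bar>\<xi> n w\<bar> \<le> a)"
    using assms by (auto simp: hit_time_def split: if_splits)
  show "\<bar>\<xi> n w\<bar> \<le> a" unfolding n using ex by (rule LeastI_ex)
  show "a < \<bar>\<xi> i w\<bar>" if "i < n" for i using not_less_Least[OF that[unfolded n]] by simp
qed

lemma hit_time_eq_infty:
  assumes "hit_time a \<xi> w = \<infinity>"
  shows "a < \<bar>\<xi> i w\<bar>"
  using assms by (auto simp: hit_time_def not_le split: if_splits)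

lemma hit_moment_finite:
  fixes p q :: real
  assumes K: "K \<in> borel \<rightarrow>\<^sub>M prob_algebra borel" and mc: "markov_chain_from M \<xi> K x"
    and pq: "0 < q" "q < p" and surv: "survival_O K a x p"
  shows "hit_moment M \<xi> a q < \<infinity>"
proof -
  obtain C where C: "C \<ge> 0" and bound: "\<And>n. n \<ge> 1 \<Longrightarrow> survival K a n x \<le> C * real n powr (- p)"
    using surv unfolding survival_O_def by blast
  have M: "prob_space M" and X[measurable]: "\<And>n. \<xi> n \<in> borel_measurable M"
    using mc by (auto simp: markov_chain_from_def)
  interpret prob_space M by fact
  define E where "E n = {w\<in>space M. \<forall>i\<le>n. a < \<bar>\<xi> i w\<bar>}" for n
  have [measurable]: "E n \<in> sets M" for n unfolding E_def by measurable
  define r where "r k = (2 ^ Suc k :: real) powr q" for k :: nat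
  have r1: "r k \<ge> 1" for k unfolding r_def using pq one_le_power[of "2::real" "Suc k"] by (intro ge_one_powr_ge_zero) auto
  \<comment> \<open>Dyadic blocks: if 2^m < \<tau> \<le> 2^(m+1), the term k = m alone majorises
    \<tau>^q, and the leading 1 covers \<tau> \<le> 1. If \<tau> is infinite, every term is at least
    1 and the series diverges, so a finite expectation of the right-hand side also disposes of that
    event.\<close>
  have "(case hit_time a \<xi> w of enat n \<Rightarrow> ennreal (real n powr q) | \<infinity> \<Rightarrow> \<infinity>) \<le> 1 + (\<Sum>k. ennreal (r k) * indicator (E (2 ^ k)) w)"
    if w: "w \<in> space M" for w
  proof (cases "hit_time a \<xi> w")
    case (enat n)
    show ?thesis
    proof (cases "n \<le> 1")
      case True
      then have "real n powr q \<le> 1" using pq by (intro powr_le1) auto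
      then have "ennreal (real n powr q) \<le> 1" by (simp add: ennreal_le_1)
      then show ?thesis using enat by (simp add: add_increasing2)
    next
      case False
      \<comment> \<open>Locating n - 1 instead of n makes 2^m strictly less than the hitting time,
        so that the path is still outside at time 2^m.\<close>
      then obtain m where m: "2 ^ m \<le> n - 1" "n - 1 < (2::nat) ^ (m + 1)" using ex_power_ivl1[of 2 "n - 1"] False by fastforce
      have "w \<in> E (2 ^ m)" unfolding E_def using w hit_time_eq_enat(2)[OF enat] m False by auto
      moreover have "real n powr q \<le> r m"
      proof -
        have "n \<le> 2 ^ Suc m" using m by simp
        then have "real n \<le> real (2 ^ Suc m)" by (simp only: of_nat_le_iff)
        then show ?thesis unfolding r_def using pq by (intro powr_mono2) auto
      qed
      ultimately have "ennreal (real n powr q) \<le> ennreal (r m) * indicator (E (2 ^ m)) w" by (simp add: ennreal_leI)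
      also have "\<dots> \<le> (\<Sum>k. ennreal (r k) * indicator (E (2 ^ k)) w)"
        using sum_le_suminf[OF summableI, of "{m}" "\<lambda>k. ennreal (r k) * indicator (E (2 ^ k)) w"]
        by (simp only: finite.intros zero_le simp_thms sum.insert sum.empty empty_iff add_0_right)
      finally show ?thesis using enat by (simp add: add_increasing)
    qed
  next
    case infinity
    have ind: "indicator (E k) w = (1::ennreal)" for k using w hit_time_eq_infty[OF infinity] by (simp add: E_def)
    have "of_nat N \<le> (\<Sum>k. ennreal (r k) * indicator (E (2 ^ k)) w)" for N
    proof -
      have "of_nat N = (\<Sum>k<N. 1 :: ennreal)" by simp
      also have "\<dots> \<le> (\<Sum>k<N. ennreal (r k) * indicator (E (2 ^ k)) w)" using r1 by (intro sum_mono) (simp add: ind)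
      also have "\<dots> \<le> (\<Sum>k. ennreal (r k) * indicator (E (2 ^ k)) w)" by (intro sum_le_suminf summableI) auto
      finally show ?thesis .
    qed
    then have "(\<Sum>k. ennreal (r k) * indicator (E (2 ^ k)) w) = top"
      using ennreal_Ex_less_of_nat[of "\<Sum>k. ennreal (r k) * indicator (E (2 ^ k)) w"] by (meson leD less_top)
    then show ?thesis by simp
  qed
  then have "hit_moment M \<xi> a q \<le> (\<integral>\<^sup>+w. 1 + (\<Sum>k. ennreal (r k) * indicator (E (2 ^ k)) w) \<partial>M)"
    unfolding hit_moment_def by (intro nn_integral_mono)
  also have "\<dots> = 1 + (\<Sum>k. ennreal (r k) * emeasure M (E (2 ^ k)))"
    by (subst nn_integral_add) (auto simp: nn_integral_suminf nn_integral_cmult emeasure_space_1)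
  also have "\<dots> \<le> 1 + (\<Sum>k. ennreal (C * 2 powr q * (2 powr (q - p)) ^ k))"
  proof (intro add_left_mono suminf_le summableI)
    fix k
    have "r k * survival K a (2 ^ k) x \<le> r k * (C * real (2 ^ k) powr (- p))"
      using r1[of k] by (intro mult_left_mono bound) auto
    also have "\<dots> = C * 2 powr q * (2 powr (q - p)) ^ k"
    proof -
      have "r k = 2 powr q * (2 powr q) ^ k" by (simp add: r_def powr_mult powr_power powr_realpow[symmetric] powr_powr mult.commute powr_add[symmetric] ring_distribs)
      moreover have "real (2 ^ k) powr (- p) = (2 powr (- p)) ^ k" by (simp add: powr_power powr_realpow[symmetric] powr_powr mult.commute)
      moreover have "(2 powr (q - p)) ^ k = (2 powr q) ^ k * (2 powr (- p)) ^ k"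
        by (simp add: power_mult_distrib[symmetric] powr_add[symmetric])
      ultimately show ?thesis by simp
    qed
    finally show "ennreal (r k) * emeasure M (E (2 ^ k)) \<le> ennreal (C * 2 powr q * (2 powr (q - p)) ^ k)"
      unfolding E_def emeasure_survival[OF K mc] using r1[of k] survival_bounds(1)[OF K]
      by (simp add: ennreal_mult[symmetric] ennreal_leI)
  qed
  also have "\<dots> < \<infinity>"
  proof -
    have "2 powr (q - p) < 2 powr 0" using pq by (intro powr_less_mono) auto
    then have "summable (\<lambda>k. C * 2 powr q * (2 powr (q - p)) ^ k)"
      by (intro summable_mult summable_geometric) auto
    then have "(\<Sum>k. ennreal (C * 2 powr q * (2 powr (q - p)) ^ k)) \<noteq> top"
      using C by (intro ennreal_suminf_neq_top) auto
    then show ?thesis by (simp add: less_top)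
  qed
  finally show ?thesis .
qed

text \<open>Every dyadic scale from some point on contributes at least the same constant
  \<open>D * c\<close>. This is still true for q = p, which gives the boundary exponent in case
  (iii).\<close>

lemma hit_moment_infinite:
  fixes p q :: real
  assumes K: "K \<in> borel \<rightarrow>\<^sub>M prob_algebra borel" and mc: "markov_chain_from M \<xi> K x"
    and pq: "0 < q" "p \<le> q" and surv: "survival_Omega K a x p"
  shows "hit_moment M \<xi> a q = \<infinity>"
proof -
  obtain c n0 where c: "c > 0" and bound: "\<And>n. n \<ge> n0 \<Longrightarrow> c * real n powr (- p) \<le> survival K a n x"
    using surv unfolding survival_Omega_def by blast
  have M: "prob_space M" and X[measurable]: "\<And>n. \<xi> n \<in> borel_measurable M"
    using mc by (auto simp: markov_chain_from_def)
  interpret prob_space M by fact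
  define E where "E n = {w\<in>space M. \<forall>i\<le>n. a < \<bar>\<xi> i w\<bar>}" for n
  have [measurable]: "E n \<in> sets M" for n unfolding E_def by measurable
  define r where "r = 2 powr q"
  have r1: "r > 1" unfolding r_def using pq by (intro gr_one_powr) auto
  have rk: "r ^ k = real (2 ^ k) powr q" for k by (simp add: r_def powr_power powr_realpow[symmetric] powr_powr mult.commute)
  \<comment> \<open>With this factor the geometric sum of D r^k over k \<le> m is at most r^m =
    (2^m)^q, hence at most \<tau>^q when 2^m < \<tau>.\<close>
  define D where "D = (r - 1) / r"
  have D: "D > 0" using r1 by (simp add: D_def)
  have pw: "(\<Sum>k<j. ennreal (D * r ^ k) * indicator (E (2 ^ k)) w) \<le> (case hit_time a \<xi> w of enat n \<Rightarrow> ennreal (real n powr q) | \<infinity> \<Rightarrow> \<infinity>)"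
    if w: "w \<in> space M" for j w
  proof (cases "hit_time a \<xi> w")
    case (enat n)
    have out: "w \<notin> E (2 ^ k)" if "n \<le> 2 ^ k" for k
      using hit_time_eq_enat(1)[OF enat] that by (auto simp: E_def not_less)
    show ?thesis
    proof (cases "n \<le> 1")
      case True
      then have "n \<le> 2 ^ k" for k :: nat using one_le_power[of "2::nat" k] by linarith
      then have "(\<Sum>k<j. ennreal (D * r ^ k) * indicator (E (2 ^ k)) w) = 0" using out by (intro sum.neutral) auto
      then show ?thesis by simp
    next
      case False
      then obtain m where m: "2 ^ m \<le> n - 1" "n - 1 < (2::nat) ^ (m + 1)" using ex_power_ivl1[of 2 "n - 1"] False by fastforce
      have "(\<Sum>k<j. ennreal (D * r ^ k) * indicator (E (2 ^ k)) w) \<le> (\<Sum>k<j. if k < Suc m then ennreal (D * r ^ k) else 0)"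
      proof (intro sum_mono)
        fix k
        show "ennreal (D * r ^ k) * indicator (E (2 ^ k)) w \<le> (if k < Suc m then ennreal (D * r ^ k) else 0)"
        proof (cases "k < Suc m")
          case False
          then have "(2::nat) ^ Suc m \<le> 2 ^ k" by (intro power_increasing) auto
          then have "n \<le> 2 ^ k" using m by simp
          then show ?thesis using out by simp
        qed (auto simp: indicator_def)
      qed
      also have "\<dots> = (\<Sum>k\<in>{..<j} \<inter> {k. k < Suc m}. ennreal (D * r ^ k))" by (simp add: sum.inter_restrict)
      also have "\<dots> \<le> (\<Sum>k<Suc m. ennreal (D * r ^ k))" by (intro sum_mono2) auto
      also have "\<dots> = ennreal (\<Sum>k<Suc m. D * r ^ k)" using D r1 by (intro sum_ennreal) auto
      also have "(\<Sum>k<Suc m. D * r ^ k) = D * ((r ^ Suc m - 1) / (r - 1))"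
      proof -
        have "r \<noteq> 1" using r1 by simp
        then show ?thesis by (simp only: sum_distrib_left[symmetric] geometric_sum[OF \<open>r \<noteq> 1\<close>])
      qed
      also have "\<dots> \<le> real n powr q"
      proof -
        have "D * ((r ^ Suc m - 1) / (r - 1)) = (r ^ Suc m - 1) / r" using r1 by (simp add: D_def)
        also have "\<dots> \<le> r ^ m" using r1 by (simp add: field_simps)
        also have "\<dots> \<le> real n powr q" unfolding rk
        proof (intro powr_mono2)
          have "2 ^ m \<le> n" using m by simp
          then show "real (2 ^ m) \<le> real n" by (simp only: of_nat_le_iff)
        qed (use pq in auto)
        finally show ?thesis .
      qed
      finally show ?thesis using enat by (simp add: ennreal_leI)
    qed
  qed simp
  have low: "of_nat N * ennreal (D * c) \<le> hit_moment M \<xi> a q" for N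
  proof -
    have "of_nat N * ennreal (D * c) = (\<Sum>k\<in>{n0..<n0 + N}. ennreal (D * c))" by simp
    also have "\<dots> \<le> (\<Sum>k\<in>{n0..<n0 + N}. ennreal (D * r ^ k) * emeasure M (E (2 ^ k)))"
    proof (intro sum_mono)
      fix k assume k: "k \<in> {n0..<n0 + N}"
      then have "n0 \<le> 2 ^ k" using less_exp[of k] by (auto intro: order_trans less_imp_le)
      then have "c * real (2 ^ k) powr (- p) \<le> survival K a (2 ^ k) x" by (rule bound)
      moreover have "c \<le> r ^ k * (c * real (2 ^ k) powr (- p))"
      proof -
        have "r ^ k * (c * real (2 ^ k) powr (- p)) = c * real (2 ^ k) powr (q - p)"
          unfolding rk by (simp add: powr_add[symmetric] mult.left_commute)
        moreover have "1 \<le> real (2 ^ k) powr (q - p)" using pq by (intro ge_one_powr_ge_zero) auto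
        ultimately show ?thesis using c by simp
      qed
      ultimately have "c \<le> r ^ k * survival K a (2 ^ k) x" using r1
        by (smt (verit) mult_left_mono zero_le_power)
      then have "D * c \<le> D * r ^ k * survival K a (2 ^ k) x" using D by simp
      then show "ennreal (D * c) \<le> ennreal (D * r ^ k) * emeasure M (E (2 ^ k))"
        unfolding E_def emeasure_survival[OF K mc] using D r1 survival_bounds(1)[OF K]
        by (simp add: ennreal_mult[symmetric] ennreal_leI)
    qed
    also have "\<dots> \<le> (\<Sum>k<n0 + N. ennreal (D * r ^ k) * emeasure M (E (2 ^ k)))" by (intro sum_mono2) auto
    also have "\<dots> = (\<integral>\<^sup>+w. (\<Sum>k<n0 + N. ennreal (D * r ^ k) * indicator (E (2 ^ k)) w) \<partial>M)"
      by (subst nn_integral_sum) (auto simp: nn_integral_cmult)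
    also have "\<dots> \<le> hit_moment M \<xi> a q" unfolding hit_moment_def by (intro nn_integral_mono pw)
    finally show ?thesis .
  qed
  show ?thesis
  proof (rule ccontr)
    assume "hit_moment M \<xi> a q \<noteq> \<infinity>"
    then obtain h where h: "hit_moment M \<xi> a q = ennreal h" "h \<ge> 0" by (cases "hit_moment M \<xi> a q") auto
    have dc: "D * c > 0" using D c by simp
    obtain N where N: "h < real N * (D * c)" using reals_Archimedean3[OF dc] by blast
    have "ennreal (real N * (D * c)) \<le> ennreal h"
      using low[of N] dc unfolding h(1) by (simp add: ennreal_mult ennreal_of_nat_eq_real_of_nat)
    then show False using N h(2) by (simp add: ennreal_le_iff)
  qed
qed

section \<open>Super- and subsolutions of the survival recursion\<close>

lemma Bernoulli_powr:
  fixes p x :: real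
  assumes "p \<ge> 1" "x > - 1" "x \<le> 0"
  shows "1 + p * x \<le> (1 + x) powr p"
proof (cases "x < 0")
  case True
  have "\<exists>z>x. z < 0 \<and> (1 + 0) powr p - (1 + x) powr p = (0 - x) * (p * (1 + z) powr (p - 1))"
  proof (rule MVT2)
    fix y assume "x \<le> y" "y \<le> 0"
    then show "((\<lambda>v. (1 + v) powr p) has_real_derivative p * (1 + y) powr (p - 1)) (at y)"
      using assms by (auto intro!: derivative_eq_intros)
  qed fact
  then obtain z where z: "x < z" "z < 0" "1 - (1 + x) powr p = (- x) * (p * (1 + z) powr (p - 1))" by auto
  have "(1 + z) powr (p - 1) \<le> 1" using z assms by (intro powr_le1) auto
  then have "(- x) * (p * (1 + z) powr (p - 1)) \<le> (- x) * (p * 1)" using assms True by (intro mult_left_mono) auto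
  then have "1 - (1 + x) powr p \<le> (- x) * (p * 1)" unfolding z(3) .
  then show ?thesis by (simp add: mult.commute)
qed (use assms in simp)

text \<open>The map \<open>F \<mapsto> (F\<^bsup>1/p\<^esup> + t)\<^bsup>p\<^esup>\<close> is concave; this is its tangent inequality at \<open>F = g\<^bsup>p\<^esup>\<close>.\<close>

lemma shifted_powr_tangent:
  fixes p G g t :: real
  assumes p: "p \<ge> 1" and "G \<ge> 0" "g > 0" "t > 0"
  shows "(G + t) powr p \<le> (g + t) powr p + ((g + t) / g) powr (p - 1) * (G powr p - g powr p)"
proof -
  define S where "S = g + t"
  define l where "l = g / S"
  have S: "S > 0" "t < S" using assms by (auto simp: S_def)
  have l: "0 < l" "l < 1" using assms by (auto simp: l_def S_def)
  have g: "g = l * S" using S by (simp add: l_def)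
  have t: "t = (1 - l) * S" using S by (simp add: l_def S_def field_simps)
  have lS: "(S / g) powr (p - 1) = l powr (1 - p)"
  proof -
    have "S / g = inverse l" using S assms by (simp add: l_def)
    then have "(S / g) powr (p - 1) = inverse l powr (p - 1)" by simp
    also have "\<dots> = l powr (- (p - 1))" using l powr_minus[of l "p - 1"] by (simp add: inverse_powr)
    finally show ?thesis by simp
  qed
  have gl: "l powr (1 - p) * g powr p = l * S powr p"
  proof -
    have "l powr (1 - p) * g powr p = l powr (1 - p) * (l powr p * S powr p)"
      unfolding g using l S by (simp add: powr_mult)
    also have "\<dots> = (l powr (1 - p) * l powr p) * S powr p" by simp
    also have "l powr (1 - p) * l powr p = l" using l by (simp add: powr_add[symmetric])
    finally show ?thesis .
  qed
  have "(G + t) powr p \<le> l powr (1 - p) * G powr p + (1 - l) * S powr p"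
  proof (cases "G = 0")
    case True
    have "t powr p = (1 - l) powr p * S powr p" unfolding t using l S by (simp add: powr_mult)
    also have "\<dots> \<le> (1 - l) powr 1 * S powr p" using l p by (intro mult_right_mono powr_mono') auto
    finally show ?thesis using True l p by simp
  next
    case False
    \<comment> \<open>G + t is the average of S and G/l with weights 1 - l and l, so convexity of
      the p-th power applies. At G = g both points are S, which is why the bound is tangent
      there.\<close>
    have "((1 - l) * S + l * (G / l)) powr p \<le> (1 - l) * S powr p + l * (G / l) powr p"
      using convex_onD[OF powr_convex[OF p], of l S "G / l"] l S False assms by simp
    also have "l * (G / l) powr p = l powr (1 - p) * G powr p"
      using l assms by (simp add: powr_divide powr_diff)
    also have "(1 - l) * S + l * (G / l) = G + t" unfolding t using l by simp
    finally show ?thesis by linarith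
  qed
  then show ?thesis unfolding S_def[symmetric] lS right_diff_distrib gl by (simp add: algebra_simps)
qed

lemma root_unbounded:
  fixes s m :: real
  assumes "s > 0"
  shows "\<exists>n0. \<forall>n\<ge>n0. m \<le> real n powr (1 / s)"
proof -
  obtain n0 :: nat where n0: "\<bar>m\<bar> powr s \<le> real n0" using real_arch_simple by blast
  have "m \<le> real n powr (1 / s)" if "n \<ge> n0" for n
  proof -
    have "m \<le> (\<bar>m\<bar> powr s) powr (1 / s)" using assms by (simp add: powr_powr)
    also have "\<dots> \<le> real n powr (1 / s)" using n0 that assms by (intro powr_mono2) auto
    finally show ?thesis .
  qed
  then show ?thesis by blast
qed

section \<open>Survival bounds from comparison functions on the state space\<close>

locale markov_kernel =
  fixes X :: "real set" and K :: "real \<Rightarrow> real measure"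
  assumes K: "K \<in> borel \<rightarrow>\<^sub>M prob_algebra borel" and X: "X \<in> sets borel"
    and KX: "\<And>x. x \<in> X \<Longrightarrow> emeasure (K x) X = 1"
begin

lemma AE_kernel: "x \<in> X \<Longrightarrow> AE z in K x. z \<in> X"
proof -
  assume x: "x \<in> X"
  interpret prob_space "K x" by (rule prob_space_kernel[OF K])
  have "prob X = 1" using KX[OF x] by (simp add: emeasure_eq_measure)
  then show "AE z in K x. z \<in> X" using X by (subst (asm) prob_eq_1) (auto simp: sets_kernel[OF K])
qed

lemma integral_survival_le:
  assumes "x \<in> X" "\<And>z. z \<in> X \<Longrightarrow> survival K a n z \<le> W z" "integrable (K x) W"
  shows "(\<integral>z. survival K a n z \<partial>K x) \<le> (\<integral>z. W z \<partial>K x)"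
  using AE_kernel[OF assms(1)] assms(2,3)
  by (intro integral_mono_AE integrable_survival[OF K]) (auto elim: eventually_mono)

lemma integral_survival_ge:
  assumes "x \<in> X" "\<And>z. z \<in> X \<Longrightarrow> W z \<le> survival K a n z" "integrable (K x) W"
  shows "(\<integral>z. W z \<partial>K x) \<le> (\<integral>z. survival K a n z \<partial>K x)"
  using AE_kernel[OF assms(1)] assms(2,3)
  by (intro integral_mono_AE integrable_survival[OF K]) (auto elim: eventually_mono)

lemma survival_Suc: "a < \<bar>x\<bar> \<Longrightarrow> survival K a (Suc n) x = (\<integral>z. survival K a n z \<partial>K x)"
  by simp

text \<open>A Foster-Lyapunov condition for |x|^\<nu>. The parameter s is the exponent of the time
  scale: \<alpha> in the critical case and \<gamma> + 1 in the subcritical one. Integrability is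
  demanded because a Bochner integral that does not exist is 0 and could satisfy the inequality
  spuriously.\<close>

definition power_drift :: "real \<Rightarrow> real \<Rightarrow> real \<Rightarrow> real \<Rightarrow> bool" where
  "power_drift \<nu> s \<epsilon> x \<longleftrightarrow> integrable (K x) (\<lambda>z. \<bar>z\<bar> powr \<nu>) \<and>
    (\<integral>z. \<bar>z\<bar> powr \<nu> \<partial>K x) \<le> \<bar>x\<bar> powr \<nu> - \<epsilon> * \<bar>x\<bar> powr (\<nu> - s)"

text \<open>For \<nu> \<le> s the drift below y = n^(1/s) is at least its value at y, so C
  (|z|/y)^\<nu> can pay for a clock 1 - k/n that loses 1/n at each step. Above y the comparison
  function is at least 1 anyway. At k = n the clock has run out and only C (|x|/y)^\<nu> is
  left.\<close>

lemma survival_upper_sublinear: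
  fixes \<nu> s \<epsilon> a :: real
  assumes \<nu>: "0 < \<nu>" "\<nu> \<le> s" and \<epsilon>: "\<epsilon> > 0" and a: "a \<ge> 0" and x: "x \<in> X"
    and lyapunov: "\<And>x. x \<in> X \<Longrightarrow> a < \<bar>x\<bar> \<Longrightarrow> power_drift \<nu> s \<epsilon> x"
  shows "survival_O K a x (\<nu> / s)"
proof -
  \<comment> \<open>C \<ge> 1 settles |z| \<ge> y, and C \<epsilon> \<ge> 1 pays the 1/n per step
    below y.\<close>
  define C where "C = 1 / min \<epsilon> 1"
  have C: "C \<ge> 1" "C * \<epsilon> \<ge> 1" using \<epsilon> by (auto simp: C_def min_def field_simps)
  have "survival K a n x \<le> (C * \<bar>x\<bar> powr \<nu>) * real n powr (- (\<nu> / s))" if n: "n \<ge> 1" for n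
  proof -
    define y where "y = real n powr (1 / s)"
    have y: "y > 0" using n by (simp add: y_def)
    have ys: "y powr (- s) = 1 / n" using \<nu> n by (simp add: y_def powr_powr powr_minus_divide)
    have "survival K a k z \<le> C * (\<bar>z\<bar> / y) powr \<nu> + 1 - k / n" if "k \<le> n" "z \<in> X" for k z
      using that
    proof (induction k arbitrary: z)
      case 0
      have "0 \<le> C * (\<bar>z\<bar> / y) powr \<nu>" using C by simp
      moreover have "survival K a 0 z \<le> 1" by (rule survival_bounds(2)[OF K])
      ultimately have "survival K a 0 z \<le> C * (\<bar>z\<bar> / y) powr \<nu> + 1" by linarith
      then show ?case by (simp del: survival.simps)
    next
      case (Suc k)
      have kn: "real (Suc k) / n \<le> 1" using Suc n by simp
      consider "\<bar>z\<bar> \<le> a" | "a < \<bar>z\<bar>" "y \<le> \<bar>z\<bar>" | "a < \<bar>z\<bar>" "\<bar>z\<bar> < y" by linarith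
      then show ?case
      proof cases
        case 1
        have "0 \<le> C * (\<bar>z\<bar> / y) powr \<nu>" using C by simp
        then show ?thesis using kn unfolding survival_zero[OF 1] by linarith
      next
        case 2
        have "1 \<le> (\<bar>z\<bar> / y) powr \<nu>" using 2 y \<nu> by (intro ge_one_powr_ge_zero) auto
        then have "1 * 1 \<le> C * (\<bar>z\<bar> / y) powr \<nu>" using C by (intro mult_mono) auto
        then show ?thesis using survival_bounds(2)[OF K, of a "Suc k" z] kn by linarith
      next
        case 3
        interpret prob_space "K z" by (rule prob_space_kernel[OF K])
        have z0: "\<bar>z\<bar> > 0" using 3 a by linarith
        have e: "C * (\<bar>w\<bar> / y) powr \<nu> = C / y powr \<nu> * \<bar>w\<bar> powr \<nu>" for w using y by (simp add: powr_divide)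
        have i: "integrable (K z) (\<lambda>w. \<bar>w\<bar> powr \<nu>)"
          and drift: "(\<integral>w. \<bar>w\<bar> powr \<nu> \<partial>K z) \<le> \<bar>z\<bar> powr \<nu> - \<epsilon> * \<bar>z\<bar> powr (\<nu> - s)"
          using lyapunov[OF Suc(3) 3(1)] by (auto simp: power_drift_def)
        have "survival K a (Suc k) z \<le> (\<integral>w. C * (\<bar>w\<bar> / y) powr \<nu> + 1 - k / n \<partial>K z)"
          unfolding survival_Suc[OF 3(1)]
          using Suc i unfolding e by (intro integral_survival_le) auto
        also have "\<dots> = C / y powr \<nu> * (\<integral>w. \<bar>w\<bar> powr \<nu> \<partial>K z) + 1 - k / n"
          using i unfolding e by (simp add: prob_space)
        also have "\<dots> \<le> C / y powr \<nu> * (\<bar>z\<bar> powr \<nu> - \<epsilon> * \<bar>z\<bar> powr (\<nu> - s)) + 1 - k / n"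
          using drift C by (intro diff_mono add_mono mult_left_mono) auto
        also have "\<dots> = C * (\<bar>z\<bar> / y) powr \<nu> - C * \<epsilon> * (\<bar>z\<bar> powr (\<nu> - s) / y powr \<nu>) + 1 - k / n"
          unfolding e by (simp add: algebra_simps)
        also have "\<dots> \<le> C * (\<bar>z\<bar> / y) powr \<nu> - 1 * (1 / n) + 1 - k / n"
        proof -
          have "1 / n = y powr (\<nu> - s) / y powr \<nu>" unfolding ys[symmetric] using y by (simp add: powr_diff powr_minus field_simps)
          also have "\<dots> \<le> \<bar>z\<bar> powr (\<nu> - s) / y powr \<nu>" using 3 z0 \<nu> by (intro divide_right_mono powr_mono2') auto
          finally have "1 * (1 / n) \<le> C * \<epsilon> * (\<bar>z\<bar> powr (\<nu> - s) / y powr \<nu>)" using C by (intro mult_mono) auto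
          then show ?thesis by linarith
        qed
        also have "\<dots> = C * (\<bar>z\<bar> / y) powr \<nu> + 1 - Suc k / n" using n by (simp add: field_simps)
        finally show ?thesis .
      qed
    qed
    from this[OF order_refl x] have "survival K a n x \<le> C * (\<bar>x\<bar> / y) powr \<nu>" using n by simp
    also have "\<dots> = (C * \<bar>x\<bar> powr \<nu>) * real n powr (- (\<nu> / s))"
      using y n by (simp add: powr_divide y_def powr_powr powr_minus_divide)
    finally show ?thesis .
  qed
  then show ?thesis unfolding survival_O_def using C by (intro exI[of _ "C * \<bar>x\<bar> powr \<nu>"]) auto
qed

text \<open>For \<nu> > s the drift is weak near the origin and cannot pay for an additive clock.
  The remaining time is put inside the power instead, as (|z|^s + \<kappa> (n - k))^p with p =
  \<nu>/s; the slope of its tangent then supplies the factor S^(p-1) that the drift lacks.\<close>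

lemma survival_upper_superlinear:
  fixes \<nu> s \<epsilon> a :: real
  assumes \<nu>: "0 < s" "s \<le> \<nu>" and \<epsilon>: "\<epsilon> > 0" and a: "a \<ge> 0" and x: "x \<in> X"
    and lyapunov: "\<And>x. x \<in> X \<Longrightarrow> a < \<bar>x\<bar> \<Longrightarrow> power_drift \<nu> s \<epsilon> x"
  shows "survival_O K a x (\<nu> / s)"
proof -
  define p where "p = \<nu> / s"
  have p: "p \<ge> 1" using \<nu> by (simp add: p_def)
  \<comment> \<open>With p \<kappa> = \<epsilon>, Bernoulli's inequality gives S^p - \<epsilon>
    S^(p-1) \<le> (S - \<kappa>)^p, which is one tick of the remaining time.\<close>
  define \<kappa> where "\<kappa> = \<epsilon> / p"
  have \<kappa>: "\<kappa> > 0" "p * \<kappa> = \<epsilon>" using p \<epsilon> by (auto simp: \<kappa>_def)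
  have "survival K a n x \<le> (\<bar>x\<bar> powr \<nu> / \<kappa> powr p) * real n powr (- p)" if n: "n \<ge> 1" for n
  proof -
    have kn: "\<kappa> * n > 0" using n \<kappa> by simp
    have "survival K a k z \<le> (\<bar>z\<bar> powr s + \<kappa> * (n - k)) powr p / (\<kappa> * n) powr p" if "k \<le> n" "z \<in> X" for k z
      using that
    proof (induction k arbitrary: z)
      case 0
      have "(\<kappa> * n) powr p \<le> (\<bar>z\<bar> powr s + \<kappa> * n) powr p" using kn p by (intro powr_mono2) auto
      then have "1 \<le> (\<bar>z\<bar> powr s + \<kappa> * n) powr p / (\<kappa> * n) powr p" using kn n by (subst le_divide_eq_1_pos) auto
      moreover have "survival K a 0 z \<le> 1" by (rule survival_bounds(2)[OF K])
      ultimately have "survival K a 0 z \<le> (\<bar>z\<bar> powr s + \<kappa> * n) powr p / (\<kappa> * n) powr p" by linarith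
      then show ?case by (simp del: survival.simps)
    next
      case (Suc k)
      show ?case
      proof (cases "a < \<bar>z\<bar>")
        case False
        then have "survival K a (Suc k) z = 0" by (intro survival_zero) auto
        then show ?thesis by (simp only: divide_nonneg_nonneg powr_ge_zero)
      next
        case True
        interpret prob_space "K z" by (rule prob_space_kernel[OF K])
        define t where "t = \<kappa> * real (n - k)"
        define g where "g = \<bar>z\<bar> powr s"
        define S where "S = g + t"
        have "real (n - k) \<ge> 1" using Suc by simp
        then have t: "t \<ge> \<kappa>" "t > 0" using \<kappa> by (auto simp: t_def)
        have z0: "\<bar>z\<bar> > 0" using True a by linarith
        have g: "g > 0" "g powr p = \<bar>z\<bar> powr \<nu>" using z0 \<nu> by (auto simp: g_def powr_powr p_def)
        have g1: "g powr (p - 1) = \<bar>z\<bar> powr (\<nu> - s)" using \<nu> by (simp add: g_def powr_powr p_def right_diff_distrib)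
        have S: "S > \<kappa>" "S > 0" using t g \<kappa> by (auto simp: S_def)
        have i: "integrable (K z) (\<lambda>w. \<bar>w\<bar> powr \<nu>)"
          and drift: "(\<integral>w. \<bar>w\<bar> powr \<nu> \<partial>K z) \<le> \<bar>z\<bar> powr \<nu> - \<epsilon> * \<bar>z\<bar> powr (\<nu> - s)"
          using lyapunov[OF Suc(3) True] by (auto simp: power_drift_def)
        \<comment> \<open>The tangent at the current state z of the concave map from |w|^\<nu> to
          (|w|^s + t)^p. It is affine in |w|^\<nu>, whose expectation the drift condition
          controls.\<close>
        define W where "W w = S powr p + (S / g) powr (p - 1) * (\<bar>w\<bar> powr \<nu> - \<bar>z\<bar> powr \<nu>)" for w
        have iW: "integrable (K z) (\<lambda>w. W w / (\<kappa> * n) powr p)" unfolding W_def using i by simp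
        have "survival K a (Suc k) z \<le> (\<integral>w. W w / (\<kappa> * n) powr p \<partial>K z)"
          unfolding survival_Suc[OF True]
        proof (rule integral_survival_le[OF Suc(3) _ iW])
          fix w assume w: "w \<in> X"
          have "survival K a k w \<le> (\<bar>w\<bar> powr s + \<kappa> * (n - k)) powr p / (\<kappa> * n) powr p" using Suc w by auto
          also have "\<dots> \<le> W w / (\<kappa> * n) powr p"
          proof (rule divide_right_mono)
            have "(\<bar>w\<bar> powr s) powr p = \<bar>w\<bar> powr \<nu>" using \<nu> by (simp add: powr_powr p_def)
            then show "(\<bar>w\<bar> powr s + \<kappa> * (n - k)) powr p \<le> W w"
              using shifted_powr_tangent[OF p _ g(1) t(2), of "\<bar>w\<bar> powr s"]
              unfolding W_def S_def g(2) t_def by simp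
          qed simp
          finally show "survival K a k w \<le> W w / (\<kappa> * n) powr p" .
        qed
        also have "\<dots> \<le> (\<bar>z\<bar> powr s + \<kappa> * (n - Suc k)) powr p / (\<kappa> * n) powr p"
        proof -
          have "(\<integral>w. W w \<partial>K z) = S powr p + (S / g) powr (p - 1) * ((\<integral>w. \<bar>w\<bar> powr \<nu> \<partial>K z) - \<bar>z\<bar> powr \<nu>)"
            unfolding W_def using i by (simp add: prob_space)
          also have "\<dots> \<le> S powr p + (S / g) powr (p - 1) * (- (\<epsilon> * \<bar>z\<bar> powr (\<nu> - s)))"
            using drift by (intro add_left_mono mult_left_mono) auto
          also have "\<dots> = S powr p - \<epsilon> * S powr (p - 1)"
            unfolding g1[symmetric] using S g by (simp add: powr_divide)
          also have "\<dots> = S powr p * (1 + p * (- \<kappa> / S))"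
            using S \<kappa>(2) by (simp add: powr_diff field_simps)
          also have "\<dots> \<le> S powr p * (1 + - \<kappa> / S) powr p"
            using S \<kappa> by (intro mult_left_mono Bernoulli_powr p) (auto simp: field_simps)
          also have "\<dots> = (S - \<kappa>) powr p"
          proof -
            have "S * (1 + - \<kappa> / S) = S - \<kappa>" using S by (simp add: field_simps)
            moreover have "0 \<le> 1 + - \<kappa> / S" using S by (simp add: field_simps)
            ultimately show ?thesis using S powr_mult[of S "1 + - \<kappa> / S" p] by simp
          qed
          also have "S - \<kappa> = \<bar>z\<bar> powr s + \<kappa> * (n - Suc k)"
            using Suc(2) by (simp add: S_def g_def t_def of_nat_diff algebra_simps)
          finally show ?thesis by (simp add: divide_right_mono)
        qed
        finally show ?thesis .
      qed
    qed
    from this[OF order_refl x] have "survival K a n x \<le> (\<bar>x\<bar> powr s) powr p / (\<kappa> * n) powr p" by simp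
    also have "\<dots> = (\<bar>x\<bar> powr \<nu> / \<kappa> powr p) * real n powr (- p)"
      using \<kappa> n \<nu> by (simp add: powr_mult powr_minus_divide powr_powr p_def)
    finally show ?thesis .
  qed
  then show ?thesis unfolding p_def[symmetric] survival_O_def
    by (intro exI[of _ "\<bar>x\<bar> powr \<nu> / \<kappa> powr p"]) auto
qed

lemma survival_upper:
  fixes \<nu> s \<epsilon> a :: real
  assumes "0 < \<nu>" "0 < s" "\<epsilon> > 0" "a \<ge> 0" "x \<in> X"
    and "\<And>x. x \<in> X \<Longrightarrow> a < \<bar>x\<bar> \<Longrightarrow> power_drift \<nu> s \<epsilon> x"
  shows "survival_O K a x (\<nu> / s)"
proof (cases "\<nu> \<le> s")
  case True
  show ?thesis by (rule survival_upper_sublinear[OF assms(1) True assms(3-6)])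
next
  case False
  then have "s \<le> \<nu>" by simp
  show ?thesis by (rule survival_upper_superlinear[OF assms(2) \<open>s \<le> \<nu>\<close> assms(3-6)])
qed

text \<open>A failure bound of the form g(z) m^k propagates, because g grows in mean by at most m =
  1 + C h^(-s) above h and equals 1 below. Over h^s steps the factors amount to at most exp
  C.\<close>

lemma survival_persistence:
  fixes \<rho> s C H :: real
  assumes \<rho>: "\<rho> > 0" and C: "C \<ge> 0" and H: "H > 0"
    and drift: "\<And>h x. h \<ge> H \<Longrightarrow> x \<in> X \<Longrightarrow> h \<le> \<bar>x\<bar> \<Longrightarrow>
      (\<integral>z. (max 1 (\<bar>z\<bar> / h)) powr (- \<rho>) \<partial>K x) \<le> (\<bar>x\<bar> / h) powr (- \<rho>) * (1 + C * h powr (- s))"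
  shows "\<exists>L\<ge>1. \<forall>h\<ge>H. \<forall>n. real n \<le> h powr s \<longrightarrow> (\<forall>x\<in>X. L * h \<le> \<bar>x\<bar> \<longrightarrow> 1 / 2 \<le> survival K h n x)"
proof -
  \<comment> \<open>L^(-\<rho>) = 1/(2 exp C), so that after growth by exp C the failure probability
    is at most 1/2.\<close>
  define L where "L = (2 * exp C) powr (1 / \<rho>)"
  have "exp C \<ge> 1" using C by simp
  then have "2 * exp C \<ge> 1" by linarith
  then have L: "L \<ge> 1" unfolding L_def using \<rho> by (intro ge_one_powr_ge_zero) auto
  have Lp: "L powr (- \<rho>) = 1 / (2 * exp C)" unfolding L_def using \<rho> by (simp add: powr_powr powr_minus_divide)
  have "1 / 2 \<le> survival K h n x"
    if h: "h \<ge> H" and n: "real n \<le> h powr s" and x: "x \<in> X" "L * h \<le> \<bar>x\<bar>" for h n x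
  proof -
    have h0: "h > 0" using h H by simp
    define m where "m = 1 + C * h powr (- s)"
    have m: "m \<ge> 1" using C by (simp add: m_def)
    define g where "g z = (max 1 (\<bar>z\<bar> / h)) powr (- \<rho>)" for z
    have [measurable]: "g \<in> borel_measurable borel" unfolding g_def by measurable
    have g: "0 \<le> g z" "g z \<le> 1" for z
    proof -
      have "(max 1 (\<bar>z\<bar> / h)) powr (- \<rho>) \<le> 1 powr (- \<rho>)" using \<rho> by (intro powr_mono2') auto
      then show "g z \<le> 1" by (simp add: g_def)
    qed (simp add: g_def)
    have "1 - survival K h k z \<le> g z * m ^ k" if "z \<in> X" for k z
      using that
    proof (induction k arbitrary: z)
      case 0
      show ?case
      proof (cases "h < \<bar>z\<bar>")
        case False
        then have "g z = 1" using h0 by (simp add: g_def max_def field_simps)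
        then show ?thesis using survival_bounds(1)[OF K, of h 0 z] by simp
      qed (use g in simp)
    next
      case (Suc k)
      interpret prob_space "K z" by (rule prob_space_kernel[OF K])
      show ?case
      proof (cases "h < \<bar>z\<bar>")
        case False
        then have "g z = 1" using h0 by (simp add: g_def max_def field_simps)
        moreover have "1 - survival K h (Suc k) z \<le> 1 * m ^ Suc k"
          using survival_bounds(1)[OF K, of h "Suc k" z] one_le_power[OF m, of "Suc k"] by linarith
        ultimately show ?thesis by (simp only:)
      next
        case True
        have ig: "integrable (K z) g"
          by (rule integrable_const_bound[where B=1]) (use g measurable_kernel[OF K, of g] in auto)
        have "(\<integral>w. 1 - g w * m ^ k \<partial>K z) \<le> (\<integral>w. survival K h k w \<partial>K z)"
        proof (rule integral_survival_ge[OF Suc(2)])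
          show "1 - g w * m ^ k \<le> survival K h k w" if "w \<in> X" for w using Suc(1)[OF that] by linarith
        qed (use ig in auto)
        also have "(\<integral>w. 1 - g w * m ^ k \<partial>K z) = 1 - (\<integral>w. g w \<partial>K z) * m ^ k"
          using ig by (simp add: prob_space)
        finally have "1 - survival K h (Suc k) z \<le> (\<integral>w. g w \<partial>K z) * m ^ k"
          unfolding survival_Suc[OF True] by linarith
        also have "\<dots> \<le> (g z * m) * m ^ k"
        proof (rule mult_right_mono)
          have "\<bar>z\<bar> / h = max 1 (\<bar>z\<bar> / h)" using True h0 by (simp add: max_def field_simps)
          then show "(\<integral>w. g w \<partial>K z) \<le> g z * m"
            using drift[OF h Suc(2)] True unfolding g_def m_def by simp
        qed (use m in simp)
        finally show ?thesis by (simp add: mult.assoc)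
      qed
    qed
    from this[OF x(1)] have "1 - survival K h n x \<le> g x * m ^ n" .
    also have "\<dots> \<le> (1 / (2 * exp C)) * exp C"
    proof (rule mult_mono)
      have "L \<le> \<bar>x\<bar> / h" using x h0 by (simp add: field_simps)
      then show "g x \<le> 1 / (2 * exp C)" unfolding Lp[symmetric] g_def using L \<rho> by (intro powr_mono2') auto
      have "m ^ n \<le> exp (C * h powr (- s)) ^ n" using m unfolding m_def by (intro power_mono) auto
      also have "\<dots> = exp (n * (C * h powr (- s)))" by (simp add: exp_of_nat_mult)
      also have "\<dots> \<le> exp C"
      proof -
        have "real n * (C * h powr (- s)) \<le> h powr s * (C * h powr (- s))" using n C by (intro mult_right_mono) auto
        also have "\<dots> = C" using h0 by (simp add: powr_minus)
        finally show ?thesis by simp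
      qed
      finally show "m ^ n \<le> exp C" .
    qed (use m in auto)
    also have "\<dots> = 1 / 2" by simp
    finally show ?thesis by simp
  qed
  then show ?thesis using L by blast
qed

text \<open>With h = n^(1/s), the first jump clears L h with probability of order n^(-\<alpha>/s),
  after which persistence keeps the chain above h \<ge> a for n steps with probability at least
  1/2.\<close>

lemma survival_lower_one_jump:
  fixes s \<alpha> a c L H Y :: real
  assumes s: "s > 0" and L: "L \<ge> 1" and a: "H \<le> a" and x: "x \<in> X" "a < \<bar>x\<bar>" and c: "c > 0"
    and persist: "\<And>h n z. h \<ge> H \<Longrightarrow> real n \<le> h powr s \<Longrightarrow> z \<in> X \<Longrightarrow> L * h \<le> \<bar>z\<bar> \<Longrightarrow> 1 / 2 \<le> survival K h n z"
    and jump: "\<And>y. y \<ge> Y \<Longrightarrow> c * y powr (- \<alpha>) \<le> measure (K x) {z. y \<le> \<bar>z\<bar>}"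
  shows "survival_Omega K a x (\<alpha> / s)"
proof -
  interpret prob_space "K x" by (rule prob_space_kernel[OF K])
  \<comment> \<open>Three demands on h: at least a to compare levels, at least H for persistence,
    and L h at least Y for the bound on the jump.\<close>
  obtain n0 where n0: "\<And>n. n \<ge> n0 \<Longrightarrow> max (max a H) (Y / L) \<le> real n powr (1 / s)"
    using root_unbounded[OF s] by blast
  have "(c / 2 * L powr (- \<alpha>)) * real n powr (- (\<alpha> / s)) \<le> survival K a n x" if n: "n \<ge> max n0 1" for n
  proof -
    define h where "h = real n powr (1 / s)"
    have h: "h \<ge> a" "h \<ge> H" "h \<ge> Y / L" using n0[of n] n by (auto simp: h_def)
    have hn: "real n \<le> h powr s" using s n by (simp add: h_def powr_powr)
    have hp: "h > 0" using n by (simp add: h_def)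
    have [measurable]: "{z. L * h \<le> \<bar>z\<bar>} \<in> sets borel" by measurable
    have "(c / 2 * L powr (- \<alpha>)) * real n powr (- (\<alpha> / s)) = 1 / 2 * (c * (L * h) powr (- \<alpha>))"
      using L n by (simp add: powr_mult h_def powr_powr)
    also have "\<dots> \<le> 1 / 2 * measure (K x) {z. L * h \<le> \<bar>z\<bar>}"
      using h L by (intro mult_left_mono jump) (auto simp: field_simps)
    also have "\<dots> = (\<integral>z. 1 / 2 * indicator {z. L * h \<le> \<bar>z\<bar>} z \<partial>K x)"
      by (simp add: sets_kernel[OF K] space_kernel[OF K])
    also have "\<dots> \<le> (\<integral>z. survival K a n z \<partial>K x)"
    proof (rule integral_survival_ge[OF x(1)])
      fix z assume z: "z \<in> X"
      show "1 / 2 * indicator {z. L * h \<le> \<bar>z\<bar>} z \<le> survival K a n z"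
      proof (cases "L * h \<le> \<bar>z\<bar>")
        case True
        have "1 / 2 \<le> survival K h n z" by (rule persist[OF h(2) hn z True])
        also have "\<dots> \<le> survival K a n z" by (rule survival_level_antimono[OF K h(1)])
        finally show ?thesis using True by simp
      qed (use survival_bounds(1)[OF K] in simp)
    qed (auto intro!: integrable_mult_right integrable_real_indicator simp: sets_kernel[OF K] emeasure_eq_measure)
    \<comment> \<open>The jump takes one step of its own; monotonicity in time returns the bound
      from n + 1 to n.\<close>
    also have "\<dots> = survival K a (Suc n) x" using x by simp
    also have "\<dots> \<le> survival K a n x" by (rule survival_Suc_le[OF K])
    finally show ?thesis .
  qed
  moreover have "c / 2 * L powr (- \<alpha>) > 0" using c L by simp
  ultimately show ?thesis unfolding survival_Omega_def by blast
qed

text \<open>The subsolution \<open>G\<close> is |z|^\<nu> truncated at T y, shifted to be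
  nonpositive where the chain has been stopped, and scaled to be at most 1/2. Below y it is
  subharmonic; above y, where truncation may spoil this, persistence gives survival at least 1/2.
  Cutting at T y instead of y leaves room above each |z| \<le> y, so the cut costs little
  drift.\<close>

lemma survival_lower_subharmonic:
  fixes s \<nu> a L H T :: real
  assumes s: "s > 0" and \<nu>: "\<nu> > 0" and L: "L \<ge> 1" and T: "T \<ge> 1" and a: "a \<ge> 0" "H \<le> a" and x: "x \<in> X" "a < \<bar>x\<bar>"
    and persist: "\<And>h n z. h \<ge> H \<Longrightarrow> real n \<le> h powr s \<Longrightarrow> z \<in> X \<Longrightarrow> L * h \<le> \<bar>z\<bar> \<Longrightarrow> 1 / 2 \<le> survival K h n z"
    and drift: "\<And>y x. x \<in> X \<Longrightarrow> a < \<bar>x\<bar> \<Longrightarrow> \<bar>x\<bar> \<le> y \<Longrightarrow> \<bar>x\<bar> powr \<nu> \<le> (\<integral>z. (min \<bar>z\<bar> (T * y)) powr \<nu> \<partial>K x)"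
  shows "survival_Omega K a x (\<nu> / s)"
proof -
  obtain n0 where n0: "\<And>n. n \<ge> n0 \<Longrightarrow> \<bar>x\<bar> \<le> real n powr (1 / s)"
    using root_unbounded[OF s] by blast
  define c' where "c' = (\<bar>x\<bar> powr \<nu> - a powr \<nu>) / (2 * (T * L) powr \<nu>)"
  have "a powr \<nu> < \<bar>x\<bar> powr \<nu>" using x a \<nu> by (intro powr_less_mono2) auto
  then have c': "c' > 0" using T L by (simp add: c'_def)
  have "c' * real n powr (- (\<nu> / s)) \<le> survival K a n x" if n: "n \<ge> max n0 1" for n
  proof -
    define h where "h = real n powr (1 / s)"
    have h: "h \<ge> \<bar>x\<bar>" using n0[of n] n by (auto simp: h_def)
    have hn: "h powr s = real n" using s n by (simp add: h_def powr_powr)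
    have hp: "h > 0" using n by (simp add: h_def)
    define y where "y = L * h"
    have hy: "h \<le> y" using L hp by (simp add: y_def)
    have y: "y > 0" using hp hy by linarith
    have yT: "y \<le> T * y" using T y by simp
    have Ty: "T * y > 0" using y yT by linarith
    define G where "G z = 1 / 2 * (((min \<bar>z\<bar> (T * y)) powr \<nu> - a powr \<nu>) / (T * y) powr \<nu>)" for z
    have mb: "(min \<bar>z\<bar> (T * y)) powr \<nu> \<le> (T * y) powr \<nu>" for z using \<nu> Ty by (intro powr_mono2) auto
    have G1: "G z \<le> 1 / 2" for z
    proof -
      have "(min \<bar>z\<bar> (T * y)) powr \<nu> - a powr \<nu> \<le> 1 * (T * y) powr \<nu>" using mb[of z] by (smt (verit) powr_ge_zero)
      then have "((min \<bar>z\<bar> (T * y)) powr \<nu> - a powr \<nu>) / (T * y) powr \<nu> \<le> 1" using Ty by (simp add: divide_le_eq)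
      then show ?thesis unfolding G_def by linarith
    qed
    have "G z \<le> survival K a k z" if "k \<le> n" "z \<in> X" for k z
      using that
    proof (induction k arbitrary: z)
      case 0
      show ?case
      proof (cases "a < \<bar>z\<bar>")
        case True then show ?thesis using G1[of z] by simp
      next
        case False
        then have "(min \<bar>z\<bar> (T * y)) powr \<nu> \<le> a powr \<nu>" using \<nu> Ty by (intro powr_mono2) auto
        then have "G z \<le> 0" using Ty unfolding G_def by (intro mult_nonneg_nonpos divide_nonpos_pos) auto
        then show ?thesis using survival_bounds(1)[OF K, of a 0 z] by linarith
      qed
    next
      case (Suc k)
      consider "\<bar>z\<bar> \<le> a" | "y \<le> \<bar>z\<bar>" "a < \<bar>z\<bar>" | "a < \<bar>z\<bar>" "\<bar>z\<bar> < y" by linarith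
      then show ?case
      proof cases
        case 1
        then have "(min \<bar>z\<bar> (T * y)) powr \<nu> \<le> a powr \<nu>" using \<nu> Ty by (intro powr_mono2) auto
        then have "G z \<le> 0" using Ty unfolding G_def by (intro mult_nonneg_nonpos divide_nonpos_pos) auto
        then show ?thesis using survival_bounds(1)[OF K, of a "Suc k" z] by linarith
      next
        case 2
        have "h \<ge> a" using h x by linarith
        have "G z \<le> 1 / 2" by (rule G1)
        \<comment> \<open>Suc k \<le> n = h^s and |z| \<ge> y = L h are precisely what persistence
          asks for.\<close>
        also have "\<dots> \<le> survival K h (Suc k) z"
          using Suc 2 \<open>h \<ge> a\<close> a by (intro persist) (auto simp: hn y_def)
        also have "\<dots> \<le> survival K a (Suc k) z" by (rule survival_level_antimono[OF K \<open>h \<ge> a\<close>])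
        finally show ?thesis .
      next
        case 3
        interpret prob_space "K z" by (rule prob_space_kernel[OF K])
        have im: "integrable (K z) (\<lambda>w. (min \<bar>w\<bar> (T * y)) powr \<nu>)"
        proof (rule integrable_const_bound[where B="(T * y) powr \<nu>"])
          show "(\<lambda>w. (min \<bar>w\<bar> (T * y)) powr \<nu>) \<in> borel_measurable (K z)" by (rule measurable_kernel[OF K]) measurable
        qed (use mb in auto)
        have "G z \<le> 1 / 2 * ((\<bar>z\<bar> powr \<nu> - a powr \<nu>) / (T * y) powr \<nu>)"
          using 3 yT by (simp add: G_def min_def)
        also have "\<dots> \<le> 1 / 2 * (((\<integral>w. (min \<bar>w\<bar> (T * y)) powr \<nu> \<partial>K z) - a powr \<nu>) / (T * y) powr \<nu>)"
          using drift[OF Suc(3) 3(1), of y] 3 by (intro mult_left_mono divide_right_mono) auto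
        also have "\<dots> = (\<integral>w. G w \<partial>K z)"
          unfolding G_def using im by (simp add: prob_space)
        also have "\<dots> \<le> (\<integral>w. survival K a k w \<partial>K z)"
          using Suc im unfolding G_def by (intro integral_survival_ge) auto
        also have "\<dots> = survival K a (Suc k) z" using 3 by simp
        finally show ?thesis .
      qed
    qed
    from this[OF order_refl x(1)] have "G x \<le> survival K a n x" .
    moreover have "G x = c' * real n powr (- (\<nu> / s))"
    proof -
      have "\<bar>x\<bar> \<le> T * y" using h hy yT by linarith
      moreover have "(T * y) powr \<nu> = (T * L) powr \<nu> * real n powr (\<nu> / s)"
      proof -
        have "T * y = (T * L) * h" by (simp add: y_def)
        then show ?thesis using T L hp by (simp add: powr_mult h_def powr_powr)
      qed
      ultimately show ?thesis by (simp add: G_def c'_def powr_minus_divide)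
    qed
    ultimately show ?thesis by simp
  qed
  then show ?thesis unfolding survival_Omega_def using c' by blast
qed

end

section \<open>Drift estimates for the chain\<close>

text \<open>The sign makes jumps away from the origin positive, so the two half-lines give one
  family of laws and the two drift limits become one.\<close>

definition outward_law :: "(real \<Rightarrow> real measure) \<Rightarrow> real \<Rightarrow> real measure" where
  "outward_law K x = distr (K x) borel (\<lambda>z. sgn x * (z - x))"

lemma abs_outward: "x \<noteq> 0 \<Longrightarrow> \<bar>\<bar>x\<bar> + sgn x * (z - x)\<bar> = \<bar>z\<bar>" for x z :: real
  by (cases "x > 0") (auto simp: sgn_if)

lemma abs_powr_scale: "r > 0 \<Longrightarrow> \<bar>r + t\<bar> powr \<nu> = r powr \<nu> * \<bar>1 + t / r\<bar> powr \<nu>" for r t \<nu> :: real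
proof -
  assume r: "r > 0"
  have "\<bar>r + t\<bar> = r * \<bar>1 + t / r\<bar>"
  proof -
    have "r + t = r * (1 + t / r)" using r by (simp add: field_simps)
    then show ?thesis using r by (simp add: abs_mult)
  qed
  then show ?thesis by (simp add: powr_mult)
qed

text \<open>In the range \<gamma> \<le> \<alpha> - 1 the drift is of at least the order of the jumps
  and the time scale is |x|^(\<gamma>+1). Larger \<gamma> enter with \<gamma> = \<alpha> - 1 and b =
  0. A positive \<open>R0\<close> keeps sgn x nonzero.\<close>

locale heavy_chain = markov_kernel X K + heavy_tails "outward_law K ` {x \<in> X. R0 \<le> \<bar>x\<bar>}" \<alpha> \<beta> c B
  for X K R0 \<alpha> \<beta> c B +
  fixes \<gamma> b :: real
  assumes R0: "R0 > 0" and \<gamma>: "\<gamma> \<ge> 0" "\<gamma> \<le> \<alpha> - 1"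
    and drift: "\<And>\<epsilon>. \<epsilon> > 0 \<Longrightarrow> \<exists>R. \<forall>x\<in>X. R \<le> \<bar>x\<bar> \<longrightarrow> \<bar>\<bar>x\<bar> powr \<gamma> * (\<integral>t. t \<partial>outward_law K x) - b\<bar> \<le> \<epsilon>"
begin

abbreviation mu :: "real \<Rightarrow> real" where
  "mu x \<equiv> (\<integral>t. t \<partial>outward_law K x)"

abbreviation scaled_moment :: "real \<Rightarrow> real \<Rightarrow> real" where
  "scaled_moment \<nu> x \<equiv> (\<integral>t. \<bar>1 + t / \<bar>x\<bar>\<bar> powr \<nu> \<partial>outward_law K x)"

abbreviation laws :: "real measure set" where
  "laws \<equiv> outward_law K ` {x \<in> X. R0 \<le> \<bar>x\<bar>}"

lemma law_mem: "x \<in> X \<Longrightarrow> R0 \<le> \<bar>x\<bar> \<Longrightarrow> outward_law K x \<in> laws"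
  by auto

lemma measurable_step: "(\<lambda>z. sgn x * (z - x)) \<in> K x \<rightarrow>\<^sub>M borel"
  by (rule measurable_kernel[OF K]) measurable

lemma integral_kernel_abs:
  fixes F :: "real \<Rightarrow> real"
  assumes [measurable]: "F \<in> borel_measurable borel" and x: "x \<noteq> 0"
  shows "(\<integral>z. F \<bar>z\<bar> \<partial>K x) = (\<integral>t. F \<bar>\<bar>x\<bar> + t\<bar> \<partial>outward_law K x)"
proof -
  have "(\<integral>t. F \<bar>\<bar>x\<bar> + t\<bar> \<partial>outward_law K x) = (\<integral>z. F \<bar>\<bar>x\<bar> + sgn x * (z - x)\<bar> \<partial>K x)"
    unfolding outward_law_def by (rule integral_distr[OF measurable_step]) measurable
  then show ?thesis using x by (simp add: abs_outward)
qed

lemma integrable_kernel_abs: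
  fixes F :: "real \<Rightarrow> real"
  assumes [measurable]: "F \<in> borel_measurable borel" and x: "x \<noteq> 0"
    and i: "integrable (outward_law K x) (\<lambda>t. F \<bar>\<bar>x\<bar> + t\<bar>)"
  shows "integrable (K x) (\<lambda>z. F \<bar>z\<bar>)"
proof -
  have "integrable (K x) (\<lambda>z. F \<bar>\<bar>x\<bar> + sgn x * (z - x)\<bar>)"
    using i unfolding outward_law_def by (rule integrable_distr[OF measurable_step])
  then show ?thesis using x by (simp add: abs_outward)
qed

lemma moment_kernel:
  assumes \<nu>: "0 < \<nu>" "\<nu> < \<alpha>" and x: "x \<in> X" "R0 \<le> \<bar>x\<bar>"
  shows "integrable (K x) (\<lambda>z. \<bar>z\<bar> powr \<nu>)"
    and "(\<integral>z. \<bar>z\<bar> powr \<nu> \<partial>K x) = \<bar>x\<bar> powr \<nu> * scaled_moment \<nu> x"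
proof -
  have x0: "x \<noteq> 0" "\<bar>x\<bar> > 0" using x R0 by auto
  have m: "(\<lambda>z::real. z powr \<nu>) \<in> borel_measurable borel" by measurable
  have "integrable (outward_law K x) (\<lambda>t. \<bar>x\<bar> powr \<nu> * \<bar>1 + t / \<bar>x\<bar>\<bar> powr \<nu>)"
    by (intro integrable_mult_right integrable_scaled_powr \<nu> law_mem x x0)
  then show "integrable (K x) (\<lambda>z. \<bar>z\<bar> powr \<nu>)"
    by (intro integrable_kernel_abs[OF m x0(1)]) (simp only: abs_powr_scale[OF x0(2)])
  show "(\<integral>z. \<bar>z\<bar> powr \<nu> \<partial>K x) = \<bar>x\<bar> powr \<nu> * scaled_moment \<nu> x"
    unfolding integral_kernel_abs[OF m x0(1)] abs_powr_scale[OF x0(2)] by simp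
qed

lemma mu_bounds:
  assumes "\<epsilon> > 0"
  shows "\<exists>R\<ge>R0. \<forall>x\<in>X. R \<le> \<bar>x\<bar> \<longrightarrow>
    (b - \<epsilon>) * \<bar>x\<bar> powr (- (\<gamma> + 1)) \<le> mu x / \<bar>x\<bar> \<and> mu x / \<bar>x\<bar> \<le> (b + \<epsilon>) * \<bar>x\<bar> powr (- (\<gamma> + 1))"
proof -
  obtain R where R: "\<And>x. x \<in> X \<Longrightarrow> R \<le> \<bar>x\<bar> \<Longrightarrow> \<bar>\<bar>x\<bar> powr \<gamma> * mu x - b\<bar> \<le> \<epsilon>"
    using drift[OF assms] by blast
  have "(b - \<epsilon>) * \<bar>x\<bar> powr (- (\<gamma> + 1)) \<le> mu x / \<bar>x\<bar> \<and> mu x / \<bar>x\<bar> \<le> (b + \<epsilon>) * \<bar>x\<bar> powr (- (\<gamma> + 1))"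
    if x: "x \<in> X" "max R R0 \<le> \<bar>x\<bar>" for x
  proof -
    have x0: "\<bar>x\<bar> > 0" using x R0 by auto
    have "b - \<epsilon> \<le> \<bar>x\<bar> powr \<gamma> * mu x" "\<bar>x\<bar> powr \<gamma> * mu x \<le> b + \<epsilon>"
      using R[OF x(1)] x(2) by (auto simp: abs_le_iff)
    then have "(b - \<epsilon>) * \<bar>x\<bar> powr (- (\<gamma> + 1)) \<le> (\<bar>x\<bar> powr \<gamma> * mu x) * \<bar>x\<bar> powr (- (\<gamma> + 1))"
      "(\<bar>x\<bar> powr \<gamma> * mu x) * \<bar>x\<bar> powr (- (\<gamma> + 1)) \<le> (b + \<epsilon>) * \<bar>x\<bar> powr (- (\<gamma> + 1))"
      by (auto intro: mult_right_mono)
    moreover have "(\<bar>x\<bar> powr \<gamma> * mu x) * \<bar>x\<bar> powr (- (\<gamma> + 1)) = mu x / \<bar>x\<bar>"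
    proof -
      have "\<bar>x\<bar> powr \<gamma> * \<bar>x\<bar> powr (- (\<gamma> + 1)) = 1 / \<bar>x\<bar>"
        using x0 by (simp add: powr_add[symmetric] powr_minus_divide)
      then show ?thesis by (simp add: mult.assoc mult.left_commute[of _ "mu x"])
    qed
    ultimately show ?thesis by simp
  qed
  then show ?thesis by (intro exI[of _ "max R R0"]) auto
qed

lemma moment_asymp:
  assumes \<nu>: "0 < \<nu>" "\<nu> < \<alpha>" and \<epsilon>: "\<epsilon> > 0"
  shows "\<exists>R\<ge>R0. \<forall>x\<in>X. R \<le> \<bar>x\<bar> \<longrightarrow>
    \<bar>scaled_moment \<nu> x - 1 - \<nu> * (mu x / \<bar>x\<bar>) + c * \<nu> * stable_coeff \<alpha> \<nu> * \<bar>x\<bar> powr (- \<alpha>)\<bar>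
      \<le> \<epsilon> * \<bar>x\<bar> powr (- \<alpha>)"
proof -
  obtain R where R: "R > 0" "\<forall>r\<ge>R. \<forall>N\<in>laws.
     \<bar>(\<integral>t. \<bar>1 + t / r\<bar> powr \<nu> \<partial>N) - 1 - \<nu> / r * (\<integral>t. t \<partial>N) + c * \<nu> * stable_coeff \<alpha> \<nu> * r powr (- \<alpha>)\<bar> \<le> \<epsilon> * r powr (- \<alpha>)"
    using powr_asymp[OF \<nu> \<epsilon>] by blast
  show ?thesis by (rule exI[of _ "max R R0"]) (use R(2) law_mem in simp)
qed

lemma power_driftI:
  assumes \<nu>: "0 < \<nu>" "\<nu> < \<alpha>" and x: "x \<in> X" "R0 \<le> \<bar>x\<bar>"
    and le: "scaled_moment \<nu> x \<le> 1 - \<epsilon> * \<bar>x\<bar> powr (- s)"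
  shows "power_drift \<nu> s \<epsilon> x"
proof -
  have "(\<integral>z. \<bar>z\<bar> powr \<nu> \<partial>K x) \<le> \<bar>x\<bar> powr \<nu> * (1 - \<epsilon> * \<bar>x\<bar> powr (- s))"
    unfolding moment_kernel(2)[OF \<nu> x] by (rule mult_left_mono[OF le]) simp
  also have "\<dots> = \<bar>x\<bar> powr \<nu> - \<epsilon> * \<bar>x\<bar> powr (\<nu> - s)"
    by (simp add: right_diff_distrib powr_diff powr_minus_divide)
  finally show ?thesis using moment_kernel(1)[OF \<nu> x] by (simp add: power_drift_def)
qed

lemma survival_O_of_drift:
  assumes "0 < \<nu>" "0 < s" "\<epsilon> > 0" and "R \<ge> R0"
    and "\<And>x. x \<in> X \<Longrightarrow> R \<le> \<bar>x\<bar> \<Longrightarrow> power_drift \<nu> s \<epsilon> x"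
  shows "\<exists>a0. \<forall>a\<ge>a0. \<forall>x\<in>X. a < \<bar>x\<bar> \<longrightarrow> survival_O K a x (\<nu> / s)"
  using assms R0 by (intro exI[of _ R] allI ballI impI survival_upper[where \<epsilon>=\<epsilon>]) auto

section \<open>Survival exponents in the critical and subcritical regimes\<close>

lemma critical_upper:
  assumes \<gamma>': "\<gamma> = \<alpha> - 1" and \<nu>: "0 < \<nu>" "\<nu> < \<alpha>" and b: "b < c * stable_coeff \<alpha> \<nu>"
  shows "\<exists>a0. \<forall>a\<ge>a0. \<forall>x\<in>X. a < \<bar>x\<bar> \<longrightarrow> survival_O K a x (\<nu> / \<alpha>)"
proof -
  define H where "H = stable_coeff \<alpha> \<nu>"
  \<comment> \<open>The leading coefficient \<nu> (b - c H) equals -2 \<epsilon>. One \<epsilon>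
    remains as drift; the other is spent on the errors \<delta> of the moment expansion and \<nu>
    \<delta> of the mean.\<close>
  define \<epsilon> where "\<epsilon> = \<nu> * (c * H - b) / 2"
  define \<delta> where "\<delta> = \<epsilon> / (\<nu> + 1)"
  have \<epsilon>: "\<epsilon> > 0" using b \<nu> by (simp add: \<epsilon>_def H_def)
  then have \<delta>: "\<delta> > 0" "(\<nu> + 1) * \<delta> = \<epsilon>" using \<nu> by (auto simp: \<delta>_def)
  obtain R1 where R1: "R1 \<ge> R0" "\<forall>x\<in>X. R1 \<le> \<bar>x\<bar> \<longrightarrow>
    \<bar>scaled_moment \<nu> x - 1 - \<nu> * (mu x / \<bar>x\<bar>) + c * \<nu> * H * \<bar>x\<bar> powr (- \<alpha>)\<bar> \<le> \<delta> * \<bar>x\<bar> powr (- \<alpha>)"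
    using moment_asymp[OF \<nu> \<delta>(1)] unfolding H_def by blast
  obtain R2 where R2: "R2 \<ge> R0" "\<forall>x\<in>X. R2 \<le> \<bar>x\<bar> \<longrightarrow>
    (b - \<delta>) * \<bar>x\<bar> powr (- (\<gamma> + 1)) \<le> mu x / \<bar>x\<bar> \<and> mu x / \<bar>x\<bar> \<le> (b + \<delta>) * \<bar>x\<bar> powr (- (\<gamma> + 1))"
    using mu_bounds[OF \<delta>(1)] by blast
  have "power_drift \<nu> \<alpha> \<epsilon> x" if x: "x \<in> X" "max R1 R2 \<le> \<bar>x\<bar>" for x
  proof -
    define I where "I = scaled_moment \<nu> x"
    define p where "p = \<bar>x\<bar> powr (- \<alpha>)"
    have "\<bar>I - 1 - \<nu> * (mu x / \<bar>x\<bar>) + c * \<nu> * H * p\<bar> \<le> \<delta> * p"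
      using R1(2) x unfolding I_def p_def by auto
    moreover have "\<nu> * (mu x / \<bar>x\<bar>) \<le> \<nu> * ((b + \<delta>) * p)"
      using R2(2) x \<nu> unfolding p_def \<gamma>' by (intro mult_left_mono) auto
    ultimately have "I \<le> 1 + \<nu> * ((b + \<delta>) * p) - c * \<nu> * H * p + \<delta> * p" by linarith
    also have "\<dots> = 1 + (- 2 * \<epsilon> + (\<nu> + 1) * \<delta>) * p" unfolding \<epsilon>_def by (simp add: field_simps)
    also have "\<dots> = 1 - \<epsilon> * p" unfolding \<delta>(2) by simp
    finally show ?thesis using R1(1) x unfolding I_def p_def by (intro power_driftI \<nu>) auto
  qed
  then show ?thesis using alpha R1(1) \<nu> \<epsilon> by (intro survival_O_of_drift[of _ _ \<epsilon> "max R1 R2"]) auto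
qed

lemma subcritical_upper:
  assumes \<gamma>': "\<gamma> < \<alpha> - 1" and \<nu>: "0 < \<nu>" "\<nu> < \<alpha>" and b: "b < 0"
  shows "\<exists>a0. \<forall>a\<ge>a0. \<forall>x\<in>X. a < \<bar>x\<bar> \<longrightarrow> survival_O K a x (\<nu> / (\<gamma> + 1))"
proof -
  define H where "H = stable_coeff \<alpha> \<nu>"
  \<comment> \<open>Allowing the mean an error of |b|/2 leaves \<nu> b/2 = -2 \<epsilon> at order
    |x|^(-(\<gamma>+1)). One \<epsilon> then absorbs all terms of order |x|^(-\<alpha>), collected
    in \<open>E\<close>.\<close>
  define \<epsilon> where "\<epsilon> = \<nu> * (- b) / 4"
  have \<epsilon>: "\<epsilon> > 0" using b \<nu> by (simp add: \<epsilon>_def mult_pos_neg)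
  define E where "E = \<bar>c * \<nu> * H\<bar> + 1"
  obtain R1 where R1: "R1 \<ge> R0" "\<forall>x\<in>X. R1 \<le> \<bar>x\<bar> \<longrightarrow>
    \<bar>scaled_moment \<nu> x - 1 - \<nu> * (mu x / \<bar>x\<bar>) + c * \<nu> * H * \<bar>x\<bar> powr (- \<alpha>)\<bar> \<le> 1 * \<bar>x\<bar> powr (- \<alpha>)"
    using moment_asymp[OF \<nu> zero_less_one] unfolding H_def by blast
  have b2: "- b / 2 > 0" using b by simp
  obtain R2 where R2: "R2 \<ge> R0" "\<forall>x\<in>X. R2 \<le> \<bar>x\<bar> \<longrightarrow>
    (b - - b / 2) * \<bar>x\<bar> powr (- (\<gamma> + 1)) \<le> mu x / \<bar>x\<bar> \<and> mu x / \<bar>x\<bar> \<le> (b + - b / 2) * \<bar>x\<bar> powr (- (\<gamma> + 1))"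
    using mu_bounds[OF b2] by blast
  have s: "\<alpha> - 1 - \<gamma> > 0" and E: "E \<ge> 0" using \<gamma>' by (auto simp: E_def)
  obtain R3 where R3: "R3 > 0" "\<forall>r\<ge>R3. E * r powr (- (\<alpha> - 1 - \<gamma>)) \<le> \<epsilon>"
    using eventually_powr_small[OF s \<epsilon> E] by blast
  define R where "R = max R1 (max R2 R3)"
  have "power_drift \<nu> (\<gamma> + 1) \<epsilon> x" if x: "x \<in> X" "R \<le> \<bar>x\<bar>" for x
  proof -
    define I where "I = scaled_moment \<nu> x"
    define p where "p = \<bar>x\<bar> powr (- \<alpha>)"
    define w where "w = \<bar>x\<bar> powr (- (\<gamma> + 1))"
    have p0: "p \<ge> 0" by (simp add: p_def)
    have "\<bar>I - 1 - \<nu> * (mu x / \<bar>x\<bar>) + c * \<nu> * H * p\<bar> \<le> 1 * p"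
      using R1(2) x unfolding I_def p_def R_def by auto
    then have "I \<le> 1 + \<nu> * (mu x / \<bar>x\<bar>) + (- (c * \<nu> * H) * p) + p" by (simp add: abs_le_iff)
    moreover have "- (c * \<nu> * H) * p \<le> \<bar>c * \<nu> * H\<bar> * p" using p0 by (intro mult_right_mono) auto
    moreover have "\<nu> * (mu x / \<bar>x\<bar>) \<le> \<nu> * ((b + - b / 2) * w)"
      using R2(2) x \<nu> unfolding w_def R_def by (intro mult_left_mono) auto
    moreover have "E * p \<le> \<epsilon> * w"
    proof -
      have "p = \<bar>x\<bar> powr (- (\<alpha> - 1 - \<gamma>)) * w" unfolding p_def w_def by (simp add: powr_add[symmetric])
      moreover have "E * \<bar>x\<bar> powr (- (\<alpha> - 1 - \<gamma>)) * w \<le> \<epsilon> * w"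
        using R3(2) x by (intro mult_right_mono) (auto simp: R_def w_def)
      ultimately show ?thesis by (simp add: mult.assoc)
    qed
    moreover have "E * p = \<bar>c * \<nu> * H\<bar> * p + p" by (simp add: E_def ring_distribs)
    moreover have "\<nu> * ((b + - b / 2) * w) = - 2 * (\<epsilon> * w)" by (simp add: \<epsilon>_def field_simps)
    ultimately have "I \<le> 1 - \<epsilon> * w" by linarith
    then show ?thesis using R1(1) x unfolding I_def w_def R_def by (intro power_driftI \<nu>) auto
  qed
  then show ?thesis using \<gamma> R1(1) \<nu> \<epsilon> by (intro survival_O_of_drift[of _ _ \<epsilon> R]) (auto simp: R_def)
qed

text \<open>Above h the drift term is of order at most h^(-(\<gamma>+1)), and so is the jump term
  |x|^(-\<alpha>), since \<alpha> \<ge> \<gamma> + 1. Even an inward drift is thus slow on the time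
  scale h^(\<gamma>+1).\<close>

lemma persistence:
  "\<exists>H>0. \<exists>L\<ge>1. \<forall>h\<ge>H. \<forall>n. real n \<le> h powr (\<gamma> + 1) \<longrightarrow> (\<forall>x\<in>X. L * h \<le> \<bar>x\<bar> \<longrightarrow> 1 / 2 \<le> survival K h n x)"
proof -
  define \<rho> where "\<rho> = \<beta> - \<alpha>"
  have \<rho>: "\<rho> > 0" using beta by (simp add: \<rho>_def)
  obtain C R where C: "C \<ge> 0" "R \<ge> 1" "\<forall>h\<ge>R. \<forall>r\<ge>h. \<forall>N\<in>laws.
    (\<integral>t. (max 1 (\<bar>r + t\<bar> / h)) powr (- \<rho>) \<partial>N) \<le> (r / h) powr (- \<rho>) * (1 - \<rho> / r * (\<integral>t. t \<partial>N) + C * r powr (- \<alpha>))"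
    using decreasing_powr_bound unfolding \<rho>_def by blast
  obtain R2 where R2: "R2 \<ge> R0" "\<forall>x\<in>X. R2 \<le> \<bar>x\<bar> \<longrightarrow>
    (b - 1) * \<bar>x\<bar> powr (- (\<gamma> + 1)) \<le> mu x / \<bar>x\<bar> \<and> mu x / \<bar>x\<bar> \<le> (b + 1) * \<bar>x\<bar> powr (- (\<gamma> + 1))"
    using mu_bounds[OF zero_less_one] by blast
  define C' where "C' = \<rho> * (\<bar>b\<bar> + 1) + C"
  have C': "C' \<ge> 0" using C \<rho> by (simp add: C'_def)
  have H: "max R2 R > 0" using C(2) by simp
  have "(\<integral>z. (max 1 (\<bar>z\<bar> / h)) powr (- \<rho>) \<partial>K x) \<le> (\<bar>x\<bar> / h) powr (- \<rho>) * (1 + C' * h powr (- (\<gamma> + 1)))"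
    if h: "h \<ge> max R2 R" and x: "x \<in> X" "h \<le> \<bar>x\<bar>" for h x
  proof -
    have x0: "R0 \<le> \<bar>x\<bar>" "\<bar>x\<bar> > 0" "\<bar>x\<bar> \<ge> 1" "R2 \<le> \<bar>x\<bar>" "x \<noteq> 0" using x R2 R0 h C(2) by auto
    define w where "w = \<bar>x\<bar> powr (- (\<gamma> + 1))"
    have w0: "w \<ge> 0" by (simp add: w_def)
    have "(\<integral>z. (max 1 (\<bar>z\<bar> / h)) powr (- \<rho>) \<partial>K x) = (\<integral>t. (max 1 (\<bar>\<bar>x\<bar> + t\<bar> / h)) powr (- \<rho>) \<partial>outward_law K x)"
      using x0 by (intro integral_kernel_abs[where F="\<lambda>y. (max 1 (y / h)) powr (- \<rho>)"]) auto
    also have "\<dots> \<le> (\<bar>x\<bar> / h) powr (- \<rho>) * (1 - \<rho> / \<bar>x\<bar> * mu x + C * \<bar>x\<bar> powr (- \<alpha>))"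
      using C(3) law_mem[OF x(1) x0(1)] h x(2) by auto
    also have "\<dots> \<le> (\<bar>x\<bar> / h) powr (- \<rho>) * (1 + C' * h powr (- (\<gamma> + 1)))"
    proof (rule mult_left_mono)
      have "\<bar>x\<bar> powr (- \<alpha>) \<le> w" unfolding w_def using x0 \<gamma> by (intro powr_mono) auto
      then have 1: "C * \<bar>x\<bar> powr (- \<alpha>) \<le> C * w" using C(1) by (intro mult_left_mono)
      have "- (\<bar>b\<bar> + 1) * w \<le> (b - 1) * w" using w0 by (intro mult_right_mono) auto
      also have "\<dots> \<le> mu x / \<bar>x\<bar>" using R2(2) x(1) x0(4) unfolding w_def by blast
      finally have "\<rho> * (- (\<bar>b\<bar> + 1) * w) \<le> \<rho> * (mu x / \<bar>x\<bar>)" using \<rho> by (intro mult_left_mono) auto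
      then have 2: "- (\<rho> / \<bar>x\<bar> * mu x) \<le> \<rho> * (\<bar>b\<bar> + 1) * w" by (simp add: algebra_simps)
      have "w \<le> h powr (- (\<gamma> + 1))" unfolding w_def using h x \<gamma> C(2) by (intro powr_mono2') auto
      then have 3: "C' * w \<le> C' * h powr (- (\<gamma> + 1))" using C' by (intro mult_left_mono)
      have "C' * w = \<rho> * (\<bar>b\<bar> + 1) * w + C * w" by (simp add: C'_def ring_distribs)
      then show "1 - \<rho> / \<bar>x\<bar> * mu x + C * \<bar>x\<bar> powr (- \<alpha>) \<le> 1 + C' * h powr (- (\<gamma> + 1))" using 1 2 3 by linarith
    qed simp
    finally show ?thesis .
  qed
  from survival_persistence[OF \<rho> C' H this] H show ?thesis by blast
qed

lemma outward_jump:
  "\<exists>Y. \<forall>y\<ge>Y. \<forall>x\<in>X. R0 \<le> \<bar>x\<bar> \<longrightarrow> c / 2 * y powr (- \<alpha>) \<le> measure (K x) {z. y \<le> \<bar>z\<bar>}"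
proof -
  have "c / 2 > 0" using c by simp
  from tail[OF this] obtain Y where Y: "\<forall>y\<ge>Y. \<forall>N\<in>laws. \<bar>y powr \<alpha> * measure N {y<..} - c\<bar> \<le> c / 2"
    by blast
  have "c / 2 * y powr (- \<alpha>) \<le> measure (K x) {z. y \<le> \<bar>z\<bar>}"
    if y: "y \<ge> max Y 1" and x: "x \<in> X" "R0 \<le> \<bar>x\<bar>" for x y
  proof -
    interpret prob_space "K x" by (rule prob_space_kernel[OF K])
    have x0: "x \<noteq> 0" using x R0 by auto
    have "\<bar>y powr \<alpha> * measure (outward_law K x) {y<..} - c\<bar> \<le> c / 2"
      using Y law_mem[OF x] y by auto
    then have "c / 2 \<le> y powr \<alpha> * measure (outward_law K x) {y<..}" by linarith
    then have "c / 2 * y powr (- \<alpha>) \<le> y powr \<alpha> * measure (outward_law K x) {y<..} * y powr (- \<alpha>)" by (rule mult_right_mono) simp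
    also have "\<dots> = measure (outward_law K x) {y<..}" using y by (simp add: powr_minus)
    also have "\<dots> = measure (K x) ((\<lambda>z. sgn x * (z - x)) -` {y<..} \<inter> space (K x))"
      unfolding outward_law_def by (rule measure_distr[OF measurable_step]) simp
    also have "\<dots> \<le> measure (K x) {z. y \<le> \<bar>z\<bar>}"
    proof (rule finite_measure_mono)
      show "(\<lambda>z. sgn x * (z - x)) -` {y<..} \<inter> space (K x) \<subseteq> {z. y \<le> \<bar>z\<bar>}"
      proof
        fix z assume "z \<in> (\<lambda>z. sgn x * (z - x)) -` {y<..} \<inter> space (K x)"
        then have "y < sgn x * (z - x)" by simp
        then show "z \<in> {z. y \<le> \<bar>z\<bar>}" using abs_outward[OF x0, of z] y by simp
      qed
      show "{z. y \<le> \<bar>z\<bar>} \<in> events" unfolding sets_kernel[OF K] by measurable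
    qed
    finally show ?thesis .
  qed
  then show ?thesis by blast
qed

text \<open>The single jump gives the exponent exactly, with nothing lost, so q = \<alpha>/(\<gamma>
  + 1) itself already has an infinite moment.\<close>

lemma subcritical_lower:
  "\<exists>a0. \<forall>a\<ge>a0. \<forall>x\<in>X. a < \<bar>x\<bar> \<longrightarrow> survival_Omega K a x (\<alpha> / (\<gamma> + 1))"
proof -
  obtain H L where HL: "H > 0" "L \<ge> 1"
    "\<forall>h\<ge>H. \<forall>n. real n \<le> h powr (\<gamma> + 1) \<longrightarrow> (\<forall>x\<in>X. L * h \<le> \<bar>x\<bar> \<longrightarrow> 1 / 2 \<le> survival K h n x)"
    using persistence by blast
  obtain Y where Y: "\<forall>y\<ge>Y. \<forall>x\<in>X. R0 \<le> \<bar>x\<bar> \<longrightarrow> c / 2 * y powr (- \<alpha>) \<le> measure (K x) {z. y \<le> \<bar>z\<bar>}"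
    using outward_jump by blast
  show ?thesis
  proof (rule exI[of _ "max H R0"], intro allI ballI impI)
    fix a x assume a: "max H R0 \<le> a" and x: "x \<in> X" "a < \<bar>x\<bar>"
    show "survival_Omega K a x (\<alpha> / (\<gamma> + 1))"
    proof (rule survival_lower_one_jump[OF _ HL(2) _ x, of "\<gamma> + 1" H "c / 2" Y])
      show "c / 2 * y powr (- \<alpha>) \<le> measure (K x) {z. y \<le> \<bar>z\<bar>}" if "Y \<le> y" for y
        using Y that x a by auto
      show "1 / 2 \<le> survival K h n z" if "H \<le> h" "real n \<le> h powr (\<gamma> + 1)" "z \<in> X" "L * h \<le> \<bar>z\<bar>" for h n z
        using HL(3) that by blast
    qed (use \<gamma> c a in auto)
  qed
qed

lemma critical_lower:
  assumes \<gamma>': "\<gamma> = \<alpha> - 1" and \<nu>: "0 < \<nu>" "\<nu> < \<alpha>" and b: "c * stable_coeff \<alpha> \<nu> < b"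
  shows "\<exists>a0. \<forall>a\<ge>a0. \<forall>x\<in>X. a < \<bar>x\<bar> \<longrightarrow> survival_Omega K a x (\<nu> / \<alpha>)"
proof -
  define H where "H = stable_coeff \<alpha> \<nu>"
  define \<epsilon> where "\<epsilon> = \<nu> * (b - c * H)"
  \<comment> \<open>Three errors share \<epsilon>: \<nu> \<delta> from the mean, \<delta> from the
    moment expansion and \<delta> from truncation. They may use it up entirely, as plain
    subharmonicity is the goal.\<close>
  define \<delta> where "\<delta> = \<epsilon> / (\<nu> + 2)"
  have \<epsilon>: "\<epsilon> > 0" "\<delta> > 0" "\<nu> * \<delta> + \<delta> + \<delta> = \<epsilon>"
  proof -
    show "\<epsilon> > 0" using b \<nu> by (simp add: \<epsilon>_def H_def)
    then show "\<delta> > 0" using \<nu> by (simp add: \<delta>_def)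
    have "(\<nu> + 2) * \<delta> = \<epsilon>" using \<nu> by (simp add: \<delta>_def)
    then show "\<nu> * \<delta> + \<delta> + \<delta> = \<epsilon>" by (simp add: ring_distribs)
  qed
  obtain R1 where R1: "R1 \<ge> R0" "\<forall>x\<in>X. R1 \<le> \<bar>x\<bar> \<longrightarrow>
    \<bar>scaled_moment \<nu> x - 1 - \<nu> * (mu x / \<bar>x\<bar>) + c * \<nu> * H * \<bar>x\<bar> powr (- \<alpha>)\<bar> \<le> \<delta> * \<bar>x\<bar> powr (- \<alpha>)"
    using moment_asymp[OF \<nu> \<epsilon>(2)] unfolding H_def by blast
  obtain R2 where R2: "R2 \<ge> R0" "\<forall>x\<in>X. R2 \<le> \<bar>x\<bar> \<longrightarrow>
    (b - \<delta>) * \<bar>x\<bar> powr (- (\<gamma> + 1)) \<le> mu x / \<bar>x\<bar> \<and> mu x / \<bar>x\<bar> \<le> (b + \<delta>) * \<bar>x\<bar> powr (- (\<gamma> + 1))"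
    using mu_bounds[OF \<epsilon>(2)] by blast
  obtain T R3 where T: "T \<ge> 2" and R3: "R3 > 0" "\<forall>T'\<ge>T. \<forall>r\<ge>R3. \<forall>N\<in>laws.
     (\<integral>t. \<bar>1 + t / r\<bar> powr \<nu> \<partial>N) - \<delta> * r powr (- \<alpha>) \<le> (\<integral>t. (min \<bar>1 + t / r\<bar> T') powr \<nu> \<partial>N)"
    using truncated_powr_asymp[OF \<nu> \<epsilon>(2)] by blast
  define R where "R = max R1 (max R2 R3)"
  have main: "\<bar>x\<bar> powr \<nu> \<le> (\<integral>z. (min \<bar>z\<bar> (T * y)) powr \<nu> \<partial>K x)"
    if x: "x \<in> X" "R \<le> \<bar>x\<bar>" and y: "\<bar>x\<bar> \<le> y" for x y
  proof -
    have x0: "R0 \<le> \<bar>x\<bar>" "\<bar>x\<bar> > 0" "x \<noteq> 0" using x R2 R0 by (auto simp: R_def)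
    define I where "I = scaled_moment \<nu> x"
    define J where "J = (\<integral>t. (min \<bar>1 + t / \<bar>x\<bar>\<bar> (T * y / \<bar>x\<bar>)) powr \<nu> \<partial>outward_law K x)"
    define p where "p = \<bar>x\<bar> powr (- \<alpha>)"
    have sc: "(min \<bar>\<bar>x\<bar> + t\<bar> (T * y)) powr \<nu> = \<bar>x\<bar> powr \<nu> * (min \<bar>1 + t / \<bar>x\<bar>\<bar> (T * y / \<bar>x\<bar>)) powr \<nu>" for t
    proof -
      have e: "\<bar>x\<bar> + t = \<bar>x\<bar> * (1 + t / \<bar>x\<bar>)" using x0 by (simp add: field_simps)
      have "\<bar>\<bar>x\<bar> + t\<bar> = \<bar>x\<bar> * \<bar>1 + t / \<bar>x\<bar>\<bar>" unfolding e by (simp add: abs_mult)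
      moreover have "T * y = \<bar>x\<bar> * (T * y / \<bar>x\<bar>)" using x0 by simp
      ultimately have "min \<bar>\<bar>x\<bar> + t\<bar> (T * y) = \<bar>x\<bar> * min \<bar>1 + t / \<bar>x\<bar>\<bar> (T * y / \<bar>x\<bar>)"
        using min_mult_distrib_left[of "\<bar>x\<bar>"] x0 by (metis abs_ge_zero)
      then show ?thesis by (simp add: powr_mult)
    qed
    have "T * \<bar>x\<bar> \<le> T * y" using y T by (intro mult_left_mono) auto
    \<comment> \<open>Relative to |x| the truncation level is at least T whenever |x| \<le> y, so
      one T works for all y.\<close>
    then have Ty: "T \<le> T * y / \<bar>x\<bar>" using x0 by (simp add: le_divide_eq)
    have "\<bar>I - 1 - \<nu> * (mu x / \<bar>x\<bar>) + c * \<nu> * H * p\<bar> \<le> \<delta> * p"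
      using R1(2) x unfolding I_def p_def R_def by auto
    then have "1 + \<nu> * (mu x / \<bar>x\<bar>) - c * \<nu> * H * p - \<delta> * p \<le> I" by (simp add: abs_le_iff)
    moreover have "\<nu> * ((b - \<delta>) * p) \<le> \<nu> * (mu x / \<bar>x\<bar>)"
      using R2(2) x \<nu> unfolding p_def \<gamma>' R_def by (intro mult_left_mono) auto
    moreover have "I - \<delta> * p \<le> J"
      using R3(2) Ty law_mem[OF x(1) x0(1)] x(2) unfolding I_def J_def p_def R_def by auto
    moreover have "\<nu> * ((b - \<delta>) * p) - c * \<nu> * H * p - \<delta> * p - \<delta> * p = (\<epsilon> - (\<nu> * \<delta> + \<delta> + \<delta>)) * p"
      unfolding \<epsilon>_def by (simp add: algebra_simps)
    ultimately have "1 \<le> J" unfolding \<epsilon>(3) by simp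
    then have "\<bar>x\<bar> powr \<nu> * 1 \<le> \<bar>x\<bar> powr \<nu> * J" by (intro mult_left_mono) auto
    also have "\<dots> = (\<integral>t. (min \<bar>\<bar>x\<bar> + t\<bar> (T * y)) powr \<nu> \<partial>outward_law K x)"
      unfolding sc J_def by simp
    also have "\<dots> = (\<integral>z. (min \<bar>z\<bar> (T * y)) powr \<nu> \<partial>K x)"
      using x0 by (intro integral_kernel_abs[where F="\<lambda>u. (min u (T * y)) powr \<nu>", symmetric]) auto
    finally show ?thesis by simp
  qed
  obtain H' L where HL: "H' > 0" "L \<ge> 1"
    "\<forall>h\<ge>H'. \<forall>n. real n \<le> h powr (\<gamma> + 1) \<longrightarrow> (\<forall>x\<in>X. L * h \<le> \<bar>x\<bar> \<longrightarrow> 1 / 2 \<le> survival K h n x)"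
    using persistence by blast
  show ?thesis
  proof (rule exI[of _ "max H' R"], intro allI ballI impI)
    fix a x assume a: "max H' R \<le> a" and x: "x \<in> X" "a < \<bar>x\<bar>"
    show "survival_Omega K a x (\<nu> / \<alpha>)"
    proof (rule survival_lower_subharmonic[OF _ \<nu>(1) HL(2) _ _ _ x, of \<alpha> T H'])
      show "1 / 2 \<le> survival K h n z" if "H' \<le> h" "real n \<le> h powr \<alpha>" "z \<in> X" "L * h \<le> \<bar>z\<bar>" for h n z
        using HL(3) that unfolding \<gamma>' by simp
      show "\<bar>w\<bar> powr \<nu> \<le> (\<integral>z. (min \<bar>z\<bar> (T * y)) powr \<nu> \<partial>K w)" if "w \<in> X" "a < \<bar>w\<bar>" "\<bar>w\<bar> \<le> y" for y w
        using that a by (intro main) auto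
    qed (use alpha T a HL(1) in auto)
  qed
qed

text \<open>The drift estimates need a strict inequality, so they are applied at an exponent \<mu>
  strictly between q \<alpha> and \<nu>, where strict monotonicity of the coefficient fixes the sign
  of the drift. The level \<open>a0\<close> depends on q through \<mu>.\<close>

lemma critical_moments:
  fixes q :: real
  assumes \<gamma>': "\<gamma> = \<alpha> - 1" and \<nu>: "0 < \<nu>" "\<nu> < \<alpha>" and b: "b = c * stable_coeff \<alpha> \<nu>" and q: "q > 0"
  shows "\<exists>a0. \<forall>a\<ge>a0. \<forall>x\<in>X. a < \<bar>x\<bar> \<longrightarrow> (\<forall>(M :: 'w measure) \<xi>. markov_chain_from M \<xi> K x \<longrightarrow>
    (q < \<nu> / \<alpha> \<longrightarrow> hit_moment M \<xi> a q < \<infinity>) \<and> (q > \<nu> / \<alpha> \<longrightarrow> hit_moment M \<xi> a q = \<infinity>))"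
proof -
  have \<alpha>0: "\<alpha> > 0" using alpha by simp
  consider "q < \<nu> / \<alpha>" | "q = \<nu> / \<alpha>" | "q > \<nu> / \<alpha>" by linarith
  then show ?thesis
  proof cases
    case 1
    then have "q * \<alpha> < \<nu>" using \<alpha>0 by (simp add: pos_less_divide_eq)
    then obtain \<mu> where \<mu>: "q * \<alpha> < \<mu>" "\<mu> < \<nu>" using dense by blast
    then have q\<mu>: "q < \<mu> / \<alpha>" using \<alpha>0 by (simp add: pos_less_divide_eq)
    have "0 < q * \<alpha>" using q \<alpha>0 by simp
    then have \<mu>0: "0 < \<mu>" "\<mu> < \<alpha>" using \<mu> \<nu> by auto
    have "b < c * stable_coeff \<alpha> \<mu>"
      using stable_coeff_strict_antimono[OF alpha \<mu>(2) \<nu>(2)] c unfolding b by simp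
    from critical_upper[OF \<gamma>' \<mu>0 this] show ?thesis
      using hit_moment_finite[OF K _ q q\<mu>] 1 by (meson less_asym)
  next
    case 3
    \<comment> \<open>Besides lying below q \<alpha>, the exponent must stay below \<alpha>, where
      the moments of the jumps are finite.\<close>
    then have "\<nu> < min (q * \<alpha>) \<alpha>" using \<alpha>0 \<nu> by (simp add: pos_divide_less_eq)
    then obtain \<mu> where \<mu>: "\<nu> < \<mu>" "\<mu> < q * \<alpha>" "\<mu> < \<alpha>" using dense by (metis min_less_iff_conj)
    then have \<mu>0: "0 < \<mu>" and q\<mu>: "\<mu> / \<alpha> \<le> q" using \<nu> \<alpha>0 by (auto simp: pos_divide_le_eq)
    have "c * stable_coeff \<alpha> \<mu> < b"
      using stable_coeff_strict_antimono[OF alpha \<mu>(1) \<mu>(3)] c unfolding b by simp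
    from critical_lower[OF \<gamma>' \<mu>0 \<mu>(3) this] show ?thesis
      using hit_moment_infinite[OF K _ q q\<mu>] 3 by (meson less_asym)
  qed auto
qed

lemma subcritical_moments:
  fixes q :: real
  assumes \<gamma>': "\<gamma> < \<alpha> - 1" and b: "b < 0" and q: "q > 0"
  shows "\<exists>a0. \<forall>a\<ge>a0. \<forall>x\<in>X. a < \<bar>x\<bar> \<longrightarrow> (\<forall>(M :: 'w measure) \<xi>. markov_chain_from M \<xi> K x \<longrightarrow>
    (q < \<alpha> / (\<gamma> + 1) \<longrightarrow> hit_moment M \<xi> a q < \<infinity>) \<and> (q \<ge> \<alpha> / (\<gamma> + 1) \<longrightarrow> hit_moment M \<xi> a q = \<infinity>))"
proof (cases "q < \<alpha> / (\<gamma> + 1)")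
  case True
  have g0: "\<gamma> + 1 > 0" using \<gamma> by simp
  have "q * (\<gamma> + 1) < \<alpha>" using True g0 by (simp add: pos_less_divide_eq)
  then obtain \<mu> where \<mu>: "q * (\<gamma> + 1) < \<mu>" "\<mu> < \<alpha>" using dense by blast
  then have q\<mu>: "q < \<mu> / (\<gamma> + 1)" using g0 by (simp add: pos_less_divide_eq)
  have "0 < q * (\<gamma> + 1)" using q g0 by simp
  then have "0 < \<mu>" using \<mu> by simp
  from subcritical_upper[OF \<gamma>' this \<mu>(2) b] show ?thesis
    using hit_moment_finite[OF K _ q q\<mu>] True by (meson not_le)
next
  case False
  then have "\<alpha> / (\<gamma> + 1) \<le> q" by simp
  from hit_moment_infinite[OF K _ q this] show ?thesis
    using subcritical_lower False by (meson not_le)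
qed

end

section \<open>From the stated conditions to outward laws\<close>

lemma heavy_tails_outward:
  assumes T: "T_out X K \<alpha> \<beta> c" and K: "K \<in> borel \<rightarrow>\<^sub>M prob_algebra borel"
  shows "\<exists>R0>0. \<exists>B. heavy_tails (outward_law K ` {x \<in> X. R0 \<le> \<bar>x\<bar>}) \<alpha> (min \<beta> 2) c B"
proof -
  obtain x0 where x0: "x0 \<ge> 0"
    and T1: "\<forall>\<epsilon>>0. \<exists>Y. \<forall>y\<ge>Y. \<forall>x\<in>X. x \<ge> x0 \<longrightarrow> \<bar>y powr \<alpha> * measure (K x) {z. ppart (z - x) > y} - c\<bar> \<le> \<epsilon>"
    and T2: "\<forall>\<epsilon>>0. \<exists>Y. \<forall>y\<ge>Y. \<forall>x\<in>X. x \<le> - x0 \<longrightarrow> \<bar>y powr \<alpha> * measure (K x) {z. npart (z - x) > y} - c\<bar> \<le> \<epsilon>"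
    and B1: "(SUP x\<in>{x\<in>X. x \<ge> x0}. \<integral>\<^sup>+z. ennreal (npart (z - x) powr \<beta>) \<partial>K x) < \<top>"
    and B2: "(SUP x\<in>{x\<in>X. x \<le> - x0}. \<integral>\<^sup>+z. ennreal (ppart (z - x) powr \<beta>) \<partial>K x) < \<top>"
    and pars: "1 < \<alpha>" "\<alpha> < 2" "\<beta> > \<alpha>" "c > 0"
    using T unfolding T_out_def by blast
  \<comment> \<open>At least 1, so that x is nonzero and its sign tells which half of the tail
    condition applies.\<close>
  define R0 where "R0 = max x0 1"
  obtain s1 where s1: "(SUP x\<in>{x\<in>X. x \<ge> x0}. \<integral>\<^sup>+z. ennreal (npart (z - x) powr \<beta>) \<partial>K x) = ennreal s1" "s1 \<ge> 0"
    using B1 by (cases "SUP x\<in>{x\<in>X. x \<ge> x0}. \<integral>\<^sup>+z. ennreal (npart (z - x) powr \<beta>) \<partial>K x") auto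
  obtain s2 where s2: "(SUP x\<in>{x\<in>X. x \<le> - x0}. \<integral>\<^sup>+z. ennreal (ppart (z - x) powr \<beta>) \<partial>K x) = ennreal s2" "s2 \<ge> 0"
    using B2 by (cases "SUP x\<in>{x\<in>X. x \<le> - x0}. \<integral>\<^sup>+z. ennreal (ppart (z - x) powr \<beta>) \<partial>K x") auto
  have step: "(\<lambda>z. sgn x * (z - x)) \<in> K x \<rightarrow>\<^sub>M borel" for x
    by (rule measurable_kernel[OF K]) measurable
  have tail: "measure (outward_law K x) {y<..} = measure (K x) {z. y < sgn x * (z - x)}" for x y
    unfolding outward_law_def by (subst measure_distr[OF step]) (auto simp: space_kernel[OF K] vimage_def)
  have split: "x \<ge> x0 \<and> sgn x = 1 \<or> x \<le> - x0 \<and> sgn x = - 1" if "R0 \<le> \<bar>x\<bar>" for x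
    using that by (auto simp: R0_def sgn_if abs_if split: if_splits)
  have "heavy_tails (outward_law K ` {x \<in> X. R0 \<le> \<bar>x\<bar>}) \<alpha> (min \<beta> 2) c (1 + max s1 s2)"
  proof (rule heavy_tails.intro)
    show "1 < \<alpha>" "\<alpha> < 2" "\<alpha> < min \<beta> 2" "min \<beta> 2 \<le> 2" "0 < c" "0 \<le> 1 + max s1 s2"
      using pars s1 by auto
  next
    fix N assume "N \<in> outward_law K ` {x \<in> X. R0 \<le> \<bar>x\<bar>}"
    then obtain x where x: "N = outward_law K x" "x \<in> X" "R0 \<le> \<bar>x\<bar>" by auto
    show "prob_space N" unfolding x outward_law_def
      by (rule prob_space.prob_space_distr[OF prob_space_kernel[OF K] step])
    show "sets N = sets borel" unfolding x outward_law_def by simp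
    have "(\<integral>\<^sup>+t. ennreal (npart t powr min \<beta> 2) \<partial>N) \<le> (\<integral>\<^sup>+t. 1 + ennreal (npart t powr \<beta>) \<partial>N)"
    proof (rule nn_integral_mono)
      fix t :: real
      \<comment> \<open>Capping the exponent at 2 costs an additive 1, hence the moment bound
        \<open>1 + max s1 s2\<close>.\<close>
      have "npart t powr min \<beta> 2 \<le> 1 + npart t powr \<beta>"
      proof (cases "npart t \<le> 1")
        case True
        then have "npart t powr min \<beta> 2 \<le> 1" using pars by (intro powr_le1) auto
        then show ?thesis by (simp add: add_increasing2)
      next
        case False
        then have "npart t powr min \<beta> 2 \<le> npart t powr \<beta>" by (intro powr_mono) auto
        then show ?thesis by simp
      qed
      then have "ennreal (npart t powr min \<beta> 2) \<le> ennreal (1 + npart t powr \<beta>)" by (rule ennreal_leI)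
      then show "ennreal (npart t powr min \<beta> 2) \<le> 1 + ennreal (npart t powr \<beta>)" by simp
    qed
    also have "\<dots> = 1 + (\<integral>\<^sup>+z. ennreal (npart (sgn x * (z - x)) powr \<beta>) \<partial>K x)"
    proof -
      interpret prob_space "K x" by (rule prob_space_kernel[OF K])
      have "(\<lambda>t. ennreal (npart t powr \<beta>)) \<in> borel_measurable borel" by measurable
      note m = measurable_compose[OF step[of x] this]
      have "(\<integral>\<^sup>+t. 1 + ennreal (npart t powr \<beta>) \<partial>N) = (\<integral>\<^sup>+z. 1 + ennreal (npart (sgn x * (z - x)) powr \<beta>) \<partial>K x)"
        unfolding x outward_law_def by (subst nn_integral_distr[OF step]) auto
      then show ?thesis using m by (simp add: nn_integral_add emeasure_space_1)
    qed
    also have "\<dots> \<le> 1 + ennreal (max s1 s2)"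
    proof (rule add_left_mono)
      show "(\<integral>\<^sup>+z. ennreal (npart (sgn x * (z - x)) powr \<beta>) \<partial>K x) \<le> ennreal (max s1 s2)"
        using split[OF x(3)]
      proof
        assume sx: "x0 \<le> x \<and> sgn x = 1"
        then have "(\<integral>\<^sup>+z. ennreal (npart (sgn x * (z - x)) powr \<beta>) \<partial>K x) \<le> ennreal s1"
          unfolding s1(1)[symmetric] using x by (intro SUP_upper2[of x]) auto
        also have "\<dots> \<le> ennreal (max s1 s2)" by (intro ennreal_leI) simp
        finally show ?thesis .
      next
        assume sx: "x \<le> - x0 \<and> sgn x = - 1"
        have "npart (- 1 * (z - x)) = ppart (z - x)" for z by (simp add: npart_def ppart_def)
        then have "(\<integral>\<^sup>+z. ennreal (npart (sgn x * (z - x)) powr \<beta>) \<partial>K x) \<le> ennreal s2"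
          unfolding s2(1)[symmetric] using x sx by (intro SUP_upper2[of x]) auto
        also have "\<dots> \<le> ennreal (max s1 s2)" by (intro ennreal_leI) simp
        finally show ?thesis .
      qed
    qed
    also have "\<dots> = ennreal (1 + max s1 s2)" using s1 by simp
    finally show "(\<integral>\<^sup>+t. ennreal (npart t powr min \<beta> 2) \<partial>N) \<le> ennreal (1 + max s1 s2)" .
  next
    fix \<epsilon> :: real assume e: "\<epsilon> > 0"
    obtain Y1 where Y1: "\<forall>y\<ge>Y1. \<forall>x\<in>X. x \<ge> x0 \<longrightarrow> \<bar>y powr \<alpha> * measure (K x) {z. ppart (z - x) > y} - c\<bar> \<le> \<epsilon>"
      using T1 e by blast
    obtain Y2 where Y2: "\<forall>y\<ge>Y2. \<forall>x\<in>X. x \<le> - x0 \<longrightarrow> \<bar>y powr \<alpha> * measure (K x) {z. npart (z - x) > y} - c\<bar> \<le> \<epsilon>"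
      using T2 e by blast
    show "\<exists>Y. \<forall>y\<ge>Y. \<forall>N\<in>outward_law K ` {x \<in> X. R0 \<le> \<bar>x\<bar>}. \<bar>y powr \<alpha> * measure N {y<..} - c\<bar> \<le> \<epsilon>"
    \<comment> \<open>For y \<ge> 0 the positive part exceeds y exactly when the increment does; for
      negative y the two events differ.\<close>
    proof (intro exI[of _ "max 0 (max Y1 Y2)"] allI impI ballI)
      fix y N assume y: "max 0 (max Y1 Y2) \<le> y" and "N \<in> outward_law K ` {x \<in> X. R0 \<le> \<bar>x\<bar>}"
      then obtain x where x: "N = outward_law K x" "x \<in> X" "R0 \<le> \<bar>x\<bar>" by auto
      show "\<bar>y powr \<alpha> * measure N {y<..} - c\<bar> \<le> \<epsilon>"
        using split[OF x(3)]
      proof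
        assume sx: "x0 \<le> x \<and> sgn x = 1"
        have "{z. y < sgn x * (z - x)} = {z. ppart (z - x) > y}" using sx y by (auto simp: ppart_def)
        then show ?thesis unfolding x tail using Y1 x sx y by simp
      next
        assume sx: "x \<le> - x0 \<and> sgn x = - 1"
        have "{z. y < sgn x * (z - x)} = {z. npart (z - x) > y}" using sx y by (auto simp: npart_def)
        then show ?thesis unfolding x tail using Y2 x sx y by simp
      qed
    qed
  qed
  moreover have "R0 > 0" by (simp add: R0_def)
  ultimately show ?thesis by blast
qed

lemma outward_drift:
  assumes D: "D' X K \<gamma> b" and K: "K \<in> borel \<rightarrow>\<^sub>M prob_algebra borel" and e: "\<epsilon> > 0"
  shows "\<exists>R. \<forall>x\<in>X. R \<le> \<bar>x\<bar> \<longrightarrow> \<bar>\<bar>x\<bar> powr \<gamma> * (\<integral>t. t \<partial>outward_law K x) - b\<bar> \<le> \<epsilon>"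
proof -
  have step: "(\<lambda>z. sgn x * (z - x)) \<in> K x \<rightarrow>\<^sub>M borel" for x
    by (rule measurable_kernel[OF K]) measurable
  have mu: "(\<integral>t. t \<partial>outward_law K x) = sgn x * drift K x" for x
    unfolding outward_law_def drift_def by (subst integral_distr[OF step]) auto
  have d: "((\<lambda>x. x powr \<gamma> * drift K x) \<longlongrightarrow> b) (inf at_top (principal X))"
    "((\<lambda>x. - (\<bar>x\<bar> powr \<gamma> * drift K x)) \<longlongrightarrow> b) (inf at_bot (principal X))"
    using D by (auto simp: D'_def)
  have "eventually (\<lambda>x. dist (x powr \<gamma> * drift K x) b < \<epsilon>) (inf at_top (principal X))"
    using tendstoD[OF d(1) e] .
  then obtain R1 where R1: "\<And>x. x \<ge> R1 \<Longrightarrow> x \<in> X \<Longrightarrow> dist (x powr \<gamma> * drift K x) b < \<epsilon>"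
    unfolding eventually_inf_principal eventually_at_top_linorder by blast
  have "eventually (\<lambda>x. dist (- (\<bar>x\<bar> powr \<gamma> * drift K x)) b < \<epsilon>) (inf at_bot (principal X))"
    using tendstoD[OF d(2) e] .
  then obtain R2 where R2: "\<And>x. x \<le> R2 \<Longrightarrow> x \<in> X \<Longrightarrow> dist (- (\<bar>x\<bar> powr \<gamma> * drift K x)) b < \<epsilon>"
    unfolding eventually_inf_principal eventually_at_bot_linorder by blast
  show ?thesis
  proof (intro exI[of _ "max 1 (max R1 (- R2))"] ballI impI)
    fix x assume x: "x \<in> X" "max 1 (max R1 (- R2)) \<le> \<bar>x\<bar>"
    show "\<bar>\<bar>x\<bar> powr \<gamma> * (\<integral>t. t \<partial>outward_law K x) - b\<bar> \<le> \<epsilon>"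
    proof (cases "x > 0")
      case True
      then show ?thesis using R1[of x] x unfolding mu by (simp add: dist_real_def)
    next
      case False
      then have "x < 0" "x \<le> R2" using x by auto
      then show ?thesis using R2[of x] x unfolding mu by (simp add: dist_real_def)
    qed
  qed
qed

text \<open>A factor |x|^(s - \<gamma>) is left over, and it tends to 0. It is applied with s =
  \<alpha> - 1.\<close>

lemma outward_drift_negligible:
  assumes D: "D' X K \<gamma> b" and K: "K \<in> borel \<rightarrow>\<^sub>M prob_algebra borel" and e: "\<epsilon> > 0" and s: "s < \<gamma>"
  shows "\<exists>R. \<forall>x\<in>X. R \<le> \<bar>x\<bar> \<longrightarrow> \<bar>\<bar>x\<bar> powr s * (\<integral>t. t \<partial>outward_law K x) - 0\<bar> \<le> \<epsilon>"
proof -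
  obtain R1 where R1: "\<forall>x\<in>X. R1 \<le> \<bar>x\<bar> \<longrightarrow> \<bar>\<bar>x\<bar> powr \<gamma> * (\<integral>t. t \<partial>outward_law K x) - b\<bar> \<le> 1"
    using outward_drift[OF D K zero_less_one] by blast
  obtain R2 where R2: "\<forall>r\<ge>R2. (\<bar>b\<bar> + 1) * r powr (- (\<gamma> - s)) \<le> \<epsilon>"
    using eventually_powr_small[of "\<gamma> - s" \<epsilon> "\<bar>b\<bar> + 1"] e s by auto
  show ?thesis
  proof (intro exI[of _ "max R1 R2"] ballI impI)
    fix x assume x: "x \<in> X" "max R1 R2 \<le> \<bar>x\<bar>"
    let ?m = "\<integral>t. t \<partial>outward_law K x"
    have "\<bar>\<bar>x\<bar> powr \<gamma> * ?m\<bar> \<le> \<bar>b\<bar> + 1" using R1 x by fastforce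
    then have "\<bar>\<bar>x\<bar> powr \<gamma> * ?m\<bar> * \<bar>x\<bar> powr (- (\<gamma> - s)) \<le> (\<bar>b\<bar> + 1) * \<bar>x\<bar> powr (- (\<gamma> - s))"
      by (rule mult_right_mono) simp
    also have "\<dots> \<le> \<epsilon>" using R2 x by simp
    also have "\<bar>\<bar>x\<bar> powr \<gamma> * ?m\<bar> * \<bar>x\<bar> powr (- (\<gamma> - s)) = \<bar>\<bar>x\<bar> powr s * ?m - 0\<bar>"
      by (simp add: abs_mult powr_diff powr_minus_divide)
    finally show "\<bar>\<bar>x\<bar> powr s * ?m - 0\<bar> \<le> \<epsilon>" .
  qed
qed

lemma heavy_chain_of_conditions:
  assumes X: "X \<in> sets borel" and kernel: "is_kernel_on X K" and T: "T_out X K \<alpha> \<beta> c"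
    and \<gamma>: "0 \<le> \<gamma>" "\<gamma> \<le> \<alpha> - 1"
    and drift: "\<And>\<epsilon>. \<epsilon> > 0 \<Longrightarrow> \<exists>R. \<forall>x\<in>X. R \<le> \<bar>x\<bar> \<longrightarrow> \<bar>\<bar>x\<bar> powr \<gamma> * (\<integral>t. t \<partial>outward_law K x) - b\<bar> \<le> \<epsilon>"
  shows "\<exists>R0 B. heavy_chain X K R0 \<alpha> (min \<beta> 2) c B \<gamma> b"
proof -
  have K: "K \<in> borel \<rightarrow>\<^sub>M prob_algebra borel" and KX: "\<And>x. x \<in> X \<Longrightarrow> emeasure (K x) X = 1"
    using kernel by (auto simp: is_kernel_on_def)
  obtain R0 B where R: "R0 > 0" "heavy_tails (outward_law K ` {x \<in> X. R0 \<le> \<bar>x\<bar>}) \<alpha> (min \<beta> 2) c B"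
    using heavy_tails_outward[OF T K] by blast
  have "heavy_chain X K R0 \<alpha> (min \<beta> 2) c B \<gamma> b"
    using K KX R X \<gamma> drift by (intro heavy_chain.intro markov_kernel.intro heavy_chain_axioms.intro) auto
  then show ?thesis by blast
qed

theorem theorem2p4:
  fixes X :: "real set" and K :: "real \<Rightarrow> real measure"
    and \<alpha> \<beta> c \<gamma> b q :: real
  assumes X_meas: "X \<in> sets borel" and X_inf: "infinite X" and X_unb: "\<not> bounded X"
    and kernel: "is_kernel_on X K"
    and T: "T_out X K \<alpha> \<beta> c"
    and D: "D' X K \<gamma> b"
    and q: "q > 0"
  shows "\<exists>a0. \<forall>a\<ge>a0. \<forall>x\<in>X. \<bar>x\<bar> > a \<longrightarrow>
     (\<forall>(M :: 'w measure). \<forall>\<xi>. markov_chain_from M \<xi> K x \<longrightarrow>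
       (\<gamma> > \<alpha> - 1 \<longrightarrow>
          (q < 1 / \<alpha> \<longrightarrow> hit_moment M \<xi> a q < \<infinity>) \<and>
          (q > 1 / \<alpha> \<longrightarrow> hit_moment M \<xi> a q = \<infinity>)) \<and>
       (\<gamma> = \<alpha> - 1 \<and> b < c * pi * \<bar>1 / sin (pi * \<alpha>)\<bar> \<longrightarrow>
          (\<exists>!\<nu>. 0 < \<nu> \<and> \<nu> < \<alpha> \<and>
              b / c = (\<nu> - 1) * (Gamma (1 - \<alpha>) * Gamma (\<alpha> - \<nu>) / Gamma (2 - \<nu>))) \<and>
          (\<forall>\<nu>. 0 < \<nu> \<and> \<nu> < \<alpha> \<and>
              b / c = (\<nu> - 1) * (Gamma (1 - \<alpha>) * Gamma (\<alpha> - \<nu>) / Gamma (2 - \<nu>)) \<longrightarrow>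
            (q < \<nu> / \<alpha> \<longrightarrow> hit_moment M \<xi> a q < \<infinity>) \<and>
            (q > \<nu> / \<alpha> \<longrightarrow> hit_moment M \<xi> a q = \<infinity>))) \<and>
       (\<gamma> < \<alpha> - 1 \<and> b < 0 \<longrightarrow>
          (q < \<alpha> / (\<gamma> + 1) \<longrightarrow> hit_moment M \<xi> a q < \<infinity>) \<and>
          (q \<ge> \<alpha> / (\<gamma> + 1) \<longrightarrow> hit_moment M \<xi> a q = \<infinity>)))"
proof -
  have \<alpha>: "1 < \<alpha>" "\<alpha> < 2" and c: "c > 0" using T by (auto simp: T_out_def)
  have \<gamma>: "0 \<le> \<gamma>" using D by (simp add: D'_def)
  have K: "K \<in> borel \<rightarrow>\<^sub>M prob_algebra borel" using kernel by (simp add: is_kernel_on_def)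
  consider (above) "\<gamma> > \<alpha> - 1" | (critical) "\<gamma> = \<alpha> - 1" "b < c * pi * \<bar>1 / sin (pi * \<alpha>)\<bar>"
    | (below) "\<gamma> < \<alpha> - 1" "b < 0" | (other) "\<not> \<gamma> > \<alpha> - 1" "\<not> (\<gamma> = \<alpha> - 1 \<and> b < c * pi * \<bar>1 / sin (pi * \<alpha>)\<bar>)" "\<not> (\<gamma> < \<alpha> - 1 \<and> b < 0)"
    by blast
  then show ?thesis
  proof cases
    case above
    obtain R0 B where "heavy_chain X K R0 \<alpha> (min \<beta> 2) c B (\<alpha> - 1) 0"
      using heavy_chain_of_conditions[OF X_meas kernel T _ order_refl outward_drift_negligible[OF D K _ above]] \<alpha> by auto
    then interpret heavy_chain X K R0 \<alpha> "min \<beta> 2" c B "\<alpha> - 1" 0 .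
    have "0 = c * stable_coeff \<alpha> 1" by (simp add: stable_coeff_def)
    from critical_moments[OF refl zero_less_one \<alpha>(1) this q, where 'w='w]
    show ?thesis using above by auto
  next
    case critical
    obtain R0 B where "heavy_chain X K R0 \<alpha> (min \<beta> 2) c B \<gamma> b"
      using heavy_chain_of_conditions[OF X_meas kernel T \<gamma> _ outward_drift[OF D K]] critical by auto
    then interpret heavy_chain X K R0 \<alpha> "min \<beta> 2" c B \<gamma> b .
    have "b / c < pi * \<bar>1 / sin (pi * \<alpha>)\<bar>" using critical c by (simp add: pos_divide_less_eq mult_ac)
    from stable_coeff_root[OF \<alpha> this]
    have ex1: "\<exists>!\<nu>. 0 < \<nu> \<and> \<nu> < \<alpha> \<and> b / c = stable_coeff \<alpha> \<nu>" .
    then obtain \<nu> where \<nu>: "0 < \<nu>" "\<nu> < \<alpha>" "b / c = stable_coeff \<alpha> \<nu>" by blast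
    have "b = c * stable_coeff \<alpha> \<nu>" unfolding \<nu>(3)[symmetric] using c by simp
    from critical_moments[OF critical(1) \<nu>(1,2) this q, where 'w='w] obtain a0 where a0:
      "\<forall>a\<ge>a0. \<forall>x\<in>X. a < \<bar>x\<bar> \<longrightarrow> (\<forall>(M :: 'w measure) \<xi>. markov_chain_from M \<xi> K x \<longrightarrow>
        (q < \<nu> / \<alpha> \<longrightarrow> hit_moment M \<xi> a q < \<infinity>) \<and> (q > \<nu> / \<alpha> \<longrightarrow> hit_moment M \<xi> a q = \<infinity>))" by blast
    have uniq: "\<nu>' = \<nu>" if "0 < \<nu>' \<and> \<nu>' < \<alpha> \<and> b / c = stable_coeff \<alpha> \<nu>'" for \<nu>'
      using ex1 \<nu> that by blast
    show ?thesis unfolding stable_coeff_def[symmetric]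
    proof (intro exI[of _ a0] allI ballI impI conjI ex1)
      fix a x \<nu>' and M :: "'w measure" and \<xi>
      assume h: "a0 \<le> a" "x \<in> X" "a < \<bar>x\<bar>" "markov_chain_from M \<xi> K x"
        and \<nu>': "0 < \<nu>' \<and> \<nu>' < \<alpha> \<and> b / c = stable_coeff \<alpha> \<nu>'"
      show "hit_moment M \<xi> a q < \<infinity>" if "q < \<nu>' / \<alpha>"
        using a0 h that unfolding uniq[OF \<nu>'] by blast
      show "hit_moment M \<xi> a q = \<infinity>" if "\<nu>' / \<alpha> < q"
        using a0 h that unfolding uniq[OF \<nu>'] by blast
    qed (use critical in auto)
  next
    case below
    obtain R0 B where "heavy_chain X K R0 \<alpha> (min \<beta> 2) c B \<gamma> b"
      using heavy_chain_of_conditions[OF X_meas kernel T \<gamma> _ outward_drift[OF D K]] below by auto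
    then interpret heavy_chain X K R0 \<alpha> "min \<beta> 2" c B \<gamma> b .
    from subcritical_moments[OF below q, where 'w='w] show ?thesis using below by auto
  next
    case other
    \<comment> \<open>The premises of all three cases fail, so any \<open>a0\<close> will
      do.\<close>
    then show ?thesis by blast
  qed
qed

end
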